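(* Let $D<-4$ be the discriminant of an imaginary quadratic field, $N=|D|$, $\chi=\chi_D$, $h(D)$ the class number, and let $B>1$ be an integer with $\gcd(B,N)=1$. Let $e$ be the multiplicative order of $B$ modulo $N$, let $X=\{x\in\mathbb{Z}: 1\le x\le N,\ \gcd(x,N)=1\}$, and let $C_1,\dots,C_f$ (with $f=\phi(N)/e$) be the $B$-cycles on $X$. Write $C_j=(x_1^{(j)},x_2^{(j)},\dots,x_e^{(j)})$ for $1\le j\le f$, and let $a_1^{(j)}a_2^{(j)}\cdots a_e^{(j)}$ be the period of the base $B$ expansion of $x_1^{(j)}/N$, i.e. $\frac{x_1^{(j)}}{N}=0.\overline{a_1^{(j)}a_2^{(j)}\cdots a_e^{(j)}}_{(B)}$. (1) If $\chi(B)=-1$ and all the cycles $C_j$ are normalized (that is, the initial term satisfies $\chi(x_1^{(j)})=1$ for every $j$), then $$(B+1)\,h(D)=\sum_{j=1}^{f}\sum_{i=1}^{e}(-1)^i a_i^{(j)}.$$ (2) If $\chi(B)=1$, then $$(B-1)\,h(D)=-\sum_{j=1}^{f}\chi(C_j)\sum_{i=1}^{e}a_i^{(j)},$$ where $\chi(C_j)\in\{1,-1\}$ denotes the common value of $\chi$ on the elements of $C_j$.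
   Context: Discriminant and character: let $K=\mathbb{Q}(\sqrt m)$ with $m$ a negative square-free integer. Its discriminant is $D=m$ if $m\equiv 1\pmod 4$ and $D=4m$ otherwise. $h(D)$ is the order of the ideal class group of $K$. The quadratic character $\chi_D:\mathbb{Z}\to\{0,1,-1\}$ modulo $N=|D|$ satisfies $\chi_D(x)=0$ if $\gcd(x,N)>1$, and for $\gcd(x,N)=1$ it is given by: $\chi_D(x)=\left(\frac{x}{|m|}\right)$ (Jacobi symbol) if $D=m\equiv1\pmod 4$; and for $D=4m$: $\chi_D(x)=\chi_4(x)\left(\frac{x}{|m|}\right)$ if $m\equiv3\pmod4$; $\chi_D(x)=\chi_8(x)\left(\frac{x}{|n|}\right)$ if $m=2n$, $n\equiv1\pmod4$; $\chi_D(x)=\chi_4(x)\chi_8(x)\left(\frac{x}{|n|}\right)$ if $m=2n$, $n\equiv3\pmod4$. Here, for odd $x$, $\chi_4(x)=(-1)^{(x-1)/2}$ and $\chi_8(x)=(-1)^{(x^2-1)/8}$. It is an odd character: $\chi_D(-1)=-1$. Base $B$ expansions and cycles: for $x\in X$, put $x_1=x$ and define recursively $Bx_i=a_iN+x_{i+1}$ by division with remainder, $0\le x_{i+1}<N$. Then each $x_i\in X$, each $a_i\in\{0,1,\dots,B-1\}$, $\frac{x}{N}=\sum_{i\ge1}a_i/B^i$ is the base $B$ expansion of $x/N$, and the sequences $(x_i)$, $(a_i)$ are periodic with period $e$, with $x_1,\dots,x_e$ distinct; one writes $x/N=0.\overline{a_1\cdots a_e}_{(B)}$. The sequence $(x_1,\dots,x_e)$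 is called a $B$-cycle; any of its elements may be chosen as initial term (equivalently, the $B$-cycles are the cycles of the permutation of $X$ sending $x$ to the element of $X$ congruent to $Bx$ modulo $N$). If $\chi(B)=-1$, a cycle is called normalized if its initial term $x_1$ satisfies $\chi(x_1)=1$. If $\chi(B)=1$, then $\chi$ is constant on each cycle $C$, and $\chi(C)$ denotes this constant value. *)

theory Defs
  imports
    "HOL-Algebra.Algebra"
    "HOL-Algebra.Algebraic_Closure_Type"
    "HOL-Number_Theory.Number_Theory"
    "HOL-Computational_Algebra.Computational_Algebra"
begin

section \<open>Imaginary quadratic fields and their class numbers\<close>

text \<open>Number fields are realised as subsets of the complex numbers.\<close>

definition quadratic_field :: "int \<Rightarrow> complex set" where
  "quadratic_field m = {of_rat a + of_rat b * csqrt (of_int m) | a b. True}"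

definition quadratic_discriminant :: "int \<Rightarrow> int" where
  "quadratic_discriminant m = (if m mod 4 = 1 then m else 4 * m)"

definition complex_subring :: "complex set \<Rightarrow> complex ring" where
  "complex_subring A = ring_of_type_algebra\<lparr>carrier := A\<rparr>"

definition ring_of_integers :: "complex set \<Rightarrow> complex set" where
  "ring_of_integers K = {z \<in> K. algebraic_int z}"

text \<open>A fractional ideal is \<open>J / d\<close> for a nonzero integral ideal \<open>J\<close> and a nonzero
  integer \<open>d\<close> of the field.\<close>

definition fractional_ideals :: "complex set \<Rightarrow> complex set set" where
  "fractional_ideals K =
     {(\<lambda>z. z / d) ` J | d J. d \<in> ring_of_integers K \<and> d \<noteq> 0 \<and>
        ideal J (complex_subring (ring_of_integers K)) \<and> J \<noteq> {0}}"

definition principal_fractional_ideals :: "complex set \<Rightarrow> complex set set" where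
  "principal_fractional_ideals K =
     {(\<lambda>z. c * z) ` ring_of_integers K | c. c \<in> K \<and> c \<noteq> 0}"

text \<open>The library's \<^const>\<open>ideal_prod\<close> is the closure under addition of the set of products
  of elements of two arbitrary sets, so over the field it is the product of fractional ideals.\<close>

definition fractional_ideal_group :: "complex set \<Rightarrow> complex set monoid" where
  "fractional_ideal_group K =
     \<lparr>carrier = fractional_ideals K,
      monoid.mult = ideal_prod (complex_subring K),
      one = ring_of_integers K\<rparr>"

definition ideal_class_group :: "complex set \<Rightarrow> complex set set monoid" where
  "ideal_class_group K = fractional_ideal_group K Mod principal_fractional_ideals K"

definition class_number :: "complex set \<Rightarrow> nat" where
  "class_number K = Coset.order (ideal_class_group K)"


section \<open>The quadratic character\<close>

text \<open>The Jacobi symbol, for odd positive \<open>n\<close>; it is \<open>1\<close> for \<open>n = 1\<close>.\<close>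

definition jacobi_symbol :: "int \<Rightarrow> int \<Rightarrow> int" where
  "jacobi_symbol x n = (\<Prod>p\<in>#prime_factorization n. Legendre x p)"

text \<open>The next two are meant for odd arguments only. As the base is \<open>-1\<close>, taking the absolute
  value of the exponent does not change the value at negative arguments.\<close>

definition chi4 :: "int \<Rightarrow> int" where
  "chi4 x = (-1) ^ nat \<bar>(x - 1) div 2\<bar>"

definition chi8 :: "int \<Rightarrow> int" where
  "chi8 x = (-1) ^ nat ((x\<^sup>2 - 1) div 8)"

text \<open>The character \<open>\<chi>\<^sub>D\<close> of the field \<open>\<rat>(\<surd>m)\<close> of discriminant \<open>D\<close>, as a function of \<open>m\<close>;
  the last two cases are those of \<open>m = 2n\<close>, with \<open>n\<close> odd as \<open>m\<close> is square-free.\<close>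

definition quadratic_character :: "int \<Rightarrow> int \<Rightarrow> int" where
  "quadratic_character m x =
     (if gcd x \<bar>quadratic_discriminant m\<bar> > 1 then 0
      else if m mod 4 = 1 then jacobi_symbol x \<bar>m\<bar>
      else if m mod 4 = 3 then chi4 x * jacobi_symbol x \<bar>m\<bar>
      else if (m div 2) mod 4 = 1 then chi8 x * jacobi_symbol x \<bar>m div 2\<bar>
      else chi4 x * chi8 x * jacobi_symbol x \<bar>m div 2\<bar>)"


section \<open>Base \<open>B\<close> cycles and expansions\<close>

definition unit_residues :: "int \<Rightarrow> int set" where
  "unit_residues N = {x. 1 \<le> x \<and> x \<le> N \<and> gcd x N = 1}"

text \<open>A \<open>B\<close>-cycle \<open>(x\<^sub>1, \<dots>, x\<^sub>e)\<close> is a list of length the order of \<open>B\<close> modulo \<open>N\<close>, with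
  \<open>x\<^sub>i\<close> at list position \<open>i - 1\<close>, and \<open>x\<^bsub>i+1\<^esub>\<close> the remainder of \<open>B x\<^sub>i\<close> on division by \<open>N\<close>.\<close>

definition B_cycle :: "int \<Rightarrow> int \<Rightarrow> int list \<Rightarrow> bool" where
  "B_cycle B N c \<longleftrightarrow>
     (\<exists>x \<in> unit_residues N. c = map (\<lambda>i. ((\<lambda>y. (B * y) mod N) ^^ i) x) [0..<ord (nat N) (nat B)])"

text \<open>\<open>C\<^sub>1, \<dots>, C\<^sub>f\<close> are the \<open>B\<close>-cycles: each cycle is listed exactly once, with an arbitrary
  choice of its initial term.\<close>

definition lists_B_cycles :: "int \<Rightarrow> int \<Rightarrow> nat \<Rightarrow> (nat \<Rightarrow> int list) \<Rightarrow> bool" where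
  "lists_B_cycles B N f C \<longleftrightarrow>
     (\<forall>j\<in>{1..f}. B_cycle B N (C j)) \<and>
     (\<forall>c. B_cycle B N c \<longrightarrow> (\<exists>!j. j \<in> {1..f} \<and> (\<exists>k. C j = rotate k c)))"

text \<open>The value \<open>\<chi>(C)\<close> of a function that is constant on the cycle \<open>C\<close>.\<close>

definition common_value :: "(int \<Rightarrow> int) \<Rightarrow> int list \<Rightarrow> int" where
  "common_value g c = (THE v. \<forall>x\<in>set c. g x = v)"

text \<open>\<open>r = 0.(a\<^sub>1 \<dots> a\<^sub>e)\<close> in base \<open>B\<close> with the whole block \<open>a\<^sub>1 \<dots> a\<^sub>e\<close> repeated.\<close>

definition periodic_expansion :: "int \<Rightarrow> int list \<Rightarrow> real \<Rightarrow> bool" where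
  "periodic_expansion B as r \<longleftrightarrow>
     as \<noteq> [] \<and> set as \<subseteq> {0..<B} \<and>
     (\<lambda>i. of_int (as ! (i mod length as)) / of_int B ^ Suc i) sums r"

text \<open>The digits that long division attaches to a cycle, \<open>B x\<^sub>i = a\<^sub>i N + x\<^bsub>i+1\<^esub>\<close>, are the
  period of the expansion of \<open>x\<^sub>1 / N\<close>.\<close>

lemma B_cycle_periodic_expansion:
  assumes B: "B > 1" and N: "N > 1" and cop: "gcd B N = 1" and c: "B_cycle B N c"
  shows "periodic_expansion B (map (\<lambda>x. (B * x) div N) c) (of_int (c ! 0) / of_int N)"
proof -
  define e where "e = ord (nat N) (nat B)"
  obtain x where x: "x \<in> unit_residues N"
    and ce: "c = map (\<lambda>i. ((\<lambda>y. (B * y) mod N) ^^ i) x) [0..<e]"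
    using c unfolding B_cycle_def e_def by blast
  define y where "y = (\<lambda>i. ((\<lambda>y. (B * y) mod N) ^^ i) x)"
  have xN: "1 \<le> x" "x < N"
    using x N unfolding unit_residues_def by (auto simp: order.order_iff_strict)
  have cn: "coprime (nat N) (nat B)"
  proof -
    have "coprime N B" using cop by (metis coprime_iff_gcd_eq_1 gcd.commute)
    hence "coprime (int (nat N)) (int (nat B))" using B N by simp
    thus ?thesis by (simp only: coprime_int_iff)
  qed
  have epos: "e > 0" using cn unfolding e_def by (simp add: coprime_ord)
  have ysuc: "y (Suc i) = (B * y i) mod N" for i by (simp add: y_def)
  have y0: "y 0 = x" by (simp add: y_def)
  have yb: "0 \<le> y i \<and> y i < N" for i
    using xN N by (cases i) (auto simp: y0 ysuc)
  have ypow: "y i = (B ^ i * x) mod N" for i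
  proof (induction i)
    case 0 then show ?case using xN by (simp add: y0)
  next
    case (Suc i) then show ?case by (simp add: ysuc mod_mult_right_eq mult.assoc)
  qed
  have "[nat B ^ e = 1] (mod nat N)" using ord unfolding e_def by blast
  hence "[int (nat B ^ e) = int 1] (mod int (nat N))" by (simp only: cong_int_iff)
  hence Be: "[B ^ e = 1] (mod N)" using B N by simp
  have yper: "y (i + e) = y i" for i
  proof -
    have "[B ^ i * x * B ^ e = B ^ i * x * 1] (mod N)" using Be by (rule cong_scalar_left)
    then show ?thesis unfolding ypow cong_def by (simp add: power_add mult_ac)
  qed
  have ymod: "y (i mod e) = y i" for i
  proof -
    have "y (r + k * e) = y r" for r k
    proof (induction k)
      case (Suc k)
      then show ?case using yper[of "r + k * e"] by (simp add: add_ac)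
    qed simp
    from this[of "i mod e" "i div e"] show ?thesis by simp
  qed
  define a where "a = (\<lambda>i. (B * y i) div N)"
  have ab: "0 \<le> a i \<and> a i < B" for i
  proof -
    have "B * y i < B * N" using yb[of i] B by simp
    hence "a i < B" using N unfolding a_def by (smt (verit) div_mult_mod_eq mult_right_less_imp_less pos_mod_sign)
    moreover have "0 \<le> a i" using yb[of i] B N by (simp add: a_def pos_imp_zdiv_nonneg_iff)
    ultimately show ?thesis by simp
  qed
  have step: "B * y i = a i * N + y (Suc i)" for i by (simp add: a_def ysuc)
  define g where "g = (\<lambda>i. real_of_int (y i) / real_of_int N / real_of_int B ^ i)"
  have tel: "real_of_int (a i) / real_of_int B ^ Suc i = g i - g (Suc i)" for i
  proof -
    have "real_of_int B * y i = a i * real_of_int N + y (Suc i)"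
      by (metis step of_int_add of_int_mult)
    then show ?thesis using B N by (simp add: g_def field_simps)
  qed
  have "g \<longlonglongrightarrow> 0"
  proof (rule tendsto_sandwich)
    show "\<forall>\<^sub>F n in sequentially. 0 \<le> g n"
      using yb N B by (intro always_eventually) (simp add: g_def)
    show "\<forall>\<^sub>F n in sequentially. g n \<le> (1 / real_of_int B) ^ n"
    proof (intro always_eventually allI)
      fix n
      have "real_of_int (y n) / real_of_int N \<le> 1" using yb[of n] N by simp
      then show "g n \<le> (1 / real_of_int B) ^ n"
        unfolding g_def power_one_over using B by (intro divide_right_mono) auto
    qed
    show "(\<lambda>n. (1 / real_of_int B) ^ n) \<longlonglongrightarrow> 0" using B by (intro LIMSEQ_realpow_zero) auto
  qed simp
  from telescope_sums'[OF this]
  have "(\<lambda>i. real_of_int (a i) / real_of_int B ^ Suc i) sums (g 0)" by (simp only: tel) simp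
  moreover have "map (\<lambda>x. (B * x) div N) c ! (i mod e) = a i" for i
    using epos by (simp add: ce a_def flip: y_def, simp add: ymod)
  moreover have "set (map (\<lambda>x. (B * x) div N) c) \<subseteq> {0..<B}"
    using ab unfolding ce a_def y_def by auto
  moreover have "g 0 = of_int (c ! 0) / of_int N" using epos by (simp add: g_def ce y0)
  moreover have "length c = e" by (simp add: ce)
  ultimately show ?thesis using epos unfolding periodic_expansion_def by auto
qed

end

theory Submission
  imports Defs "HOL-Analysis.Analysis"
begin

hide_const (open) Divisibility.prime Polynomials.lead_coeff Polynomials.degree
  up_ring.coeff up_ring.monom module.smult

text \<open>
  Summing the long division \<open>B x = a N + x'\<close> over all residues \<open>x\<close>, weighted with \<open>\<chi> x\<close>,
  expresses the digit sums of the theorem by \<open>\<Sum> x \<chi>(x)\<close>: the remainders \<open>x'\<close> run through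
  the same residues, with \<open>\<chi> x' = \<chi> B \<chi> x\<close>. So the theorem amounts to the class number
  formula \<open>N h = - \<Sum> x \<chi>(x)\<close> (\<open>class_number_formula\<close>), together with the facts that the
  cycles list every residue once and that an expansion determines its digits.

  The class number formula is read off at \<open>t \<rightarrow> 0\<close> from the function
  \<open>S(t) = \<Sum> exp (- t N(I))\<close>, the sum being over the nonzero ideals \<open>I\<close> of the ring of
  integers. It has two expansions \<open>A / t + constant + o(1)\<close>, with different descriptions of
  the constant; this is the value at \<open>0\<close> of the Dedekind zeta function. Working at \<open>0\<close>
  rather than at \<open>1\<close> gives \<open>\<Sum> x \<chi>(x)\<close> directly instead of \<open>L(1, \<chi>)\<close>; the coefficient \<open>A\<close>
  cancels.

  The first expansion sorts the ideals by classes. The ideals in the class of \<open>J\<close> are the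
  multiples \<open>c J\<close>, where \<open>c\<close> runs through the lattice \<open>{c. c J \<subseteq> O}\<close> without \<open>0\<close>, and \<open>c\<close> is
  unique up to sign because the only units are \<open>1\<close> and \<open>-1\<close>; this is the place where \<open>D < -4\<close>
  enters. So a class contributes \<open>(\<Theta>(t) - 1) / 2\<close> for the theta series \<open>\<Theta>\<close> of a lattice. As
  \<open>\<Theta>(t) = A / t + o(1)\<close> (\<open>lattice_theta_asymptotics\<close>), the constant is \<open>-1/2\<close> for each of the
  finitely many classes, in total \<open>- h / 2\<close> (\<open>zeta_asymptotics_classes\<close>).

  The second expansion sorts the ideals by their norm. An ideal is \<open>g (a \<int> + (b + \<omega>) \<int>)\<close>,
  where \<open>a\<close> divides the norm of \<open>b + \<omega>\<close>, so counting ideals of norm \<open>n\<close> means counting roots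
  of a quadratic polynomial modulo divisors of \<open>n\<close>. By the Chinese remainder theorem, Hensel's
  lemma and quadratic reciprocity there are \<open>\<Sum> \<chi>(d)\<close> of them, over the divisors \<open>d\<close> of \<open>n\<close>
  (\<open>sum_rho_eq_sum_chi\<close>). Hence \<open>S(t) = \<Sum>\<^sub>k G(k t)\<close> with \<open>G(x) = \<Sum>\<^sub>d \<chi>(d) exp (- d x)\<close>, and the
  trapezoidal rule gives the constant \<open>- G(0) / 2\<close> (\<open>trapezoid_asymptotics\<close>). Since \<open>\<chi>\<close> is
  periodic with mean \<open>0\<close>, \<open>G\<close> is a rational function of \<open>exp (- x)\<close> without a pole at \<open>x = 0\<close>,
  where its value is \<open>- (1 / N) \<Sum> x \<chi>(x)\<close> (\<open>periodic_power_series\<close>).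

  It is enough to have both expansions along the sequence \<open>t = 4\<^sup>-\<^sup>k\<close>. There they follow from
  comparing the theta series at \<open>t\<close> and \<open>t / 4\<close>, and the trapezoidal sum at \<open>t\<close> and \<open>t / 2\<close>,
  which replaces integrals and Poisson summation.
\<close>

section \<open>The trapezoidal rule along a geometric sequence\<close>

lemma first_difference_bound:
  fixes f f' :: "real \<Rightarrow> real"
  assumes "\<And>x. (f has_real_derivative f' x) (at x)" and "h \<ge> 0"
    and "\<And>x. a \<le> x \<Longrightarrow> x \<le> a + h \<Longrightarrow> \<bar>f' x\<bar> \<le> M"
  shows "\<bar>f (a + h) - f a\<bar> \<le> h * M"
proof (cases "h = 0")
  case False
  then obtain z where "z > a" "z < a + h" "f (a + h) - f a = (a + h - a) * f' z"
    using MVT2[of a "a + h" f f'] assms by auto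
  then show ?thesis
    using assms(3)[of z] assms(2) by (simp add: abs_mult mult_left_mono)
qed simp

lemma second_difference_bound:
  fixes f f' f'' :: "real \<Rightarrow> real"
  assumes "\<And>x. (f has_real_derivative f' x) (at x)"
    and "\<And>x. (f' has_real_derivative f'' x) (at x)" and h: "h \<ge> 0"
    and "\<And>x. a \<le> x \<Longrightarrow> x \<le> a + 2 * h \<Longrightarrow> \<bar>f'' x\<bar> \<le> M"
  shows "\<bar>f (a + 2 * h) - 2 * f (a + h) + f a\<bar> \<le> h ^ 2 * M"
proof -
  have "\<bar>(f (a + h + h) - f (a + h)) - (f (a + h) - f a)\<bar> \<le> h * (h * M)"
  proof (rule first_difference_bound[where f = "\<lambda>x. f (x + h) - f x" and f' = "\<lambda>x. f' (x + h) - f' x"])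
    show "((\<lambda>x. f (x + h) - f x) has_real_derivative f' (x + h) - f' x) (at x)" for x
      by (rule DERIV_diff[OF iffD1[OF DERIV_shift assms(1)] assms(1)])
    show "\<bar>f' (x + h) - f' x\<bar> \<le> h * M" if "a \<le> x" "x \<le> a + h" for x
      by (rule first_difference_bound[OF assms(2) h]) (use that h in \<open>auto intro!: assms(4)\<close>)
  qed (rule h)
  then show ?thesis
    by (simp add: power2_eq_square mult.assoc) (simp add: algebra_simps)
qed

lemma third_difference_bound:
  fixes f f' f'' f''' :: "real \<Rightarrow> real"
  assumes "\<And>x. (f has_real_derivative f' x) (at x)"
    and "\<And>x. (f' has_real_derivative f'' x) (at x)"
    and "\<And>x. (f'' has_real_derivative f''' x) (at x)"
    and "\<And>x. 0 \<le> x \<Longrightarrow> x \<le> 3 \<Longrightarrow> \<bar>f''' x\<bar> \<le> M"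
  shows "\<bar>f 3 - 3 * f 2 + 3 * f 1 - f 0\<bar> \<le> M"
proof -
  have shift: "((\<lambda>x. g (x + 1)) has_real_derivative g' (x + 1)) (at x)"
    if "\<And>x. (g has_real_derivative g' x) (at x)" for g g' :: "real \<Rightarrow> real" and x
    by (rule iffD1[OF DERIV_shift that])
  have "\<bar>(\<lambda>x. f (x + 1) - f x) (0 + 2 * 1) - 2 * (\<lambda>x. f (x + 1) - f x) (0 + 1)
           + (\<lambda>x. f (x + 1) - f x) 0\<bar> \<le> 1 ^ 2 * M"
  proof (rule second_difference_bound)
    show "((\<lambda>x. f (x + 1) - f x) has_real_derivative f' (x + 1) - f' x) (at x)" for x
      by (rule DERIV_diff[OF shift assms(1)]) (rule assms(1))
    show "((\<lambda>x. f' (x + 1) - f' x) has_real_derivative f'' (x + 1) - f'' x) (at x)" for x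
      by (rule DERIV_diff[OF shift assms(2)]) (rule assms(2))
    show "\<bar>f'' (x + 1) - f'' x\<bar> \<le> M" if "0 \<le> x" "x \<le> 0 + 2 * 1" for x
      using first_difference_bound[OF assms(3), of 1 x M] that assms(4) by auto
  qed simp
  then show ?thesis by (simp add: algebra_simps)
qed

text \<open>The increments of \<open>T k / r\<^sup>k\<close> are of size \<open>(2 r)\<^sup>-\<^sup>k\<close>. So the sequence converges to some \<open>c\<close>,
  fast enough that the error is still negligible after multiplication by \<open>r\<^sup>k\<close>.\<close>

lemma asymptotic_of_geometric_recursion:
  fixes T :: "nat \<Rightarrow> real"
  assumes r: "r > 1" and T: "\<And>k. \<bar>T (Suc k) - r * T k\<bar> \<le> C / 2 ^ k"
  shows "\<exists>c. (\<lambda>k. T k - c * r ^ k) \<longlonglongrightarrow> 0"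
proof -
  define d where "d = (\<lambda>k. T (Suc k) / r ^ Suc k - T k / r ^ k)"
  have C0: "C \<ge> 0" using T[of 0] by simp
  have db: "\<bar>d k\<bar> \<le> (C / r ^ k) * (1 / 2) ^ k" for k
  proof -
    have "d k = (T (Suc k) - r * T k) / r ^ Suc k"
      using r by (simp add: d_def field_simps)
    hence "\<bar>d k\<bar> \<le> (C / 2 ^ k) / r ^ Suc k"
      using divide_right_mono[OF T[of k], of "r ^ Suc k"] r by simp
    also have "\<dots> \<le> (C / 2 ^ k) / r ^ k"
      using r C0 by (intro divide_left_mono) auto
    finally show ?thesis by (simp add: power_divide mult_ac)
  qed
  have rk: "1 \<le> r ^ k" for k using r by simp
  have db1: "\<bar>d (j + k)\<bar> \<le> (C / (r ^ k * 2 ^ k)) * (1 / 2) ^ j" for j k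
  proof -
    have "C / r ^ (j + k) \<le> C / r ^ k"
      using r C0 by (intro divide_left_mono) (auto simp: power_increasing)
    hence "(C / r ^ (j + k)) * (1 / 2) ^ (j + k) \<le> (C / r ^ k) * (1 / 2) ^ (j + k)"
      by (rule mult_right_mono) simp
    then show ?thesis using db[of "j + k"] by (simp add: power_add power_divide field_simps)
  qed
  have sum1: "summable (\<lambda>j. \<bar>d (j + k)\<bar>)" for k
    by (rule summable_comparison_test'[where g = "\<lambda>j. (C / (r ^ k * 2 ^ k)) * (1 / 2) ^ j" and N = 0])
       (use db1 in \<open>auto intro!: summable_mult summable_geometric\<close>)
  have sd: "summable (\<lambda>j. d (j + k))" for k using sum1[of k] by (rule summable_rabs_cancel)
  define c where "c = T 0 + suminf d"
  have tail: "c - T k / r ^ k = suminf (\<lambda>j. d (j + k))" for k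
  proof -
    have "sum d {..<k} = T k / r ^ k - T 0"
      unfolding d_def by (subst sum_lessThan_telescope) simp
    moreover have "suminf d = suminf (\<lambda>j. d (j + k)) + sum d {..<k}"
      using suminf_split_initial_segment[of d k] sd[of 0] by simp
    ultimately show ?thesis by (simp add: c_def)
  qed
  have "\<bar>T k - c * r ^ k\<bar> \<le> 2 * C * (1 / 2) ^ k" for k
  proof -
    have "\<bar>suminf (\<lambda>j. d (j + k))\<bar> \<le> suminf (\<lambda>j. \<bar>d (j + k)\<bar>)" by (rule summable_rabs[OF sum1])
    also have "\<dots> \<le> suminf (\<lambda>j. (C / (r ^ k * 2 ^ k)) * (1 / 2) ^ j)"
      by (rule suminf_le[OF db1 sum1]) (auto intro!: summable_mult summable_geometric)
    also have "\<dots> = (C / (r ^ k * 2 ^ k)) * 2"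
      by (subst suminf_mult) (auto simp: suminf_geometric)
    finally have "\<bar>c - T k / r ^ k\<bar> * r ^ k \<le> (C / (r ^ k * 2 ^ k)) * 2 * r ^ k"
      unfolding tail[symmetric] using r by (intro mult_right_mono) auto
    moreover have "\<bar>c - T k / r ^ k\<bar> * r ^ k = \<bar>T k - c * r ^ k\<bar>"
    proof -
      have "\<bar>c - T k / r ^ k\<bar> * r ^ k = \<bar>(c - T k / r ^ k) * r ^ k\<bar>"
        using r by (simp add: abs_mult)
      also have "(c - T k / r ^ k) * r ^ k = - (T k - c * r ^ k)" using r by (simp add: field_simps)
      finally show ?thesis by (simp only: abs_minus_cancel)
    qed
    moreover have "(C / (r ^ k * 2 ^ k)) * 2 * r ^ k = 2 * C * (1 / 2) ^ k"
      using r by (simp add: power_divide)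
    ultimately show ?thesis by linarith
  qed
  moreover have "(\<lambda>k. 2 * C * (1 / 2) ^ k) \<longlonglongrightarrow> 0"
    by (intro tendsto_mult_right_zero LIMSEQ_realpow_zero) auto
  ultimately have "(\<lambda>k. T k - c * r ^ k) \<longlonglongrightarrow> 0"
    by (auto intro: Lim_null_comparison[where g = "\<lambda>k. 2 * C * (1 / 2) ^ k"])
  then show ?thesis by blast
qed

lemma inverse_one_minus_exp_bound:
  fixes t :: real assumes "0 < t" "t \<le> 1"
  shows "1 / (1 - exp (- t)) \<le> 2 / t"
proof -
  have "(1 + t) * exp (- t) \<le> exp t * exp (- t)" using assms by (intro mult_right_mono) auto
  hence "(1 + t) * exp (- t) \<le> 1" by (simp flip: exp_add)
  hence "exp (- t) \<le> 1 / (1 + t)" using assms by (simp add: field_simps)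
  also have "\<dots> \<le> 1 - t / 2"
  proof -
    have "t * t \<le> t * 1" using assms by (intro mult_left_mono) auto
    then show ?thesis using assms by (simp add: divide_simps) (simp add: algebra_simps)
  qed
  finally have "t / 2 \<le> 1 - exp (- t)" by simp
  then have "1 / (1 - exp (- t)) \<le> 1 / (t / 2)" using assms by (intro divide_left_mono) auto
  then show ?thesis by simp
qed

text \<open>Halving the step width \<open>t\<close> doubles the sum of the trapezoidal rule, up to a sum of second
  differences of \<open>G\<close>, which is of size \<open>t\<close>. The trapezoidal rule counts the end point \<open>0\<close> with
  weight \<open>1/2\<close>; the sum here leaves it out, and this accounts for the limit \<open>- G 0 / 2\<close>.\<close>

lemma trapezoid_asymptotics:
  fixes G G' G'' :: "real \<Rightarrow> real"
  assumes G': "\<And>x. (G has_real_derivative G' x) (at x)"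
    and G'': "\<And>x. (G' has_real_derivative G'' x) (at x)"
    and Gb: "\<And>x. x \<ge> 0 \<Longrightarrow> \<bar>G x\<bar> \<le> C * exp (- x)"
    and G''b: "\<And>x. x \<ge> 0 \<Longrightarrow> \<bar>G'' x\<bar> \<le> C * exp (- x)"
  shows "\<exists>c. (\<lambda>k. suminf (\<lambda>n. G (real (Suc n) / 4 ^ k)) - c * 4 ^ k) \<longlonglongrightarrow> - G 0 / 2"
    and "\<And>t. t > 0 \<Longrightarrow> summable (\<lambda>n. \<bar>G (real (Suc n) * t)\<bar>)"
proof -
  have C0: "C \<ge> 0" using Gb[of 0] by simp
  have geo: "summable (\<lambda>n. K * exp (- (real n * t)))" if "t > 0" for K t :: real
  proof -
    have "exp (- (real n * t)) = exp (- t) ^ n" for n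
      by (simp flip: exp_of_nat_mult)
    then show ?thesis using that by (auto intro!: summable_mult summable_geometric)
  qed
  have sa: "summable (\<lambda>n. \<bar>G (real n * t)\<bar>)" if "t > 0" for t
    by (rule summable_comparison_test'[where g = "\<lambda>n. C * exp (- (real n * t))" and N = 0])
       (use geo[OF that] Gb that in auto)
  then show sa1: "summable (\<lambda>n. \<bar>G (real (Suc n) * t)\<bar>)" if "t > 0" for t
    using that by (subst summable_Suc_iff[where f = "\<lambda>n. \<bar>G (real n * t)\<bar>"]) auto
  have s: "summable (\<lambda>n. G (real n * t))" and s1: "summable (\<lambda>n. G (real (Suc n) * t))"
    if "t > 0" for t
    using sa[OF that] sa1[OF that] by (blast intro: summable_rabs_cancel)+
  \<comment> \<open>The trapezoidal sum, still to be multiplied by \<open>t\<close>.\<close>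
  define T where "T = (\<lambda>t. suminf (\<lambda>n. (G (real n * t) + G (real (Suc n) * t)) / 2))"
  have Tsums: "(\<lambda>n. (G (real n * t) + G (real (Suc n) * t)) / 2) sums T t" if "t > 0" for t
    unfolding T_def using s[OF that] s1[OF that] by (intro summable_sums summable_divide summable_add)
  have Teq: "T t = G 0 / 2 + suminf (\<lambda>n. G (real (Suc n) * t))" if t: "t > 0" for t
  proof -
    have "T t = (suminf (\<lambda>n. G (real n * t)) + suminf (\<lambda>n. G (real (Suc n) * t))) / 2"
      unfolding T_def suminf_add[OF s[OF t] s1[OF t]]
      by (rule suminf_divide[OF summable_add[OF s[OF t] s1[OF t]]])
    moreover have "suminf (\<lambda>n. G (real n * t)) = suminf (\<lambda>n. G (real (Suc n) * t)) + G 0"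
      using suminf_split_head[OF s[OF t]] by simp
    ultimately show ?thesis by (simp only: add_divide_distrib)
  qed
  have step: "\<bar>T (t / 2) - 2 * T t\<bar> \<le> C * t" if t: "0 < t" "t \<le> 1" for t
  proof -
    let ?d = "\<lambda>n. - (G (real (Suc n) * t) - 2 * G (real n * t + t / 2) + G (real n * t)) / 2"
    have "(\<lambda>n. \<Sum>i\<in>{n * 2..<n * 2 + 2}. (G (real i * (t / 2)) + G (real (Suc i) * (t / 2))) / 2)
            sums T (t / 2)"
      by (rule sums_group[OF Tsums]) (use t in auto)
    moreover have "(\<Sum>i\<in>{n * 2..<n * 2 + 2}. (G (real i * (t / 2)) + G (real (Suc i) * (t / 2))) / 2)
        = (G (real n * t) + 2 * G (real n * t + t / 2) + G (real (Suc n) * t)) / 2" for n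
    proof -
      have pair: "(\<Sum>i\<in>{n * 2..<n * 2 + 2}. H i) = H (2 * n) + H (Suc (2 * n))" for H :: "nat \<Rightarrow> real"
      proof -
        have "{n * 2..<n * 2 + 2} = {2 * n, Suc (2 * n)}" by auto
        then show ?thesis by simp
      qed
      have "real (2 * n) * (t / 2) = real n * t"
        "real (Suc (2 * n)) * (t / 2) = real n * t + t / 2"
        "real (Suc (Suc (2 * n))) * (t / 2) = real (Suc n) * t" by (simp_all add: field_simps)
      then show ?thesis by (simp only: pair) (simp add: add_divide_distrib)
    qed
    ultimately have "(\<lambda>n. (G (real n * t) + 2 * G (real n * t + t / 2) + G (real (Suc n) * t)) / 2)
        sums T (t / 2)" by (simp only:)
    from sums_diff[OF this sums_mult[OF Tsums[OF t(1)], of 2]]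
    have ds: "?d sums (T (t / 2) - 2 * T t)" by (simp add: field_simps)
    have db: "\<bar>?d n\<bar> \<le> (C * t ^ 2 / 8) * exp (- (real n * t))" for n
    proof -
      have "\<bar>G (real n * t + 2 * (t / 2)) - 2 * G (real n * t + t / 2) + G (real n * t)\<bar>
           \<le> (t / 2) ^ 2 * (C * exp (- (real n * t)))"
      proof (rule second_difference_bound[OF G' G''])
        fix x assume x: "real n * t \<le> x" "x \<le> real n * t + 2 * (t / 2)"
        moreover have "0 \<le> real n * t" using t by simp
        ultimately have "x \<ge> 0" by linarith
        from G''b[OF this] have "\<bar>G'' x\<bar> \<le> C * exp (- x)" .
        also have "\<dots> \<le> C * exp (- (real n * t))" using x C0 by (intro mult_left_mono) auto
        finally show "\<bar>G'' x\<bar> \<le> C * exp (- (real n * t))" .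
      qed (use t in auto)
      moreover have "real (Suc n) * t = real n * t + 2 * (t / 2)" by (simp add: algebra_simps)
      moreover have "\<bar>- y / 2\<bar> = \<bar>y\<bar> / 2" for y :: real by simp
      moreover have "(t / 2) ^ 2 * (C * E) = 2 * (C * t ^ 2 / 8 * E)" for E
        by (simp add: power_divide)
      moreover have "y / 2 \<le> z" if "y \<le> 2 * z" for y z :: real using that by simp
      ultimately show ?thesis by (simp only:)
    qed
    have dsa: "summable (\<lambda>n. \<bar>?d n\<bar>)"
      by (rule summable_comparison_test'[where g = "\<lambda>n. (C * t ^ 2 / 8) * exp (- (real n * t))" and N = 0])
         (use db geo[OF t(1)] in auto)
    have "\<bar>T (t / 2) - 2 * T t\<bar> \<le> suminf (\<lambda>n. \<bar>?d n\<bar>)"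
      using summable_rabs[OF dsa] sums_unique[OF ds] by simp
    also have "\<dots> \<le> suminf (\<lambda>n. (C * t ^ 2 / 8) * exp (- (real n * t)))"
      by (rule suminf_le[OF db dsa geo[OF t(1)]])
    also have "\<dots> = (C * t ^ 2 / 8) * (1 / (1 - exp (- t)))"
    proof -
      have "exp (- (real n * t)) = exp (- t) ^ n" for n by (simp flip: exp_of_nat_mult)
      moreover have "(\<lambda>n. exp (- t) ^ n) sums (1 / (1 - exp (- t)))"
        using t by (intro geometric_sums) auto
      ultimately have "(\<lambda>n. exp (- (real n * t))) sums (1 / (1 - exp (- t)))" by (simp only:)
      from sums_unique[OF sums_mult[OF this]] show ?thesis by (rule sym)
    qed
    also have "\<dots> \<le> (C * t ^ 2 / 8) * (2 / t)"
      by (rule mult_left_mono[OF inverse_one_minus_exp_bound]) (use t C0 in auto)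
    also have "\<dots> \<le> C * t" using t C0 by (simp add: power2_eq_square field_simps)
    finally show ?thesis .
  qed
  have "\<exists>c. (\<lambda>k. T (1 / 2 ^ k) - c * 2 ^ k) \<longlonglongrightarrow> 0"
  proof (rule asymptotic_of_geometric_recursion)
    show "\<bar>T (1 / 2 ^ Suc k) - 2 * T (1 / 2 ^ k)\<bar> \<le> C / 2 ^ k" for k
      using step[of "1 / 2 ^ k"] by (simp add: mult.commute)
  qed simp
  then obtain c where c: "(\<lambda>k. T (1 / 2 ^ k) - c * 2 ^ k) \<longlonglongrightarrow> 0" by blast
  have "strict_mono (\<lambda>k::nat. 2 * k)" by (simp add: strict_mono_def)
  from LIMSEQ_subseq_LIMSEQ[OF c this]
  have "(\<lambda>k. T (1 / 4 ^ k) - c * 4 ^ k) \<longlonglongrightarrow> 0" by (simp add: o_def power_mult)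
  from tendsto_diff[OF this tendsto_const[of "G 0 / 2"]]
  have "(\<lambda>k. suminf (\<lambda>n. G (real (Suc n) / 4 ^ k)) - c * 4 ^ k) \<longlonglongrightarrow> - G 0 / 2"
    by (simp add: Teq)
  then show "\<exists>c. (\<lambda>k. suminf (\<lambda>n. G (real (Suc n) / 4 ^ k)) - c * 4 ^ k) \<longlonglongrightarrow> - G 0 / 2" by blast
qed

section \<open>Theta series of plane lattices\<close>

definition lattice_point :: "complex \<Rightarrow> complex \<Rightarrow> int \<times> int \<Rightarrow> complex" where
  "lattice_point u v = (\<lambda>(x, y). of_int x * u + of_int y * v)"

definition gaussian :: "real \<Rightarrow> complex \<Rightarrow> real" where
  "gaussian r z = exp (- ((r * norm z) ^ 2))"

text \<open>The parallelogram spanned by \<open>z = x u + y v\<close> and \<open>v\<close> has area \<open>|x| |Im (cnj u v)|\<close>, which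
  is at most \<open>|z| |v|\<close>; similarly for \<open>y\<close>.\<close>

lemma lattice_norm_lower_bound:
  fixes u v :: complex
  assumes d: "Im (cnj u * v) \<noteq> 0"
  shows "\<exists>\<kappa>>0. \<forall>x y. norm (lattice_point u v (x, y)) \<ge> \<kappa> * (\<bar>real_of_int x\<bar> + \<bar>real_of_int y\<bar>)"
proof -
  have uv: "u \<noteq> 0" "v \<noteq> 0" using d by auto
  let ?d = "\<bar>Im (cnj u * v)\<bar>"
  have "?d / (norm u + norm v) * (\<bar>real_of_int x\<bar> + \<bar>real_of_int y\<bar>) \<le> norm (lattice_point u v (x, y))" for x y
  proof -
    let ?z = "lattice_point u v (x, y)"
    have "Im (cnj ?z * v) = of_int x * Im (cnj u * v)"
      by (simp add: lattice_point_def algebra_simps)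
    hence "\<bar>real_of_int x\<bar> * ?d = \<bar>Im (cnj ?z * v)\<bar>" by (simp only: abs_mult)
    also have "\<dots> \<le> norm ?z * norm v"
      using abs_Im_le_cmod[of "cnj ?z * v"] by (simp add: norm_mult)
    finally have 1: "\<bar>real_of_int x\<bar> * ?d \<le> norm ?z * norm v" .
    have "Im (cnj u * ?z) = of_int y * Im (cnj u * v)"
      by (simp add: lattice_point_def algebra_simps)
    hence "\<bar>real_of_int y\<bar> * ?d = \<bar>Im (cnj u * ?z)\<bar>" by (simp only: abs_mult)
    also have "\<dots> \<le> norm ?z * norm u"
      using abs_Im_le_cmod[of "cnj u * ?z"] by (simp add: norm_mult mult.commute)
    finally have "\<bar>real_of_int y\<bar> * ?d \<le> norm ?z * norm u" .
    with 1 have "?d * (\<bar>real_of_int x\<bar> + \<bar>real_of_int y\<bar>) \<le> norm ?z * (norm u + norm v)"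
      by (simp only: distrib_left mult.commute[of ?d]) 
    moreover have "norm u + norm v > 0" using uv by (simp add: add_pos_pos)
    ultimately show ?thesis by (simp add: pos_divide_le_eq)
  qed
  moreover have "?d / (norm u + norm v) > 0" using uv d by (simp add: add_pos_pos)
  ultimately show ?thesis by blast
qed

lemma sum_exp_abs_bound:
  fixes \<sigma> :: real assumes \<sigma>: "\<sigma> > 0"
  shows "(\<Sum>x=-int n..int n. exp (- \<sigma> * \<bar>real_of_int x\<bar>)) \<le> 2 / (1 - exp (- \<sigma>))"
proof -
  let ?f = "\<lambda>x. exp (- \<sigma> * \<bar>real_of_int x\<bar>)"
  have "sum ?f {-int n..int n} \<le> sum ?f (int ` {..n} \<union> (\<lambda>k. - int k) ` {..n})"
  proof (rule sum_mono2)
    show "{-int n..int n} \<subseteq> int ` {..n} \<union> (\<lambda>k. - int k) ` {..n}"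
    proof
      fix x assume "x \<in> {-int n..int n}"
      then show "x \<in> int ` {..n} \<union> (\<lambda>k. - int k) ` {..n}"
        by (cases x rule: int_cases2) auto
    qed
  qed auto
  also have "\<dots> \<le> sum ?f (int ` {..n}) + sum ?f ((\<lambda>k. - int k) ` {..n})"
    by (subst sum_Un) (auto intro!: sum_nonneg)
  also have "sum ?f (int ` {..n}) = (\<Sum>k\<le>n. exp (- \<sigma>) ^ k)"
    by (subst sum.reindex) (auto simp: inj_on_def mult.commute simp flip: exp_of_nat_mult)
  also have "sum ?f ((\<lambda>k. - int k) ` {..n}) = (\<Sum>k\<le>n. exp (- \<sigma>) ^ k)"
    by (subst sum.reindex) (auto simp: inj_on_def mult.commute simp flip: exp_of_nat_mult)
  also have "(\<Sum>k\<le>n. exp (- \<sigma>) ^ k) \<le> 1 / (1 - exp (- \<sigma>))"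
  proof -
    have s: "(\<lambda>k. exp (- \<sigma>) ^ k) sums (1 / (1 - exp (- \<sigma>)))" using \<sigma> by (intro geometric_sums) auto
    show ?thesis
      using sum_le_suminf[OF sums_summable[OF s], of "{..n}"] sums_unique[OF s] by simp
  qed
  finally show ?thesis by simp
qed

lemma exp_lattice_sum:
  fixes \<sigma> :: real assumes \<sigma>: "\<sigma> > 0"
  defines "g \<equiv> \<lambda>p::int \<times> int. exp (- \<sigma> * (\<bar>real_of_int (fst p)\<bar> + \<bar>real_of_int (snd p)\<bar>))"
  shows "g summable_on UNIV" and "infsum g UNIV \<le> (2 / (1 - exp (- \<sigma>))) ^ 2"
proof -
  have *: "sum g F \<le> (2 / (1 - exp (- \<sigma>))) ^ 2" if F: "finite F" for F
  proof -
    define n where "n = Max (insert 0 ((\<lambda>p. nat (max \<bar>fst p\<bar> \<bar>snd p\<bar>)) ` F))"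
    let ?I = "{-int n..int n}"
    have "F \<subseteq> ?I \<times> ?I"
    proof
      fix p assume "p \<in> F"
      hence "nat (max \<bar>fst p\<bar> \<bar>snd p\<bar>) \<le> n"
        unfolding n_def using F by (intro Max_ge) auto
      then show "p \<in> ?I \<times> ?I" by (cases p) auto
    qed
    hence "sum g F \<le> sum g (?I \<times> ?I)"
      by (intro sum_mono2) (auto simp: g_def)
    also have "\<dots> = (\<Sum>x\<in>?I. exp (- \<sigma> * \<bar>real_of_int x\<bar>)) * (\<Sum>x\<in>?I. exp (- \<sigma> * \<bar>real_of_int x\<bar>))"
      unfolding sum_product sum.cartesian_product
      by (intro sum.cong) (auto simp: g_def algebra_simps simp flip: exp_add)
    also have "\<dots> \<le> (2 / (1 - exp (- \<sigma>))) * (2 / (1 - exp (- \<sigma>)))"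
      using \<sigma> by (intro mult_mono sum_exp_abs_bound sum_nonneg) auto
    finally show ?thesis by (simp add: power2_eq_square)
  qed
  show s: "g summable_on UNIV"
    by (rule nonneg_bdd_above_summable_on) (use * in \<open>auto simp: g_def intro!: bdd_aboveI2\<close>)
  show "infsum g UNIV \<le> (2 / (1 - exp (- \<sigma>))) ^ 2"
    by (rule infsum_le_finite_sums[OF s]) (use * in auto)
qed

lemma gaussian_le_exp: "gaussian r z \<le> exp 1 * exp (- (r * norm z))"
proof -
  have "0 \<le> (r * norm z - 1 / 2) ^ 2" by simp
  hence "- ((r * norm z) ^ 2) \<le> 1 + - (r * norm z)" by (simp add: power2_eq_square algebra_simps)
  then show ?thesis by (simp add: gaussian_def flip: exp_add)
qed

lemma gaussian_lattice_summable:
  assumes d: "Im (cnj u * v) \<noteq> 0" and r: "r > 0"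
  shows "(\<lambda>p. gaussian r (z + lattice_point u v p)) summable_on UNIV"
proof -
  obtain \<kappa> where \<kappa>: "\<kappa> > 0"
    "\<And>x y. norm (lattice_point u v (x, y)) \<ge> \<kappa> * (\<bar>real_of_int x\<bar> + \<bar>real_of_int y\<bar>)"
    using lattice_norm_lower_bound[OF d] by blast
  let ?h = "\<lambda>p::int\<times>int. exp 1 * exp (r * norm z) *
     exp (- (r * \<kappa>) * (\<bar>real_of_int (fst p)\<bar> + \<bar>real_of_int (snd p)\<bar>))"
  show ?thesis
  proof (rule summable_on_comparison_test)
    show "?h summable_on UNIV"
      by (rule summable_on_cmult_right[OF exp_lattice_sum(1)]) (use r \<kappa> in auto)
    show "gaussian r (z + lattice_point u v p) \<le> ?h p" for p
    proof -
      have "norm (lattice_point u v p) - norm z \<le> norm (z + lattice_point u v p)"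
        using norm_triangle_ineq2[of "lattice_point u v p" "- z"] by (simp add: add.commute)
      moreover have "norm (lattice_point u v p) \<ge> \<kappa> * (\<bar>real_of_int (fst p)\<bar> + \<bar>real_of_int (snd p)\<bar>)"
        using \<kappa>(2)[of "fst p" "snd p"] by simp
      ultimately have "\<kappa> * (\<bar>real_of_int (fst p)\<bar> + \<bar>real_of_int (snd p)\<bar>) - norm z \<le> norm (z + lattice_point u v p)"
        by linarith
      hence "r * (\<kappa> * (\<bar>real_of_int (fst p)\<bar> + \<bar>real_of_int (snd p)\<bar>) - norm z) \<le> r * norm (z + lattice_point u v p)"
        using r by (intro mult_left_mono) auto
      hence "exp (- (r * norm (z + lattice_point u v p))) \<le> exp (r * norm z) *
         exp (- (r * \<kappa>) * (\<bar>real_of_int (fst p)\<bar> + \<bar>real_of_int (snd p)\<bar>))"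
        by (simp add: algebra_simps flip: exp_add)
      hence "exp 1 * exp (- (r * norm (z + lattice_point u v p))) \<le> ?h p"
        unfolding mult.assoc by (intro mult_left_mono) auto
      with gaussian_le_exp show ?thesis by (rule order_trans)
    qed
  qed (simp add: gaussian_def)
qed

text \<open>The left-hand side is what a third derivative of a Gaussian looks like. An exponential
  bound, with any constant, is convenient as it can be summed over a lattice.\<close>

lemma cubic_gaussian_bound:
  fixes y :: real assumes y: "y \<ge> 0"
  shows "(8 * y ^ 3 + 12 * y) * exp (- (y ^ 2)) \<le> 700 * exp (- y)"
proof -
  have 1: "y \<le> exp y" using exp_ge_add_one_self[of y] by linarith
  have "y / 3 \<le> exp (y / 3)" using exp_ge_add_one_self[of "y / 3"] by linarith
  from power_mono[OF this, of 3] y have "y ^ 3 / 27 \<le> exp y"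
    by (simp add: power_divide flip: exp_of_nat_mult)
  with 1 have 2: "8 * y ^ 3 + 12 * y \<le> 228 * exp y" by linarith
  have "0 \<le> (y - 1) ^ 2" by simp
  hence "y + - (y ^ 2) \<le> 1 + - y" by (simp add: power2_eq_square algebra_simps)
  hence e: "exp y * exp (- (y ^ 2)) \<le> exp 1 * exp (- y)" by (simp flip: exp_add)
  have "(8 * y ^ 3 + 12 * y) * exp (- (y ^ 2)) \<le> 228 * (exp y * exp (- (y ^ 2)))"
    using mult_right_mono[OF 2, of "exp (- (y ^ 2))"] by (simp add: mult.assoc)
  also have "\<dots> \<le> 228 * (3 * exp (- y))"
  proof -
    have "exp 1 * exp (- y) \<le> 3 * exp (- y)" by (intro mult_right_mono exp_le) auto
    with e show ?thesis by linarith
  qed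
  also have "\<dots> \<le> 700 * exp (- y)" by simp
  finally show ?thesis .
qed

text \<open>On the line from \<open>z\<close> to \<open>z + 3 w\<close> the Gaussian is \<open>exp (- p)\<close> with a quadratic polynomial
  \<open>p\<close>. Each differentiation produces a factor \<open>r\<close>.\<close>

lemma gaussian_third_difference:
  fixes z w :: complex
  assumes r: "0 < r" "r \<le> 1"
  shows "\<bar>gaussian r (z + 3 * w) - 3 * gaussian r (z + 2 * w) + 3 * gaussian r (z + w) - gaussian r z\<bar>
     \<le> 700 * norm w ^ 3 * exp (3 * norm w) * r ^ 3 * exp (- (r * norm z))"
proof -
  define p where "p = (\<lambda>x. r ^ 2 * (norm z ^ 2 + 2 * Re (z * cnj w) * x + norm w ^ 2 * x ^ 2))"
  define p1 where "p1 = (\<lambda>x. r ^ 2 * (2 * Re (z * cnj w) + 2 * norm w ^ 2 * x))"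
  define p2 where "p2 = r ^ 2 * (2 * norm w ^ 2)"
  define h where "h = (\<lambda>x. exp (- p x))"
  have peq: "p x = (r * norm (z + of_real x * w)) ^ 2" for x
    unfolding p_def power_mult_distrib cmod_power2
    by (simp add: power2_eq_square algebra_simps)
  have hg: "h x = gaussian r (z + of_real x * w)" for x by (simp add: h_def peq gaussian_def)
  have dp: "(p has_real_derivative p1 x) (at x)" for x
    unfolding p_def p1_def by (auto intro!: derivative_eq_intros simp: algebra_simps)
  have dp1: "(p1 has_real_derivative p2) (at x)" for x
    unfolding p1_def p2_def by (auto intro!: derivative_eq_intros simp: algebra_simps)
  have dh: "(h has_real_derivative - p1 x * h x) (at x)" for x
    unfolding h_def by (auto intro!: derivative_eq_intros dp)
  have dh1: "((\<lambda>x. - p1 x * h x) has_real_derivative (p1 x ^ 2 - p2) * h x) (at x)" for x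
    by (auto intro!: derivative_eq_intros dp1 dh simp: algebra_simps power2_eq_square)
  have dh2: "((\<lambda>x. (p1 x ^ 2 - p2) * h x) has_real_derivative (3 * p1 x * p2 - p1 x ^ 3) * h x) (at x)" for x
    by (auto intro!: derivative_eq_intros dp1 dh simp: algebra_simps power2_eq_square power3_eq_cube)
  have "\<bar>h 3 - 3 * h 2 + 3 * h 1 - h 0\<bar>
     \<le> 700 * norm w ^ 3 * exp (3 * norm w) * r ^ 3 * exp (- (r * norm z))"
  proof (rule third_difference_bound[OF dh dh1 dh2])
    fix x :: real assume x: "0 \<le> x" "x \<le> 3"
    define y where "y = r * norm (z + of_real x * w)"
    have y0: "y \<ge> 0" using r by (simp add: y_def)
    have "p1 x = 2 * r ^ 2 * Re ((z + of_real x * w) * cnj w)"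
      unfolding p1_def cmod_power2 by (simp add: power2_eq_square algebra_simps)
    hence "\<bar>p1 x\<bar> = 2 * r ^ 2 * \<bar>Re ((z + of_real x * w) * cnj w)\<bar>" by (simp add: abs_mult)
    also have "\<dots> \<le> 2 * r ^ 2 * (norm (z + of_real x * w) * norm w)"
      using abs_Re_le_cmod[of "(z + of_real x * w) * cnj w"]
      by (intro mult_left_mono) (auto simp: norm_mult)
    also have "\<dots> = 2 * (r * norm w) * y" by (simp add: y_def power2_eq_square)
    finally have p1b: "\<bar>p1 x\<bar> \<le> 2 * (r * norm w) * y" .
    have p2e: "p2 = 2 * (r * norm w) ^ 2" by (simp add: p2_def power_mult_distrib)
    have hx: "h x = exp (- (y ^ 2))" by (simp add: h_def peq y_def)
    have "\<bar>3 * p1 x * p2 - p1 x ^ 3\<bar> \<le> 3 * \<bar>p1 x\<bar> * p2 + \<bar>p1 x\<bar> ^ 3"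
      using abs_triangle_ineq4[of "3 * p1 x * p2" "p1 x ^ 3"]
      using r by (simp add: abs_mult p2e power_abs)
    also have "\<dots> \<le> 3 * (2 * (r * norm w) * y) * p2 + (2 * (r * norm w) * y) ^ 3"
      using p1b by (intro add_mono mult_right_mono mult_left_mono power_mono) (auto simp: p2e)
    also have "\<dots> = (r * norm w) ^ 3 * (8 * y ^ 3 + 12 * y)"
      unfolding p2e by (simp add: power2_eq_square power3_eq_cube algebra_simps)
    finally have "\<bar>(3 * p1 x * p2 - p1 x ^ 3) * h x\<bar> \<le> (r * norm w) ^ 3 * (8 * y ^ 3 + 12 * y) * exp (- (y ^ 2))"
      unfolding abs_mult hx by (simp add: mult_right_mono)
    also have "\<dots> \<le> (r * norm w) ^ 3 * (700 * exp (- y))"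
      unfolding mult.assoc by (intro mult_left_mono cubic_gaussian_bound[OF y0]) (use r in auto)
    finally have 1: "\<bar>(3 * p1 x * p2 - p1 x ^ 3) * h x\<bar> \<le> (r * norm w) ^ 3 * (700 * exp (- y))" .
    have "norm z - x * norm w \<le> norm (z + of_real x * w)"
      using norm_triangle_ineq4[of "z + of_real x * w" "of_real x * w"] x by (simp add: norm_mult)
    hence "r * (norm z - x * norm w) \<le> y" unfolding y_def using r by (intro mult_left_mono) auto
    moreover have "r * (x * norm w) \<le> 1 * (3 * norm w)"
      using r x by (intro mult_mono) auto
    ultimately have "- y \<le> 3 * norm w + - (r * norm z)" by (simp add: algebra_simps)
    hence "exp (- y) \<le> exp (3 * norm w) * exp (- (r * norm z))" by (simp flip: exp_add)
    hence "(r * norm w) ^ 3 * (700 * exp (- y))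
        \<le> (r * norm w) ^ 3 * (700 * (exp (3 * norm w) * exp (- (r * norm z))))"
      using r by (intro mult_left_mono) auto
    also have "\<dots> = 700 * norm w ^ 3 * exp (3 * norm w) * r ^ 3 * exp (- (r * norm z))"
      by (simp add: power_mult_distrib)
    finally show "\<bar>(3 * p1 x * p2 - p1 x ^ 3) * h x\<bar>
        \<le> 700 * norm w ^ 3 * exp (3 * norm w) * r ^ 3 * exp (- (r * norm z))"
      using 1 by linarith
  qed
  then show ?thesis by (simp add: hg)
qed

lemma infsum_parity_classes:
  fixes f :: "int \<times> int \<Rightarrow> real"
  assumes "f summable_on UNIV"
  shows "infsum f UNIV = (\<Sum>(i, j)\<in>{0, 1} \<times> {0, 1}. infsum (\<lambda>(x, y). f (2 * x + i, 2 * y + j)) UNIV)"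
proof -
  let ?S = "{0, 1} \<times> {0, 1} :: (int \<times> int) set"
  let ?b = "\<lambda>((i, j), (x, y)). (2 * x + i, 2 * y + j) :: int \<times> int"
  have bij: "bij_betw ?b (?S \<times> UNIV) UNIV"
  proof (rule bij_betw_byWitness[where f' = "\<lambda>(x, y). ((x mod 2, y mod 2), (x div 2, y div 2))"])
    show "\<forall>a\<in>?S \<times> UNIV. (case ?b a of (x, y) \<Rightarrow> ((x mod 2, y mod 2), (x div 2, y div 2))) = a"
      by auto
    show "\<forall>a'\<in>UNIV. ?b (case a' of (x, y) \<Rightarrow> ((x mod 2, y mod 2), (x div 2, y div 2))) = a'"
      by auto
    show "(\<lambda>(x, y). ((x mod 2, y mod 2), (x div 2, y div 2))) ` UNIV \<subseteq> ?S \<times> (UNIV :: (int \<times> int) set)"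
    proof -
      have "z mod 2 \<in> {0, 1}" for z :: int by (cases "even z") (simp_all add: odd_iff_mod_2_eq_one)
      then show ?thesis unfolding image_subset_iff by (simp only: mem_Times_iff case_prod_unfold fst_conv snd_conv UNIV_I simp_thms) simp
    qed
  qed auto
  have sm: "(\<lambda>a. f (?b a)) summable_on (?S \<times> UNIV)"
    using summable_on_reindex_bij_betw[OF bij, of f] assms by simp
  have "infsum f UNIV = infsum (\<lambda>a. f (?b a)) (?S \<times> UNIV)"
    by (rule infsum_reindex_bij_betw[OF bij, symmetric])
  also have "\<dots> = infsum (\<lambda>s. infsum (\<lambda>p. f (?b (s, p))) UNIV) ?S"
    by (rule infsum_Sigma_banach[OF sm, symmetric])
  also have "\<dots> = (\<Sum>s\<in>?S. infsum (\<lambda>p. f (?b (s, p))) UNIV)"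
    by (rule infsum_finite) auto
  also have "\<dots> = (\<Sum>(i, j)\<in>?S. infsum (\<lambda>(x, y). f (2 * x + i, 2 * y + j)) UNIV)"
    by (intro sum.cong) (auto simp: case_prod_unfold)
  finally show ?thesis .
qed

text \<open>The sum \<open>F(z)\<close> of the Gaussian over \<open>z + \<Lambda>\<close> has the period \<open>2 w\<close>, so on its values the
  translation \<open>S\<close> by \<open>w\<close> satisfies \<open>S\<^sup>2 = 1\<close> and therefore \<open>(S - 1)\<^sup>3 = 4 (S - 1)\<close>. Hence
  \<open>4 (F(w) - F(0))\<close> is a sum of third differences. Each is of size \<open>r\<^sup>3\<close>, and about \<open>r\<^sup>-\<^sup>2\<close> lattice
  points contribute, which leaves a bound of order \<open>r\<close>.\<close>

lemma gaussian_lattice_half_period: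
  fixes u v w :: complex
  assumes d: "Im (cnj u * v) \<noteq> 0" and w: "2 * w = lattice_point u v q"
  shows "\<exists>K. \<forall>r. 0 < r \<longrightarrow> r \<le> 1 \<longrightarrow>
     \<bar>infsum (\<lambda>p. gaussian r (w + lattice_point u v p)) UNIV
       - infsum (\<lambda>p. gaussian r (lattice_point u v p)) UNIV\<bar> \<le> K * r"
proof -
  obtain \<kappa> where \<kappa>: "\<kappa> > 0"
    "\<And>x y. norm (lattice_point u v (x, y)) \<ge> \<kappa> * (\<bar>real_of_int x\<bar> + \<bar>real_of_int y\<bar>)"
    using lattice_norm_lower_bound[OF d] by blast
  define \<mu> where "\<mu> = min \<kappa> 1"
  have \<mu>: "0 < \<mu>" "\<mu> \<le> 1" "\<mu> \<le> \<kappa>" using \<kappa> by (auto simp: \<mu>_def)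
  define K where "K = 700 * norm w ^ 3 * exp (3 * norm w)"
  define F where "F = (\<lambda>r z. infsum (\<lambda>p. gaussian r (z + lattice_point u v p)) UNIV)"
  have hs: "((\<lambda>p. gaussian r (lattice_point u v p + z)) has_sum F r z) UNIV" if "r > 0" for r z
    using has_sum_infsum[OF gaussian_lattice_summable[OF d that, of z]]
    by (simp add: F_def add.commute)
  have per: "F r (z + lattice_point u v q) = F r z" for r z
  proof -
    have "lattice_point u v (p + q) = lattice_point u v q + lattice_point u v p" for p
      by (auto simp: lattice_point_def case_prod_unfold algebra_simps)
    moreover have "bij_betw (\<lambda>p. p + q) UNIV UNIV"
      by (rule bij_betw_byWitness[where f' = "\<lambda>p. p - q"]) auto
    ultimately show ?thesis
      unfolding F_def using infsum_reindex_bij_betw[of "\<lambda>p. p + q" UNIV UNIV "\<lambda>p. gaussian r (z + lattice_point u v p)"]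
      by (simp add: add.assoc)
  qed
  have "\<bar>F r w - F r 0\<bar> \<le> (4 * K / \<mu> ^ 2) * r" if r: "0 < r" "r \<le> 1" for r
  proof -
    define \<sigma> where "\<sigma> = r * \<mu>"
    have \<sigma>: "0 < \<sigma>" "\<sigma> \<le> 1" using r \<mu> mult_mono[of r 1 \<mu> 1] by (auto simp: \<sigma>_def)
    let ?L = "lattice_point u v"
    \<comment> \<open>Summed over the lattice, \<open>S\<^sup>3 - 3 S\<^sup>2 + 3 S - 1\<close> becomes \<open>4 (S - 1)\<close> as \<open>S\<^sup>2 = 1\<close>.\<close>
    let ?t = "\<lambda>p. gaussian r (?L p + 3 * w) + (-3) * gaussian r (?L p + 2 * w)
       + 3 * gaussian r (?L p + w) + (-1) * gaussian r (?L p + 0)"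
    have "(?t has_sum (F r (3 * w) + (-3) * F r (2 * w) + 3 * F r w + (-1) * F r 0)) UNIV"
      by (intro has_sum_add has_sum_cmult_right hs r)
    moreover have "F r (3 * w) = F r w" using per[of r w] w by (simp add: algebra_simps flip: w)
    moreover have "F r (2 * w) = F r 0" using per[of r 0] w by simp
    ultimately have t: "(?t has_sum (4 * (F r w - F r 0))) UNIV" by (simp add: algebra_simps)
    let ?g = "\<lambda>p::int \<times> int. exp (- \<sigma> * (\<bar>real_of_int (fst p)\<bar> + \<bar>real_of_int (snd p)\<bar>))"
    have tb: "norm (?t p) \<le> K * r ^ 3 * ?g p" for p
    proof -
      have "\<mu> * (\<bar>real_of_int (fst p)\<bar> + \<bar>real_of_int (snd p)\<bar>) \<le> norm (?L p)"
        using \<kappa>(2)[of "fst p" "snd p"] \<mu>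
          mult_right_mono[of \<mu> \<kappa> "\<bar>real_of_int (fst p)\<bar> + \<bar>real_of_int (snd p)\<bar>"] by simp
      hence "exp (- (r * norm (?L p))) \<le> ?g p"
        using r mult_left_mono[of "\<mu> * (\<bar>real_of_int (fst p)\<bar> + \<bar>real_of_int (snd p)\<bar>)" "norm (?L p)" r]
        by (simp add: \<sigma>_def mult.assoc)
      hence "K * r ^ 3 * exp (- (r * norm (?L p))) \<le> K * r ^ 3 * ?g p"
        using r by (intro mult_left_mono) (auto simp: K_def)
      moreover have "norm (?t p) \<le> K * r ^ 3 * exp (- (r * norm (?L p)))"
        using gaussian_third_difference[OF r, of "?L p" w] by (simp add: K_def)
      ultimately show ?thesis by linarith
    qed
    have gs: "((\<lambda>p. K * r ^ 3 * ?g p) has_sum (K * r ^ 3 * infsum ?g UNIV)) UNIV"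
      by (intro has_sum_cmult_right has_sum_infsum exp_lattice_sum(1) \<sigma>)
    have "norm (infsum ?t UNIV) \<le> K * r ^ 3 * infsum ?g UNIV"
      by (rule norm_infsum_le[OF has_sum_infsum gs tb]) (use t in \<open>auto simp: summable_on_def\<close>)
    hence "4 * \<bar>F r w - F r 0\<bar> \<le> K * r ^ 3 * infsum ?g UNIV"
      unfolding infsumI[OF t] real_norm_def by (simp only: abs_mult abs_numeral)
    also have "\<dots> \<le> K * r ^ 3 * (2 / (1 - exp (- \<sigma>))) ^ 2"
      using r by (intro mult_left_mono exp_lattice_sum(2) \<sigma>) (auto simp: K_def)
    also have "\<dots> \<le> K * r ^ 3 * (4 / \<sigma>) ^ 2"
      using r inverse_one_minus_exp_bound[OF \<sigma>] \<sigma>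
      by (intro mult_left_mono power_mono) (auto simp: K_def)
    also have "\<dots> = 4 * ((4 * K / \<mu> ^ 2) * r)"
      using r \<mu> by (simp add: \<sigma>_def power_mult_distrib power_divide power2_eq_square power3_eq_cube)
    finally show ?thesis by simp
  qed
  then show ?thesis unfolding F_def by (intro exI[of _ "4 * K / \<mu> ^ 2"]) simp
qed

text \<open>Halving \<open>r\<close> amounts to summing over half the lattice, that is, over four translates of the
  lattice by half periods. By the preceding lemma the four sums are nearly equal, so the theta
  series satisfies a geometric recursion with ratio \<open>4\<close>.\<close>

lemma lattice_theta_asymptotics:
  fixes u v :: complex
  assumes d: "Im (cnj u * v) \<noteq> 0"
  shows "\<exists>c. (\<lambda>k. infsum (\<lambda>p. exp (- ((norm (lattice_point u v p)) ^ 2 / 4 ^ k))) UNIV - c * 4 ^ k) \<longlonglongrightarrow> 0"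
proof -
  let ?L = "lattice_point u v"
  define F where "F = (\<lambda>r z. infsum (\<lambda>p. gaussian r (z + ?L p)) UNIV)"
  define S where "S = ({0, 1} \<times> {0, 1} :: (int \<times> int) set)"
  have "\<exists>K. \<forall>r. 0 < r \<longrightarrow> r \<le> 1 \<longrightarrow> \<bar>F r (?L s / 2) - F r 0\<bar> \<le> K * r" for s
    using gaussian_lattice_half_period[OF d, of "?L s / 2" s] by (simp add: F_def)
  then obtain K where K: "\<And>s r. 0 < r \<Longrightarrow> r \<le> 1 \<Longrightarrow> \<bar>F r (?L s / 2) - F r 0\<bar> \<le> K s * r"
    by metis
  have step: "F (r / 2) 0 = (\<Sum>s\<in>S. F r (?L s / 2))" if r: "r > 0" for r
  proof -
    have "F (r / 2) 0 = (\<Sum>(i, j)\<in>S. infsum (\<lambda>(x, y). gaussian (r / 2) (?L (2 * x + i, 2 * y + j))) UNIV)"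
      using infsum_parity_classes[OF gaussian_lattice_summable[OF d, of "r / 2" 0]] r
      by (simp add: F_def S_def)
    also have "\<dots> = (\<Sum>s\<in>S. F r (?L s / 2))"
    proof (intro sum.cong refl)
      fix s assume "s \<in> S"
      have "gaussian (r / 2) (?L (2 * x + fst s, 2 * y + snd s)) = gaussian r (?L s / 2 + ?L (x, y))" for x y
      proof -
        have "?L (2 * x + fst s, 2 * y + snd s) = 2 * (?L s / 2 + ?L (x, y))"
          by (simp add: lattice_point_def case_prod_unfold algebra_simps)
        hence "norm (?L (2 * x + fst s, 2 * y + snd s)) = 2 * norm (?L s / 2 + ?L (x, y))"
          by (simp only: norm_mult norm_numeral)
        then show ?thesis by (simp add: gaussian_def)
      qed
      then show "(case s of (i, j) \<Rightarrow> infsum (\<lambda>(x, y). gaussian (r / 2) (?L (2 * x + i, 2 * y + j))) UNIV)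
          = F r (?L s / 2)"
        by (simp add: F_def case_prod_unfold)
    qed
    finally show ?thesis .
  qed
  have "\<exists>c. (\<lambda>k. F (1 / 2 ^ k) 0 - c * 4 ^ k) \<longlonglongrightarrow> 0"
  proof (rule asymptotic_of_geometric_recursion)
    show "\<bar>F (1 / 2 ^ Suc k) 0 - 4 * F (1 / 2 ^ k) 0\<bar> \<le> (\<Sum>s\<in>S. K s) / 2 ^ k" for k
    proof -
      have "F (1 / 2 ^ Suc k) 0 - 4 * F (1 / 2 ^ k) 0
          = (\<Sum>s\<in>S. F (1 / 2 ^ k) (?L s / 2) - F (1 / 2 ^ k) 0)"
        using step[of "1 / 2 ^ k"] by (simp add: sum_subtractf mult.commute) (simp add: S_def)
      also have "\<bar>\<dots>\<bar> \<le> (\<Sum>s\<in>S. K s * (1 / 2 ^ k))"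
        by (intro order_trans[OF sum_abs] sum_mono K) auto
      finally show ?thesis by (simp add: sum_divide_distrib)
    qed
  qed simp
  moreover have "F (1 / 2 ^ k) 0 = infsum (\<lambda>p. exp (- ((norm (?L p)) ^ 2 / 4 ^ k))) UNIV" for k
    by (simp add: F_def gaussian_def power_divide power_mult[symmetric] power2_eq_square
          power_mult_distrib[symmetric])
  ultimately show ?thesis by simp
qed

section \<open>The Jacobi symbol\<close>

lemma chi4_odd: "odd x \<Longrightarrow> chi4 x = (if x mod 4 = 1 then 1 else -1)"
proof -
  assume "odd x"
  then obtain k where k: "x = 2 * k + 1" by (auto elim: oddE)
  have "even (nat \<bar>k\<bar>) \<longleftrightarrow> even k" by (simp add: even_nat_iff)
  moreover have "x mod 4 = 1 \<longleftrightarrow> even k" unfolding k by presburger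
  ultimately show ?thesis by (simp add: chi4_def k)
qed

lemma chi8_odd: "odd x \<Longrightarrow> chi8 x = (if x mod 8 = 1 \<or> x mod 8 = 7 then 1 else -1)"
proof -
  assume "odd x"
  define q where "q = x div 8"
  define r where "r = x mod 8"
  have x: "x = 8 * q + r" by (simp add: q_def r_def)
  have "r \<in> {0..<8}" by (simp add: r_def)
  moreover have "odd r" using \<open>odd x\<close> x by simp
  ultimately have "r = 1 \<or> r = 3 \<or> r = 5 \<or> r = 7" by (auto simp: atLeastLessThan_def) presburger
  have e: "(x\<^sup>2 - 1) div 8 = 2 * (4 * q\<^sup>2 + r * q) + - 2 * (r * q) + 2 * q * r + (r\<^sup>2 - 1) div 8"
  proof -
    have "x\<^sup>2 - 1 = 8 * (8 * q\<^sup>2 + 2 * q * r) + (r\<^sup>2 - 1)"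
      unfolding x by (simp add: power2_eq_square algebra_simps)
    hence "(x\<^sup>2 - 1) div 8 = (8 * q\<^sup>2 + 2 * q * r) + (r\<^sup>2 - 1) div 8"
      by (simp only: div_mult_self4)
    then show ?thesis by simp
  qed
  have "(x\<^sup>2 - 1) div 8 \<ge> 0"
  proof -
    have "x \<noteq> 0" using \<open>odd x\<close> by auto
    hence "x\<^sup>2 > 0" by simp
    hence "x\<^sup>2 - 1 \<ge> 0" by linarith
    then show ?thesis by (simp add: pos_imp_zdiv_nonneg_iff del: one_le_power)
  qed
  hence "chi8 x = (if even ((x\<^sup>2 - 1) div 8) then 1 else -1)"
    by (simp add: chi8_def even_nat_iff)
  also have "even ((x\<^sup>2 - 1) div 8) \<longleftrightarrow> even ((r\<^sup>2 - 1) div 8)" unfolding e by simp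
  also have "\<dots> \<longleftrightarrow> r = 1 \<or> r = 7"
    using \<open>r = 1 \<or> r = 3 \<or> r = 5 \<or> r = 7\<close> by auto
  finally show ?thesis by (simp add: r_def)
qed

lemma chi4_mult: "odd x \<Longrightarrow> odd y \<Longrightarrow> chi4 (x * y) = chi4 x * chi4 y"
proof -
  assume o: "odd x" "odd y"
  have "x mod 4 = 1 \<or> x mod 4 = 3" "y mod 4 = 1 \<or> y mod 4 = 3" using o by presburger+
  moreover have "(x * y) mod 4 = ((x mod 4) * (y mod 4)) mod 4" by (simp add: mod_mult_eq)
  moreover have "odd (x * y)" using o by simp
  ultimately show ?thesis
    unfolding chi4_odd[OF o(1)] chi4_odd[OF o(2)] chi4_odd[OF \<open>odd (x * y)\<close>]
    by (elim disjE) simp_all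
qed

lemma chi8_mult: "odd x \<Longrightarrow> odd y \<Longrightarrow> chi8 (x * y) = chi8 x * chi8 y"
proof -
  assume o: "odd x" "odd y"
  have "x mod 8 = 1 \<or> x mod 8 = 3 \<or> x mod 8 = 5 \<or> x mod 8 = 7"
    "y mod 8 = 1 \<or> y mod 8 = 3 \<or> y mod 8 = 5 \<or> y mod 8 = 7" using o by presburger+
  moreover have "(x * y) mod 8 = ((x mod 8) * (y mod 8)) mod 8" by (simp add: mod_mult_eq)
  moreover have "odd (x * y)" using o by simp
  ultimately show ?thesis
    unfolding chi8_odd[OF o(1)] chi8_odd[OF o(2)] chi8_odd[OF \<open>odd (x * y)\<close>]
    by (elim disjE) simp_all
qed

lemma Legendre_values: "Legendre x p \<in> {-1, 0, 1}" by (auto simp: Legendre_def)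

lemma Legendre_eq_0_iff: "Legendre x p = 0 \<longleftrightarrow> p dvd x"
  by (auto simp: Legendre_def cong_0_iff)

lemma Legendre_cong: "[x = y] (mod p) \<Longrightarrow> Legendre x p = Legendre y p"
proof -
  assume "[x = y] (mod p)"
  hence "[x = z] (mod p) \<longleftrightarrow> [y = z] (mod p)" "[z = x] (mod p) \<longleftrightarrow> [z = y] (mod p)" for z
    by (simp_all add: Cong.cong_def)
  then show ?thesis by (simp add: Legendre_def QuadRes_def)
qed

lemma signs_cong_imp_eq:
  fixes a b p :: int
  assumes "[a = b] (mod p)" "a \<in> {-1, 0, 1}" "b \<in> {-1, 0, 1}" "p > 2"
  shows "a = b"
proof -
  have "p dvd a - b" using assms(1) by (simp add: cong_iff_dvd_diff)
  moreover have "\<bar>a - b\<bar> < p" using assms by auto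
  ultimately show ?thesis using zdvd_not_zless[of "\<bar>a - b\<bar>" p] by (cases "a = b") auto
qed

context
  fixes p :: int
  assumes p: "prime p" "p > 2"
begin

lemma Legendre_euler: "[Legendre x p = x ^ nat ((p - 1) div 2)] (mod p)"
proof -
  have "prime (nat p)" using p(1) prime_int_nat_transfer by blast
  moreover have "2 < nat p" using p(2) by simp
  ultimately have "[Legendre x p = x ^ ((nat p - 1) div 2)] (mod p)"
    using euler_criterion[of "nat p" x] p by simp
  moreover have "(nat p - 1) div 2 = nat ((p - 1) div 2)"
    using p by (simp add: nat_div_distrib nat_diff_distrib)
  ultimately show ?thesis by simp
qed

lemma odd_prime: "odd p" using p prime_odd_int by blast

lemma Legendre_mult: "Legendre (x * y) p = Legendre x p * Legendre y p"
proof (rule signs_cong_imp_eq[OF _ _ _ p(2)])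
  have "[Legendre x p * Legendre y p = x ^ nat ((p - 1) div 2) * y ^ nat ((p - 1) div 2)] (mod p)"
    by (intro cong_mult Legendre_euler)
  with Legendre_euler[of "x * y"] show "[Legendre (x * y) p = Legendre x p * Legendre y p] (mod p)"
    by (metis cong_sym cong_trans power_mult_distrib)
qed (use Legendre_values[of x p] Legendre_values[of y p] Legendre_values[of "x * y" p] in auto)

lemma Legendre_minus_one: "Legendre (-1) p = chi4 p"
proof (rule signs_cong_imp_eq[OF _ _ _ p(2)])
  have "\<bar>(p - 1) div 2\<bar> = (p - 1) div 2" using p by simp
  hence "chi4 p = (-1) ^ nat ((p - 1) div 2)" by (simp only: chi4_def)
  with Legendre_euler[of "-1"] show "[Legendre (-1) p = chi4 p] (mod p)" by (simp only:)
qed (use Legendre_values[of "-1" p] chi4_odd[OF odd_prime] in auto)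

lemma Legendre_square: "\<not> p dvd x \<Longrightarrow> Legendre (x ^ 2) p = 1"
  unfolding Legendre_def QuadRes_def cong_0_iff
  using prime_dvd_power[OF p(1), of x 2] by (auto intro: cong_refl)

text \<open>By Gauss's lemma the exponent is the number of even residues above \<open>h = (p - 1) / 2\<close>, which
  is \<open>h - h div 2\<close>.\<close>

lemma Legendre_two: "Legendre 2 p = chi8 p"
proof -
  define h where "h = (p - 1) div 2"
  have ph: "p = 2 * h + 1" using odd_prime unfolding h_def by presburger
  have h0: "h \<ge> 1" using p ph by linarith
  have np: "int (nat p) = p" using p by simp
  have G: "GAUSS (nat p) 2"
  proof
    show "prime (nat p)" using p(1) prime_int_nat_transfer by blast
    show "2 < nat p" using p(2) by simp
    show "[2 \<noteq> 0] (mod int (nat p))" using p by (auto simp: cong_0_iff dest: zdvd_imp_le)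
  qed auto
  have E: "GAUSS.E (nat p) 2 = (\<lambda>x. 2 * x) ` {h div 2 + 1..h}"
  proof -
    have C: "(\<lambda>x. x mod p) ` (\<lambda>x. x * 2) ` {0<..h} = (\<lambda>x. 2 * x) ` {0<..h}"
      unfolding image_image by (intro image_cong refl) (use ph in auto)
    have "GAUSS.E (nat p) 2 = (\<lambda>x. 2 * x) ` {0<..h} \<inter> {h<..}"
      unfolding GAUSS.E_def[OF G] GAUSS.C_def[OF G] GAUSS.B_def[OF G] GAUSS.A_def[OF G] np
        h_def[symmetric] C ..
    also have "\<dots> = (\<lambda>x. 2 * x) ` {h div 2 + 1..h}" by auto
    finally show ?thesis .
  qed
  have "card (GAUSS.E (nat p) 2) = nat (h - h div 2)"
    unfolding E by (subst card_image) (auto simp: inj_on_def)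
  moreover have "h - h div 2 \<ge> 0" using h0 by linarith
  ultimately have "Legendre 2 p = (if even (h - h div 2) then 1 else -1)"
    using GAUSS.gauss_lemma[OF G] np by (simp add: even_nat_iff)
  moreover have "even (h - h div 2) \<longleftrightarrow> p mod 8 = 1 \<or> p mod 8 = 7" unfolding ph by presburger
  ultimately show ?thesis using chi8_odd[OF odd_prime] by simp
qed

text \<open>The sign is attached to one side, so that the formula also holds for \<open>q = p\<close>, where both
  symbols vanish, and can be multiplied over the prime factors of a number.\<close>

lemma Legendre_reciprocity:
  assumes q: "prime q" "q > 2"
  shows "Legendre p q = Legendre q p * (if chi4 p = -1 then chi4 q else 1)"
proof (cases "p = q")
  case True
  then show ?thesis using Legendre_eq_0_iff[of q q] by simp
next
  case False
  have oq: "odd q" using q prime_odd_int by blast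
  have ndvd: "\<not> p dvd q" using False p q primes_dvd_imp_eq by blast
  have "prime (nat p)" "prime (nat q)" using p(1) q(1) prime_int_nat_transfer by blast+
  from Quadratic_Reciprocity_int[OF this(1) p(2) this(2) q(2) False]
  have QR: "Legendre p q * Legendre q p = (-1) ^ nat ((p - 1) div 2 * ((q - 1) div 2))" .
  have "(p - 1) div 2 * ((q - 1) div 2) \<ge> 0" using p q by simp
  hence "(-1 :: int) ^ nat ((p - 1) div 2 * ((q - 1) div 2))
       = (if even ((p - 1) div 2) \<or> even ((q - 1) div 2) then 1 else -1)"
    by (simp add: even_nat_iff)
  moreover have "even ((p - 1) div 2) \<longleftrightarrow> p mod 4 = 1" using odd_prime by presburger
  moreover have "even ((q - 1) div 2) \<longleftrightarrow> q mod 4 = 1" using oq by presburger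
  moreover have "Legendre q p * Legendre q p = 1"
    using Legendre_values[of q p] ndvd Legendre_eq_0_iff[of q p] by auto
  ultimately show ?thesis using QR chi4_odd[OF odd_prime] chi4_odd[OF oq]
    by (smt (verit) mult.assoc mult_cancel_left1 mult.commute)
qed

end

text \<open>Everything that follows about the Jacobi symbol holds prime by prime, and passes to odd
  \<open>n\<close> by induction on the prime factorisation.\<close>

lemma odd_multiplicative_prime_factorization:
  fixes n :: int and f :: "int \<Rightarrow> int"
  assumes n: "odd n" "n > 0" and f1: "f 1 = 1"
    and fm: "\<And>x y. odd x \<Longrightarrow> odd y \<Longrightarrow> f (x * y) = f x * f y"
  shows "(\<Prod>p\<in>#prime_factorization n. f p) = f n"
proof -
  have "odd (prod_mset M) \<and> (\<Prod>p\<in>#M. f p) = f (prod_mset M)"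
    if "\<forall>p\<in>#M. odd p" for M :: "int multiset"
    using that by (induction M) (auto simp: f1 fm)
  moreover have "odd p" if "p \<in># prime_factorization n" for p
    using that n by (meson dvd_trans in_prime_factors_imp_dvd)
  ultimately show ?thesis using n by (metis less_irrefl prod_mset_prime_factorization_int)
qed

context
  fixes n :: int
  assumes n: "odd n" "n > 0"
begin

lemma odd_prime_factor:
  assumes "p \<in># prime_factorization n" shows "prime p" "p > 2"
proof -
  show "prime p" using assms by (rule in_prime_factors_imp_prime)
  moreover have "odd p" using assms n by (meson dvd_trans in_prime_factors_imp_dvd)
  ultimately show "p > 2" using prime_ge_2_int[of p] by (cases "p = 2") auto
qed

lemma jacobi_mult: "jacobi_symbol (x * y) n = jacobi_symbol x n * jacobi_symbol y n"
proof -
  have "jacobi_symbol (x * y) n = (\<Prod>p\<in>#prime_factorization n. Legendre x p * Legendre y p)"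
    unfolding jacobi_symbol_def
    by (intro arg_cong[where f = prod_mset] image_mset_cong Legendre_mult odd_prime_factor)
  then show ?thesis by (simp add: jacobi_symbol_def prod_mset.distrib)
qed

lemma jacobi_cong: "[x = y] (mod n) \<Longrightarrow> jacobi_symbol x n = jacobi_symbol y n"
  unfolding jacobi_symbol_def
  by (intro arg_cong[where f = prod_mset] image_mset_cong Legendre_cong)
     (auto dest: in_prime_factors_imp_dvd intro: cong_dvd_modulus)

lemma jacobi_nonzero: "coprime x n \<Longrightarrow> jacobi_symbol x n \<in> {1, -1}"
proof -
  assume c: "coprime x n"
  have "\<not> p dvd x" if "p \<in># prime_factorization n" for p
    using that c odd_prime_factor[OF that]
    by (meson coprime_common_divisor in_prime_factors_imp_dvd not_prime_unit)
  hence "\<forall>p\<in>#prime_factorization n. Legendre x p \<in> {1, -1}"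
    using Legendre_values Legendre_eq_0_iff by blast
  then have "(\<Prod>p\<in>#M. Legendre x p) \<in> {1, -1}" if "M \<subseteq># prime_factorization n" for M
    using that
  proof (induction M)
    case (add q M)
    then have "q \<in># prime_factorization n" "M \<subseteq># prime_factorization n"
      by (auto dest: mset_subset_eqD simp: subset_mset.order_trans insert_subset_eq_iff)
    then show ?case using add by auto
  qed auto
  then show ?thesis unfolding jacobi_symbol_def by blast
qed

lemma jacobi_minus_one: "jacobi_symbol (-1) n = chi4 n"
proof -
  have "jacobi_symbol (-1) n = (\<Prod>p\<in>#prime_factorization n. chi4 p)"
    unfolding jacobi_symbol_def
    by (intro arg_cong[where f = prod_mset] image_mset_cong Legendre_minus_one odd_prime_factor)
  also have "\<dots> = chi4 n"
    by (rule odd_multiplicative_prime_factorization[OF n _ chi4_mult]) (auto simp: chi4_def)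
  finally show ?thesis .
qed

lemma jacobi_two: "jacobi_symbol 2 n = chi8 n"
proof -
  have "jacobi_symbol 2 n = (\<Prod>p\<in>#prime_factorization n. chi8 p)"
    unfolding jacobi_symbol_def
    by (intro arg_cong[where f = prod_mset] image_mset_cong Legendre_two odd_prime_factor)
  also have "\<dots> = chi8 n"
    by (rule odd_multiplicative_prime_factorization[OF n _ chi8_mult]) (auto simp: chi8_def)
  finally show ?thesis .
qed

lemma jacobi_prime:
  assumes p: "prime p" "p > 2"
  shows "jacobi_symbol p n = Legendre n p * (if chi4 p = -1 then chi4 n else 1)"
proof -
  let ?g = "\<lambda>q. Legendre q p * (if chi4 p = -1 then chi4 q else 1)"
  have "jacobi_symbol p n = (\<Prod>q\<in>#prime_factorization n. ?g q)"
    unfolding jacobi_symbol_def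
    by (intro arg_cong[where f = prod_mset] image_mset_cong Legendre_reciprocity p odd_prime_factor)
  also have "\<dots> = ?g n"
  proof (rule odd_multiplicative_prime_factorization[OF n])
    have "Legendre 1 p = 1" using Legendre_square[OF p, of 1] p by auto
    then show "?g 1 = 1" by (simp add: chi4_def)
  qed (auto simp: Legendre_mult[OF p] chi4_mult)
  finally show ?thesis .
qed

end

section \<open>The quadratic character of an imaginary quadratic field\<close>

locale imaginary_quadratic =
  fixes m :: int
  assumes m_neg: "m < 0" and m_squarefree: "squarefree m"
    and discriminant_less: "quadratic_discriminant m < -4"
begin

abbreviation D :: int where "D \<equiv> quadratic_discriminant m"
abbreviation N :: int where "N \<equiv> \<bar>quadratic_discriminant m\<bar>"
abbreviation chi :: "int \<Rightarrow> int" where "chi \<equiv> quadratic_character m"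

lemma N_greater: "N > 4" using discriminant_less by simp

lemma m_mod_4: "m mod 4 = 1 \<or> m mod 4 = 2 \<or> m mod 4 = 3"
proof -
  have "\<not> 2\<^sup>2 dvd m" using squarefreeD[OF m_squarefree, of 2] by auto
  hence "\<not> 4 dvd m" by simp
  then show ?thesis by presburger
qed

text \<open>The character is a product of a character modulo \<open>8\<close> and the Jacobi symbol modulo the odd
  number below. As \<open>m\<close> is negative, it is minus this number, or minus twice it.\<close>

definition two_part :: "int \<Rightarrow> int" where
  "two_part x = (if m mod 4 = 1 then 1 else if m mod 4 = 3 then chi4 x
     else if (m div 2) mod 4 = 1 then chi8 x else chi4 x * chi8 x)"

definition odd_part :: int where
  "odd_part = (if m mod 4 = 2 then - (m div 2) else - m)"

lemma m_cases:
  obtains "m mod 4 = 1" "- odd_part = m" "odd_part mod 4 = 3"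
    | "m mod 4 = 3" "- odd_part = m" "odd_part mod 4 = 1"
    | "m mod 4 = 2" "(m div 2) mod 4 = 1" "- (2 * odd_part) = m" "odd_part mod 4 = 3"
    | "m mod 4 = 2" "(m div 2) mod 4 = 3" "- (2 * odd_part) = m" "odd_part mod 4 = 1"
proof -
  consider "m mod 4 = 1" | "m mod 4 = 3" | "m mod 4 = 2" using m_mod_4 by blast
  then show ?thesis
  proof cases
    case 1
    then have o: "odd_part = - m" by (simp add: odd_part_def)
    have "(- m) mod 4 = 3" using 1 by presburger
    with o 1 show ?thesis by (intro that(1)) (simp_all only: minus_minus)
  next
    case 2
    then have o: "odd_part = - m" by (simp add: odd_part_def)
    have "(- m) mod 4 = 1" using 2 by presburger
    with o 2 show ?thesis by (intro that(2)) (simp_all only: minus_minus)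
  next
    case 3
    define k where "k = m div 2"
    have m: "2 * k = m" using 3 unfolding k_def by presburger
    have o: "odd_part = - k" using 3 by (simp add: odd_part_def k_def)
    have om: "- (2 * odd_part) = m" unfolding o using m by simp
    have "(2 * k) mod 4 = 2" using 3 m by simp
    hence "k mod 4 = 1 \<or> k mod 4 = 3" by presburger
    then consider "k mod 4 = 1" | "k mod 4 = 3" by blast
    then show ?thesis
    proof cases
      assume *: "k mod 4 = 1"
      then have "(- k) mod 4 = 3" by presburger
      then show ?thesis by (rule that(3)[OF 3 *[unfolded k_def] om, unfolded o])
    next
      assume *: "k mod 4 = 3"
      then have "(- k) mod 4 = 1" by presburger
      then show ?thesis by (rule that(4)[OF 3 *[unfolded k_def] om, unfolded o])
    qed
  qed
qed

lemma two_part_cases: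
  "m mod 4 = 1 \<Longrightarrow> two_part x = 1"
  "m mod 4 = 3 \<Longrightarrow> two_part x = chi4 x"
  "m mod 4 = 2 \<Longrightarrow> (m div 2) mod 4 = 1 \<Longrightarrow> two_part x = chi8 x"
  "m mod 4 = 2 \<Longrightarrow> (m div 2) mod 4 = 3 \<Longrightarrow> two_part x = chi4 x * chi8 x"
  by (simp_all only: two_part_def) simp_all

lemma odd_part: "odd odd_part" "odd_part > 0"
proof -
  have "odd_part mod 4 = 1 \<or> odd_part mod 4 = 3" by (cases rule: m_cases) simp_all
  then show "odd odd_part" by presburger
  have "- odd_part = m \<or> - (2 * odd_part) = m" by (cases rule: m_cases) simp_all
  then show "odd_part > 0" using m_neg by linarith
qed

lemma odd_part_dvd: "odd_part dvd N"
proof -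
  have "- odd_part = m \<or> - (2 * odd_part) = m" by (cases rule: m_cases) simp_all
  hence "odd_part dvd m" by (metis dvd_minus_iff dvd_refl dvd_triv_right minus_dvd_iff)
  then show ?thesis by (simp add: quadratic_discriminant_def)
qed

lemma chi_eq: "chi x = (if coprime x N then two_part x * jacobi_symbol x odd_part else 0)"
proof -
  have "gcd x N \<noteq> 0" using N_greater by auto
  hence "gcd x N \<ge> 1" using gcd_ge_0_int[of x N] by linarith
  hence "gcd x N > 1 \<longleftrightarrow> \<not> coprime x N" unfolding coprime_iff_gcd_eq_1 by linarith
  moreover have "m mod 4 = 1 \<or> m mod 4 = 3 \<Longrightarrow> odd_part = \<bar>m\<bar>" "m mod 4 = 2 \<Longrightarrow> odd_part = \<bar>m div 2\<bar>"
    using m_neg by (auto simp: odd_part_def)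
  ultimately show ?thesis
    unfolding quadratic_character_def two_part_def using m_mod_4
    by (elim disjE) (simp_all only: if_False if_True, simp_all)
qed

lemma coprime_N_odd: "coprime x N \<Longrightarrow> m mod 4 \<noteq> 1 \<Longrightarrow> odd x"
proof
  assume "coprime x N" "m mod 4 \<noteq> 1" "even x"
  moreover from this have "2 dvd N" by (simp add: quadratic_discriminant_def)
  ultimately show False using coprime_common_divisor[of x N 2] by simp
qed

lemma two_part_mult:
  "coprime x N \<Longrightarrow> coprime y N \<Longrightarrow> two_part (x * y) = two_part x * two_part y"
proof (cases rule: m_cases)
  case 1
  then show ?thesis by (simp only: two_part_cases mult_1)
next
  assume c: "coprime x N" "coprime y N"
  have o: "odd x" "odd y" if "m mod 4 \<noteq> 1" using that c coprime_N_odd by blast+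
  {
    case 2
    then have xy: "odd x" "odd y" using o by auto
    with 2 show ?thesis by (simp only: two_part_cases chi4_mult[OF xy])
  next
    case 3
    then have xy: "odd x" "odd y" using o by auto
    with 3 show ?thesis by (simp only: two_part_cases chi8_mult[OF xy])
  next
    case 4
    then have xy: "odd x" "odd y" using o by auto
    with 4 show ?thesis by (simp only: two_part_cases chi4_mult[OF xy] chi8_mult[OF xy] mult_ac)
  }
qed

lemma two_part_values: "coprime x N \<Longrightarrow> two_part x \<in> {1, -1}"
proof (cases rule: m_cases)
  case 1
  then show ?thesis by (simp only: two_part_cases insert_iff simp_thms)
next
  assume c: "coprime x N"
  have v: "chi4 x \<in> {1, -1}" "chi8 x \<in> {1, -1}" if "m mod 4 \<noteq> 1"
    using coprime_N_odd[OF c that] by (auto simp: chi4_odd chi8_odd)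
  {
    case 2
    then show ?thesis using v by (simp add: two_part_cases)
  next
    case 3
    then show ?thesis using v by (simp add: two_part_cases)
  next
    case 4
    then show ?thesis using v by (auto simp: two_part_cases)
  }
qed

lemma chi_mult: "chi (x * y) = chi x * chi y"
proof (cases "coprime x N \<and> coprime y N")
  case True
  then have "coprime (x * y) N" by simp
  with True show ?thesis
    by (simp only: chi_eq if_True simp_thms two_part_mult jacobi_mult[OF odd_part] mult_ac)
next
  case False
  then have "\<not> coprime (x * y) N" by simp
  with False show ?thesis by (simp only: chi_eq if_False de_Morgan_conj) auto
qed

lemma chi_zero: "\<not> coprime x N \<Longrightarrow> chi x = 0" by (simp add: chi_eq)

lemma chi_values: "coprime x N \<Longrightarrow> chi x \<in> {1, -1}"
proof -
  assume c: "coprime x N"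
  hence "coprime x odd_part" using odd_part_dvd coprime_divisors dvd_refl by blast
  from jacobi_nonzero[OF odd_part this] two_part_values[OF c] c show ?thesis by (auto simp: chi_eq)
qed

lemma chi_mod: "chi (x mod N) = chi x"
proof -
  have c: "coprime (x mod N) N \<longleftrightarrow> coprime x N"
    unfolding coprime_iff_gcd_eq_1 by (metis gcd.commute gcd_red_int)
  have J: "jacobi_symbol (x mod N) odd_part = jacobi_symbol x odd_part"
    by (rule jacobi_cong[OF odd_part])
       (meson cong_dvd_modulus cong_mod_left cong_refl odd_part_dvd)
  have "two_part (x mod N) = two_part x" if cx: "coprime x N"
  proof -
    have d: "4 dvd N" if "m mod 4 \<noteq> 1" using that by (simp add: quadratic_discriminant_def)
    have d8: "8 dvd N" if "m mod 4 = 2"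
    proof -
      have "2 dvd m" using that by presburger
      then show ?thesis using that unfolding quadratic_discriminant_def by auto
    qed
    have m4: "x mod N mod 4 = x mod 4" if "m mod 4 \<noteq> 1" using d[OF that] by (rule mod_mod_cancel)
    have m8: "x mod N mod 8 = x mod 8" if "m mod 4 = 2" using d8[OF that] by (rule mod_mod_cancel)
    have o: "odd x" "odd (x mod N)" if "m mod 4 \<noteq> 1"
      using that coprime_N_odd cx c by blast+
    have "chi4 (x mod N) = chi4 x" if "m mod 4 \<noteq> 1"
      by (simp only: chi4_odd[OF o(1)[OF that]] chi4_odd[OF o(2)[OF that]] m4[OF that])
    moreover have "chi8 (x mod N) = chi8 x" if "m mod 4 = 2"
    proof -
      from that have 1: "m mod 4 \<noteq> 1" by simp
      show ?thesis
        by (simp only: chi8_odd[OF o(1)[OF 1]] chi8_odd[OF o(2)[OF 1]] m8[OF that])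
    qed
    ultimately show ?thesis unfolding two_part_def using m_mod_4 by presburger
  qed
  with c J show ?thesis by (simp add: chi_eq)
qed

lemma chi_minus_one: "chi (-1) = -1"
proof -
  have "chi (-1) = two_part (-1) * chi4 odd_part"
    using jacobi_minus_one[OF odd_part] by (simp add: chi_eq)
  also have "\<dots> = -1"
  proof -
    show ?thesis
    proof (cases rule: m_cases)
      case 1
        then show ?thesis by (simp add: two_part_cases chi4_odd odd_part)
    next
      case 2
        then show ?thesis by (simp add: two_part_cases chi4_odd odd_part)
    next
      case 3
        then show ?thesis by (simp add: two_part_cases chi4_odd chi8_odd odd_part)
    next
      case 4
        then show ?thesis by (simp add: two_part_cases chi4_odd chi8_odd odd_part)
    qed
  qed
  finally show ?thesis .
qed

text \<open>Reciprocity turns the Jacobi symbol of \<open>p\<close> into a Legendre symbol modulo \<open>p\<close>, and the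
  sign that it costs combines with the character modulo \<open>8\<close> to the Legendre symbols of \<open>-1\<close>
  and \<open>2\<close> that are missing from the one of \<open>m\<close>.\<close>

lemma chi_odd_prime:
  assumes p: "prime p" "p > 2" "\<not> p dvd D"
  shows "chi p = Legendre D p"
proof -
  note pp = p(1,2)
  have "coprime p N" using p by (simp add: prime_imp_coprime)
  hence "chi p = two_part p * (Legendre odd_part p * (if chi4 p = -1 then chi4 odd_part else 1))"
    using jacobi_prime[OF odd_part pp] by (simp add: chi_eq)
  moreover have "Legendre D p = Legendre m p"
  proof -
    have "\<not> p dvd 2" using zdvd_imp_le[of p 2] p by auto
    hence "Legendre (2\<^sup>2 * m) p = Legendre m p"
      using Legendre_mult[OF pp, of "2\<^sup>2" m] Legendre_square[OF pp, of 2] by simp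
    then show ?thesis by (simp add: quadratic_discriminant_def)
  qed
  moreover have "chi4 p = 1 \<or> chi4 p = -1" using odd_prime[OF pp] by (simp add: chi4_odd)
  moreover have neg: "Legendre (- y) p = chi4 p * Legendre y p" for y
    using Legendre_mult[OF pp, of "-1" y] Legendre_minus_one[OF pp] by simp
  moreover have two: "Legendre (2 * y) p = chi8 p * Legendre y p" for y
    using Legendre_mult[OF pp, of 2 y] Legendre_two[OF pp] by simp
  moreover have "two_part p * (Legendre odd_part p * (if chi4 p = -1 then chi4 odd_part else 1)) = Legendre m p"
    if c: "chi4 p = 1 \<or> chi4 p = -1"
  proof (cases rule: m_cases)
    case 1
    with c neg[of odd_part] show ?thesis
      unfolding chi4_odd[OF odd_part(1)] by (elim disjE) (simp_all add: two_part_cases)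
  next
    case 2
    with c neg[of odd_part] show ?thesis
      unfolding chi4_odd[OF odd_part(1)] by (elim disjE) (simp_all add: two_part_cases)
  next
    case 3
    with c neg[of "2 * odd_part"] two[of odd_part] show ?thesis
      unfolding chi4_odd[OF odd_part(1)] by (elim disjE) (simp_all add: two_part_cases)
  next
    case 4
    with c neg[of "2 * odd_part"] two[of odd_part] show ?thesis
      unfolding chi4_odd[OF odd_part(1)] by (elim disjE) (simp_all add: two_part_cases)
  qed
  ultimately show ?thesis by simp
qed

lemma chi_two: assumes "odd D" shows "chi 2 = (if D mod 8 = 1 then 1 else -1)"
proof -
  have m1: "m mod 4 = 1" "D = m" using assms by (auto simp: quadratic_discriminant_def split: if_splits)
  have "coprime 2 N" using assms by simp
  hence "chi 2 = chi8 odd_part" using jacobi_two[OF odd_part] m1 by (simp add: chi_eq two_part_def)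
  also have "\<dots> = (if odd_part mod 8 = 1 \<or> odd_part mod 8 = 7 then 1 else -1)"
    by (rule chi8_odd[OF odd_part(1)])
  also have "odd_part mod 8 = 1 \<or> odd_part mod 8 = 7 \<longleftrightarrow> D mod 8 = 1"
  proof -
    have "odd_part = - m" using m1 by (simp add: odd_part_def)
    moreover have "m mod 8 = 1 \<or> m mod 8 = 5" using m1(1) by presburger
    moreover have "(- m) mod 8 = (- (m mod 8)) mod 8" by (simp add: mod_minus_eq)
    ultimately show ?thesis unfolding m1(2) by (elim disjE) simp_all
  qed
  finally show ?thesis .
qed

end

section \<open>Multiplicative functions\<close>

lemma multiplicative_eqI:
  fixes F G :: "nat \<Rightarrow> int"
  assumes F: "\<And>x y. x > 0 \<Longrightarrow> y > 0 \<Longrightarrow> coprime x y \<Longrightarrow> F (x * y) = F x * F y"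
    and G: "\<And>x y. x > 0 \<Longrightarrow> y > 0 \<Longrightarrow> coprime x y \<Longrightarrow> G (x * y) = G x * G y"
    and pp: "\<And>p k. prime p \<Longrightarrow> F (p ^ k) = G (p ^ k)"
    and n: "n > 0"
  shows "F n = G n"
  using n
proof (induction n rule: less_induct)
  case (less n)
  show ?case
  proof (cases "n = 1")
    case True
    then show ?thesis using pp[of 2 0] by simp
  next
    case False
    then obtain p where p: "prime p" "p dvd n" using prime_factor_nat by blast
    obtain q where q: "n = p ^ multiplicity p n * q" "\<not> p dvd q"
      using multiplicity_decompose'[of n p] less.prems p not_prime_unit by blast
    have k: "multiplicity p n > 0"
      using p less.prems by (simp add: prime_multiplicity_gt_zero_iff)
    have q0: "q > 0" using q less.prems by (cases "q = 0") auto
    have "p ^ multiplicity p n > 1" using k p prime_gt_1_nat by (intro one_less_power) auto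
    hence "q < n" using q0 by (subst q(1)) simp
    hence "F q = G q" using less.IH q0 by blast
    moreover have "coprime (p ^ multiplicity p n) q"
      using q(2) p(1) by (simp add: prime_imp_coprime)
    ultimately show ?thesis
      using F[of "p ^ multiplicity p n" q] G[of "p ^ multiplicity p n" q] pp[OF p(1)] q0 p
      by (subst (1 2) q(1)) (simp add: prime_gt_0_nat)
  qed
qed

text \<open>For coprime \<open>x\<close> and \<open>y\<close> the divisors of \<open>x y\<close> are the products of divisors of \<open>x\<close> and \<open>y\<close>,
  and this respects the condition on the \<open>e\<close>-th powers. The cases \<open>e = 1\<close> and \<open>e = 2\<close> are used
  for the two sides of the identity that counts ideals.\<close>

lemma sum_power_divisors_multiplicative:
  fixes H :: "nat \<Rightarrow> nat \<Rightarrow> int"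
  assumes xy: "coprime x y" "x > 0" "y > 0" and e: "e > 0"
    and H: "\<And>g h. g ^ e dvd x \<Longrightarrow> h ^ e dvd y \<Longrightarrow> H (g * h) (x * y) = H g x * H h y"
  shows "(\<Sum>g | g ^ e dvd x * y. H g (x * y)) = (\<Sum>g | g ^ e dvd x. H g x) * (\<Sum>h | h ^ e dvd y. H h y)"
proof -
  have base: "g dvd n" if "g ^ e dvd n" for g n :: nat
    using that e by (metis dvd_power dvd_trans)
  have gcds: "gcd (g * h) x = g" "gcd (g * h) y = h" if "g dvd x" "h dvd y" for g h
  proof -
    have c: "coprime x h" "coprime y g"
      using that xy(1) by (meson coprime_commute coprime_divisors dvd_refl)+
    show "gcd (g * h) x = g" "gcd (g * h) y = h"
      unfolding gcd_mult_left_right_cancel[OF c(1)] gcd_mult_left_left_cancel[OF c(2)]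
      using that by (simp_all add: gcd_nat.absorb1)
  qed
  have "bij_betw (\<lambda>(g, h). g * h) ({g. g ^ e dvd x} \<times> {h. h ^ e dvd y}) {g. g ^ e dvd x * y}"
  proof (rule bij_betw_imageI)
    show "inj_on (\<lambda>(g, h). g * h) ({g. g ^ e dvd x} \<times> {h. h ^ e dvd y})"
    proof (rule inj_onI)
      fix z z' assume zz: "z \<in> {g. g ^ e dvd x} \<times> {h. h ^ e dvd y}"
        "z' \<in> {g. g ^ e dvd x} \<times> {h. h ^ e dvd y}"
        "(\<lambda>(g, h). g * h) z = (\<lambda>(g, h). g * h) z'"
      have "fst w dvd x" "snd w dvd y" if "w \<in> {g. g ^ e dvd x} \<times> {h. h ^ e dvd y}" for w
        using that base by auto
      with zz(1,2) have "fst z dvd x" "snd z dvd y" "fst z' dvd x" "snd z' dvd y" by blast+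
      moreover have "fst z * snd z = fst z' * snd z'" using zz(3) by (simp add: case_prod_unfold)
      ultimately show "z = z'" using gcds by (metis prod.expand)
    qed
    show "(\<lambda>(g, h). g * h) ` ({g. g ^ e dvd x} \<times> {h. h ^ e dvd y}) = {g. g ^ e dvd x * y}"
    proof (intro equalityI subsetI)
      fix g assume "g \<in> {g. g ^ e dvd x * y}"
      hence g: "g ^ e dvd x * y" by simp
      hence "g dvd x * y" by (rule base)
      then obtain b c where bc: "g = b * c" "b dvd x" "c dvd y" using division_decomp by blast
      have "b ^ e dvd x * y" "c ^ e dvd x * y"
        using g bc(1) by (auto simp: power_mult_distrib elim: dvd_mult_left dvd_mult_right)
      moreover have "coprime (b ^ e) y" "coprime (c ^ e) x"
        using xy(1) bc by (meson coprime_commute coprime_divisors coprime_power_left_iff dvd_refl)+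
      ultimately have "b ^ e dvd x" "c ^ e dvd y"
        by (simp_all add: coprime_dvd_mult_left_iff coprime_dvd_mult_right_iff)
      then show "g \<in> (\<lambda>(g, h). g * h) ` ({g. g ^ e dvd x} \<times> {h. h ^ e dvd y})"
        using bc(1) by force
    qed (auto simp: power_mult_distrib mult_dvd_mono)
  qed
  note bij = sum.reindex_bij_betw[OF this, of "\<lambda>g. H g (x * y)", symmetric]
  have "(\<Sum>g | g ^ e dvd x * y. H g (x * y))
     = (\<Sum>(g, h)\<in>{g. g ^ e dvd x} \<times> {h. h ^ e dvd y}. H (g * h) (x * y))"
    unfolding bij by (simp add: case_prod_unfold)
  also have "\<dots> = (\<Sum>(g, h)\<in>{g. g ^ e dvd x} \<times> {h. h ^ e dvd y}. H g x * H h y)"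
    by (intro sum.cong refl) (auto simp: H)
  finally show ?thesis by (simp add: sum_product sum.cartesian_product)
qed

section \<open>Roots of the norm form modulo integers\<close>

context imaginary_quadratic begin

text \<open>The trace \<open>T\<close> and the norm \<open>c0\<close> of the generator \<open>\<omega> = (T + \<surd>D) / 2\<close> of the ring of
  integers; the norm form is the norm of \<open>b + \<omega>\<close>.\<close>

definition T :: int where "T = D mod 2"
definition c0 :: int where "c0 = (T - D) div 4"
definition norm_form :: "int \<Rightarrow> int" where "norm_form b = b\<^sup>2 + T * b + c0"

lemma T_cases: "T = 0 \<or> T = 1" unfolding T_def by presburger

lemma discriminant_eq: "T\<^sup>2 - 4 * c0 = D"
proof -
  have "D mod 4 = 0 \<or> D mod 4 = 1" unfolding quadratic_discriminant_def by (simp split: if_split)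
  hence "(T - D) mod 4 = 0" unfolding T_def by presburger
  hence "4 * c0 = T - D" unfolding c0_def by presburger
  moreover have "T\<^sup>2 = T" using T_cases by auto
  ultimately show ?thesis by simp
qed

lemma four_norm_form: "4 * norm_form b = (2 * b + T)\<^sup>2 - D"
  unfolding norm_form_def discriminant_eq[symmetric] by (simp add: power2_eq_square algebra_simps)

lemma norm_form_diff: "norm_form c - norm_form b = (c - b) * (c + b + T)"
  by (simp add: norm_form_def power2_eq_square algebra_simps)

lemma norm_form_pos: "norm_form b > 0"
proof -
  have "4 * norm_form b > 0" unfolding four_norm_form using discriminant_less
    by (smt (verit) zero_le_power2)
  then show ?thesis by simp
qed

lemma norm_form_dvd_cong:
  assumes "[b = c] (mod a)" "a dvd norm_form b" shows "a dvd norm_form c"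
proof -
  have "a dvd c - b" using assms(1) by (metis cong_iff_dvd_diff cong_sym)
  hence "a dvd norm_form c - norm_form b" unfolding norm_form_diff by simp
  then show ?thesis using assms(2) by (metis diff_add_cancel dvd_add)
qed

definition roots :: "int \<Rightarrow> int set" where
  "roots a = {b \<in> {0..<a}. a dvd norm_form b}"

lemma finite_roots [simp]: "finite (roots a)"
  unfolding roots_def by (rule finite_subset[of _ "{0..<a}"]) auto

lemma mod_in_roots: "a > 0 \<Longrightarrow> a dvd norm_form b \<Longrightarrow> b mod a \<in> roots a"
  using norm_form_dvd_cong[of b "b mod a" a] by (simp add: roots_def)

lemma rootsD: "b \<in> roots a \<Longrightarrow> a dvd norm_form b" "b \<in> roots a \<Longrightarrow> b mod a = b"
  by (auto simp: roots_def)

lemma card_roots_mult: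
  assumes xy: "coprime x y" "x > 0" "y > 0"
  shows "card (roots (x * y)) = card (roots x) * card (roots y)"
proof -
  have "bij_betw (\<lambda>b. (b mod x, b mod y)) (roots (x * y)) (roots x \<times> roots y)"
  proof (rule bij_betw_imageI)
    show "inj_on (\<lambda>b. (b mod x, b mod y)) (roots (x * y))"
    proof (rule inj_onI)
      fix b c assume bc: "b \<in> roots (x * y)" "c \<in> roots (x * y)" "(b mod x, b mod y) = (c mod x, c mod y)"
      hence "[b = c] (mod x)" "[b = c] (mod y)" by (auto simp: Cong.cong_def)
      hence "[b = c] (mod x * y)" using xy(1) by (rule coprime_cong_mult)
      then show "b = c" using rootsD(2)[OF bc(1)] rootsD(2)[OF bc(2)] by (simp add: Cong.cong_def)
    qed
    show "(\<lambda>b. (b mod x, b mod y)) ` roots (x * y) = roots x \<times> roots y"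
    proof (intro equalityI subsetI)
      fix z assume "z \<in> (\<lambda>b. (b mod x, b mod y)) ` roots (x * y)"
      then obtain b where b: "z = (b mod x, b mod y)" "b \<in> roots (x * y)" by blast
      have "x dvd norm_form b" "y dvd norm_form b" using rootsD(1)[OF b(2)] by (auto elim: dvd_mult_left dvd_mult_right)
      then show "z \<in> roots x \<times> roots y" using b(1) mod_in_roots xy by simp
    next
      fix z assume "z \<in> roots x \<times> roots y"
      then obtain b c where z: "z = (b, c)" "b \<in> roots x" "c \<in> roots y" by auto
      obtain d where d: "[d = b] (mod x)" "[d = c] (mod y)"
        using binary_chinese_remainder_int[OF xy(1)] by blast
      have "x dvd norm_form d" "y dvd norm_form d"
        using norm_form_dvd_cong d rootsD(1)[OF z(2)] rootsD(1)[OF z(3)] cong_sym by blast+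
      hence "x * y dvd norm_form d" using xy(1) by (rule divides_mult)
      hence "d mod (x * y) \<in> roots (x * y)" using xy by (intro mod_in_roots) auto
      moreover have "z = (d mod (x * y) mod x, d mod (x * y) mod y)"
        using d rootsD(2)[OF z(2)] rootsD(2)[OF z(3)] z(1) by (simp add: Cong.cong_def mod_mod_cancel)
      ultimately show "z \<in> (\<lambda>b. (b mod x, b mod y)) ` roots (x * y)" by blast
    qed
  qed
  from bij_betw_same_card[OF this] show ?thesis by (simp add: card_cartesian_product)
qed

text \<open>The derivative \<open>2 b + T\<close> of the norm form has the square \<open>D + 4 N(b + \<omega>)\<close>.\<close>

lemma root_derivative_unit:
  assumes p: "prime p" "\<not> p dvd D" and b: "p dvd norm_form b"
  shows "\<not> p dvd 2 * b + T"
proof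
  assume "p dvd 2 * b + T"
  hence "p dvd (2 * b + T)\<^sup>2 - 4 * norm_form b" using b by (simp add: power2_eq_square)
  then show False using p(2) by (simp add: four_norm_form)
qed

text \<open>Two roots that agree modulo \<open>p\<^sup>k\<close> agree modulo \<open>p\<^sup>k\<^sup>+\<^sup>1\<close>, because the difference of the values of
  the norm form is \<open>c - b\<close> times a unit; and a root is lifted by a Newton step.\<close>

lemma card_roots_Hensel:
  assumes p: "prime p" "\<not> p dvd D" and k: "k > 0"
  shows "card (roots (p ^ Suc k)) = card (roots (p ^ k))"
proof -
  have p0: "p > 0" using p by (rule_tac prime_gt_0_int)
  have pk: "p dvd p ^ k" using k by (simp add: dvd_power)
  have "bij_betw (\<lambda>b. b mod p ^ k) (roots (p ^ Suc k)) (roots (p ^ k))"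
  proof (rule bij_betw_imageI)
    show "inj_on (\<lambda>b. b mod p ^ k) (roots (p ^ Suc k))"
    proof (rule inj_onI)
      fix b c assume bc: "b \<in> roots (p ^ Suc k)" "c \<in> roots (p ^ Suc k)" "b mod p ^ k = c mod p ^ k"
      have "p ^ k dvd c - b" using bc(3) by (metis mod_eq_dvd_iff)
      hence pcb: "p dvd c - b" using pk by (rule dvd_trans[rotated])
      have "p dvd norm_form b" using rootsD(1)[OF bc(1)] by (auto elim: dvd_mult_left)
      hence "\<not> p dvd 2 * b + T" by (rule root_derivative_unit[OF p])
      moreover have "c + b + T = (c - b) + (2 * b + T)" by simp
      ultimately have "\<not> p dvd c + b + T" using pcb by (metis dvd_add_right_iff)
      hence "coprime (p ^ Suc k) (c + b + T)" using p(1) by (simp add: prime_imp_coprime)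
      moreover have "p ^ Suc k dvd (c - b) * (c + b + T)"
        unfolding norm_form_diff[symmetric] using bc rootsD(1) by (intro dvd_diff) blast+
      ultimately have "p ^ Suc k dvd c - b" using coprime_dvd_mult_left_iff by blast
      hence "c mod p ^ Suc k = b mod p ^ Suc k" by (simp only: mod_eq_dvd_iff)
      then show "b = c" using rootsD(2)[OF bc(1)] rootsD(2)[OF bc(2)] by simp
    qed
    show "(\<lambda>b. b mod p ^ k) ` roots (p ^ Suc k) = roots (p ^ k)"
    proof (intro equalityI subsetI)
      fix z assume "z \<in> (\<lambda>b. b mod p ^ k) ` roots (p ^ Suc k)"
      then obtain b where b: "z = b mod p ^ k" "b \<in> roots (p ^ Suc k)" by blast
      have "p ^ k dvd norm_form b" using rootsD(1)[OF b(2)] by (auto elim: dvd_mult_right)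
      then show "z \<in> roots (p ^ k)" using b(1) mod_in_roots p0 by simp
    next
      fix b assume b: "b \<in> roots (p ^ k)"
      then obtain s where s: "norm_form b = p ^ k * s" using rootsD(1) by blast
      have "\<not> p dvd 2 * b + T"
        using root_derivative_unit[OF p] rootsD(1)[OF b] pk dvd_trans by blast
      hence "coprime (2 * b + T) p" using p(1) by (simp add: prime_imp_coprime coprime_commute)
      then obtain i where i: "[(2 * b + T) * i = 1] (mod p)" using cong_solve_coprime_int by blast
      define t where "t = - s * i"
      have "[s * ((2 * b + T) * i) = s * 1] (mod p)" by (rule cong_scalar_left[OF i])
      hence ps: "p dvd s + (2 * b + T) * t"
        by (simp add: t_def cong_iff_dvd_diff) (metis (no_types, opaque_lifting) add.commute
            dvd_minus_iff minus_diff_eq mult.left_commute uminus_add_conv_diff)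
      have "norm_form (b + p ^ k * t) = p ^ k * (s + (2 * b + T) * t + p ^ k * t\<^sup>2)"
        using norm_form_diff[of "b + p ^ k * t" b] s
        by (simp add: power2_eq_square algebra_simps)
      moreover have "p dvd s + (2 * b + T) * t + p ^ k * t\<^sup>2"
        by (rule dvd_add[OF ps dvd_mult2[OF pk]])
      ultimately have "p ^ Suc k dvd norm_form (b + p ^ k * t)"
        by (simp add: mult.commute[of p] mult_dvd_mono)
      hence "(b + p ^ k * t) mod p ^ Suc k \<in> roots (p ^ Suc k)" using p0 by (intro mod_in_roots) auto
      moreover have "(b + p ^ k * t) mod p ^ Suc k mod p ^ k = b"
      proof -
        have "(b + p ^ k * t) mod p ^ Suc k mod p ^ k = (b + p ^ k * t) mod p ^ k"
          by (rule mod_mod_cancel) simp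
        then show ?thesis using rootsD(2)[OF b] by simp
      qed
      ultimately show "b \<in> (\<lambda>b. b mod p ^ k) ` roots (p ^ Suc k)" by (metis image_eqI)
    qed
  qed
  then show ?thesis by (rule bij_betw_same_card)
qed

text \<open>Completing the square: the roots correspond to the square roots of \<open>D\<close>. If \<open>b\<close> is a root,
  the other one is \<open>- T - b\<close>.\<close>

lemma card_roots_odd_prime:
  assumes p: "prime p" "p > 2" "\<not> p dvd D"
  shows "int (card (roots p)) = 1 + Legendre D p"
proof (cases "QuadRes p D")
  case False
  have "roots p = {}"
  proof (rule ccontr)
    assume "roots p \<noteq> {}"
    then obtain b where "p dvd norm_form b" using rootsD(1) by blast
    hence "p dvd 4 * norm_form b" by simp
    hence "[(2 * b + T)\<^sup>2 = D] (mod p)" by (simp only: four_norm_form cong_iff_dvd_diff)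
    then show False using False unfolding QuadRes_def by blast
  qed
  then show ?thesis using False p by (simp add: Legendre_def cong_0_iff)
next
  case True
  have p2: "coprime 2 p" "coprime p 4"
  proof -
    have "odd p" using p prime_odd_int by blast
    then show "coprime 2 p" by simp
    then have "coprime p (2 * 2)" by (simp only: coprime_mult_right_iff coprime_commute simp_thms)
    then show "coprime p 4" by simp
  qed
  obtain y where y: "[y\<^sup>2 = D] (mod p)" using True unfolding QuadRes_def by blast
  obtain i where i: "[2 * i = 1] (mod p)" using cong_solve_coprime_int[OF p2(1)] by blast
  define b where "b = i * (y - T)"
  have "[2 * i * (y - T) = 1 * (y - T)] (mod p)" by (rule cong_scalar_right[OF i])
  hence "[2 * b + T = y - T + T] (mod p)" unfolding b_def by (intro cong_add) (simp_all add: mult.assoc)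
  hence "[(2 * b + T)\<^sup>2 = y\<^sup>2] (mod p)" by (intro cong_pow) simp
  hence "[(2 * b + T)\<^sup>2 = D] (mod p)" using y cong_trans by blast
  hence "p dvd 4 * norm_form b" by (simp only: four_norm_form cong_iff_dvd_diff)
  hence b: "p dvd norm_form b" using p2(2) coprime_dvd_mult_right_iff by blast
  define c where "c = - T - b"
  have c: "p dvd norm_form c" using b norm_form_diff[of c b] by (simp add: c_def)
  have "\<not> p dvd b - c" using root_derivative_unit[OF p(1,3) b] by (simp add: c_def algebra_simps)
  hence ne: "b mod p \<noteq> c mod p" by (simp add: mod_eq_dvd_iff)
  have "roots p = {b mod p, c mod p}"
  proof (intro equalityI subsetI)
    fix d assume d: "d \<in> roots p"
    have "p dvd norm_form d - norm_form b" using rootsD(1)[OF d] b by (rule dvd_diff)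
    hence "p dvd (d - b) * (d - c)" unfolding norm_form_diff by (simp add: c_def algebra_simps)
    hence "p dvd d - b \<or> p dvd d - c" using p(1) prime_dvd_mult_iff by blast
    hence "d mod p = b mod p \<or> d mod p = c mod p" by (simp only: mod_eq_dvd_iff)
    then show "d \<in> {b mod p, c mod p}" using rootsD(2)[OF d] by auto
  qed (use mod_in_roots b c p in auto)
  then show ?thesis using ne True p by (simp add: Legendre_def cong_0_iff)
qed

lemma card_roots_two:
  assumes "odd D" shows "int (card (roots 2)) = 1 + chi 2"
proof -
  have T1: "T = 1" using assms unfolding T_def by presburger
  have D: "D = 1 - 4 * c0" using discriminant_eq T1 by simp
  have e: "even (norm_form b) \<longleftrightarrow> even c0" for b
    by (simp add: norm_form_def T1 power2_eq_square)
  have "{0..<2::int} = {0, 1}" by auto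
  hence "roots 2 = (if even c0 then {0, 1} else {})"
    unfolding roots_def using e by auto
  moreover have "even c0 \<longleftrightarrow> D mod 8 = 1" unfolding D by presburger
  ultimately show ?thesis using chi_two[OF assms] by simp
qed

lemma card_roots_ramified:
  assumes p: "prime p" "p dvd D"
  shows "card (roots p) = 1"
proof -
  have p0: "p > 0" using p by (rule_tac prime_gt_0_int)
  have "\<exists>b. p dvd norm_form b \<and> (\<forall>c. p dvd norm_form c \<longrightarrow> p dvd c - b)"
  proof (cases "p = 2")
    case True
    hence T: "T = 0" using p(2) unfolding T_def by presburger
    have "even (norm_form c) \<longleftrightarrow> even (c - c0)" for c
      by (simp add: norm_form_def T power2_eq_square)
    then show ?thesis using True by (intro exI[of _ c0]) auto
  next
    case False
    hence "odd p" using p prime_odd_int prime_ge_2_int[of p] by (metis order_le_less)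
    hence p2: "coprime 2 p" "coprime p 2" by (simp_all add: coprime_commute)
    hence p4: "coprime p (2 * 2)" by (simp only: coprime_mult_right_iff simp_thms)
    obtain i where i: "[2 * i = 1] (mod p)" using cong_solve_coprime_int[OF p2(1)] by blast
    have iff: "p dvd norm_form c \<longleftrightarrow> p dvd 2 * c + T" for c
    proof -
      have "p dvd norm_form c \<longleftrightarrow> p dvd 4 * norm_form c"
        using p4 coprime_dvd_mult_right_iff[of p 4 "norm_form c"] by simp
      also have "\<dots> \<longleftrightarrow> p dvd (2 * c + T)\<^sup>2"
        unfolding four_norm_form using p(2) by (metis diff_add_cancel dvd_add dvd_diff)
      also have "\<dots> \<longleftrightarrow> p dvd 2 * c + T" using p(1) by (simp add: prime_dvd_power_iff)
      finally show ?thesis .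
    qed
    have "[2 * i * - T = 1 * - T] (mod p)" by (rule cong_scalar_right[OF i])
    hence b: "p dvd 2 * (i * - T) + T" by (simp add: cong_iff_dvd_diff mult.assoc)
    have "p dvd c - i * - T" if "p dvd 2 * c + T" for c
    proof -
      have "p dvd (2 * c + T) - (2 * (i * - T) + T)" using that b by (rule dvd_diff)
      hence "p dvd 2 * (c - i * - T)" by (simp add: algebra_simps)
      then show ?thesis using p2(2) coprime_dvd_mult_right_iff by blast
    qed
    with b iff show ?thesis by blast
  qed
  then obtain b where b: "p dvd norm_form b" "\<And>c. p dvd norm_form c \<Longrightarrow> p dvd c - b" by blast
  have "roots p = {b mod p}"
  proof (intro equalityI subsetI)
    fix c assume c: "c \<in> roots p"
    hence "p dvd c - b" using b rootsD(1) by blast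
    hence "c mod p = b mod p" by (simp only: mod_eq_dvd_iff)
    then show "c \<in> {b mod p}" using rootsD(2)[OF c] by simp
  qed (use mod_in_roots b p0 in auto)
  then show ?thesis by simp
qed

text \<open>For odd \<open>p\<close> a root modulo \<open>p\<^sup>2\<close> would make \<open>D\<close> divisible by \<open>p\<^sup>2\<close>; for \<open>p = 2\<close> it would make
  \<open>m\<close> a square modulo \<open>4\<close>. Both are excluded by the choice of a fundamental discriminant.\<close>

lemma roots_ramified_power:
  assumes p: "prime p" "p dvd D" and k: "k \<ge> 2"
  shows "roots (p ^ k) = {}"
proof (rule ccontr)
  assume "roots (p ^ k) \<noteq> {}"
  then obtain b where "p ^ k dvd norm_form b" using rootsD(1) by blast
  hence b: "p\<^sup>2 dvd norm_form b" using k by (meson dvd_trans le_imp_power_dvd)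
  show False
  proof (cases "p = 2")
    case True
    hence "even D" using p by simp
    hence "m mod 4 \<noteq> 1" unfolding quadratic_discriminant_def by (simp split: if_splits) presburger
    hence m: "D = 4 * m" "m mod 4 \<noteq> 1" by (simp_all add: quadratic_discriminant_def)
    have T0: "T = 0" unfolding T_def m(1) by simp
    have "c0 = - m" using discriminant_eq m T0 by simp
    hence "4 dvd b\<^sup>2 - m" using b True by (simp add: norm_form_def T0)
    hence "m mod 4 = b\<^sup>2 mod 4" by (metis mod_eq_dvd_iff)
    moreover have "b\<^sup>2 mod 4 = 0 \<or> b\<^sup>2 mod 4 = 1"
    proof (cases "even b")
      case True then show ?thesis by (auto elim!: evenE simp: power2_eq_square)
    next
      case False
      then obtain j where "b = 2 * j + 1" by (auto elim: oddE)
      hence "b\<^sup>2 = 1 + (j\<^sup>2 + j) * 4" by (simp add: power2_eq_square algebra_simps)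
      then show ?thesis by (simp only: mod_mult_self1) simp
    qed
    ultimately show False using m_mod_4 m by auto
  next
    case False
    hence "odd p" using p prime_odd_int prime_ge_2_int[of p] by (metis order_le_less)
    hence "coprime p (2 * 2)" by (simp only: coprime_mult_right_iff coprime_right_2_iff_odd simp_thms)
    hence c4: "coprime (p\<^sup>2) 4" by simp
    have "p dvd norm_form b" using b by (simp add: power2_eq_square dvd_mult_left)
    hence "p dvd 4 * norm_form b + D" using p(2) by (intro dvd_add dvd_mult)
    hence "p dvd (2 * b + T)\<^sup>2" by (simp add: four_norm_form)
    hence "p dvd 2 * b + T" using p(1) prime_dvd_power by blast
    hence "p\<^sup>2 dvd (2 * b + T)\<^sup>2" by simp
    hence "p\<^sup>2 dvd (2 * b + T)\<^sup>2 - 4 * norm_form b" using b by simp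
    hence "p\<^sup>2 dvd D" by (simp add: four_norm_form)
    hence "p\<^sup>2 dvd m" using c4 coprime_dvd_mult_right_iff[of "p\<^sup>2" 4 m]
      by (simp add: quadratic_discriminant_def split: if_splits)
    hence "is_unit p" using m_squarefree squarefreeD by blast
    then show False using p not_prime_unit by blast
  qed
qed

definition rho :: "nat \<Rightarrow> int" where "rho a = int (card (roots (int a)))"

lemma rho_mult: "x > 0 \<Longrightarrow> y > 0 \<Longrightarrow> coprime x y \<Longrightarrow> rho (x * y) = rho x * rho y"
  using card_roots_mult[of "int x" "int y"] by (simp add: rho_def coprime_int_iff)

lemma rho_1: "rho 1 = 1"
proof -
  have "roots 1 = {0}" by (auto simp: roots_def)
  then show ?thesis by (simp add: rho_def)
qed

text \<open>Unramified primes have \<open>1 + \<chi>(p)\<close> roots at each level; ramified ones have a single root,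
  which does not lift. With \<open>\<chi>(p) \<in> {0, 1, -1}\<close> the formula covers all cases.\<close>

lemma rho_prime_power:
  assumes p: "prime p"
  shows "rho (p ^ Suc k) = chi (int p) ^ k + chi (int p) ^ Suc k"
proof -
  have ip: "prime (int p)" using p by simp
  show ?thesis
  proof (cases "int p dvd D")
    case True
    hence "\<not> coprime (int p) N" using ip by (meson coprime_common_divisor dvd_abs_iff dvd_refl not_prime_unit)
    hence c: "chi (int p) = 0" by (rule chi_zero)
    show ?thesis
    proof (cases k)
      case 0
      then show ?thesis using card_roots_ramified[OF ip True] c by (simp add: rho_def)
    next
      case (Suc l)
      then have "Suc k \<ge> 2" by simp
      from roots_ramified_power[OF ip True this] show ?thesis using c Suc by (simp add: rho_def)
    qed
  next
    case False
    have "int (card (roots (int p ^ Suc k))) = 1 + chi (int p)"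
    proof (induction k)
      case 0
      show ?case
      proof (cases "p = 2")
        case True
        then show ?thesis using card_roots_two False by simp
      next
        case False
        hence "int p > 2" using p prime_ge_2_nat[of p] by linarith
        then show ?thesis using card_roots_odd_prime[OF ip] chi_odd_prime[OF ip] \<open>\<not> int p dvd D\<close> by simp
      qed
    next
      case (Suc k)
      then show ?case using card_roots_Hensel[OF ip False, of "Suc k"] by simp
    qed
    moreover have "coprime (int p) N" using ip False by (simp add: prime_imp_coprime)
    hence "chi (int p) = 1 \<or> chi (int p) = -1" using chi_values by blast
    ultimately show ?thesis by (auto simp: rho_def)
  qed
qed

text \<open>The number of ideals of norm \<open>n\<close> is the sum on the left, so this is the factorisation of the
  Dedekind zeta function, coefficient by coefficient. Both sides are multiplicative. At \<open>p\<^sup>k\<close>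
  the sum on the left telescopes in steps of two, \<open>\<rho>(p\<^sup>k) = \<chi>(p)\<^sup>k\<^sup>-\<^sup>1 + \<chi>(p)\<^sup>k\<close>, to the geometric sum
  on the right.\<close>

theorem sum_rho_eq_sum_chi:
  assumes n: "n > 0"
  shows "(\<Sum>g | g\<^sup>2 dvd n. rho (n div g\<^sup>2)) = (\<Sum>d | d dvd n. chi (int d))"
proof (rule multiplicative_eqI[OF _ _ _ n])
  fix x y :: nat assume xy: "x > 0" "y > 0" "coprime x y"
  show "(\<Sum>g | g\<^sup>2 dvd x * y. rho (x * y div g\<^sup>2))
     = (\<Sum>g | g\<^sup>2 dvd x. rho (x div g\<^sup>2)) * (\<Sum>g | g\<^sup>2 dvd y. rho (y div g\<^sup>2))"
  proof (rule sum_power_divisors_multiplicative[where H = "\<lambda>g n. rho (n div g\<^sup>2)", OF xy(3,1,2)])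
    fix g h assume gh: "g\<^sup>2 dvd x" "h\<^sup>2 dvd y"
    hence "x * y div (g * h)\<^sup>2 = (x div g\<^sup>2) * (y div h\<^sup>2)"
      by (simp add: power_mult_distrib div_mult_div_if_dvd)
    moreover have "coprime (x div g\<^sup>2) (y div h\<^sup>2)"
      using coprime_divisors[OF _ _ xy(3)] gh by (metis dvd_div_mult_self dvd_triv_left)
    moreover have "x div g\<^sup>2 > 0" "y div h\<^sup>2 > 0"
      using gh xy by (metis dvd_div_eq_0_iff gr0I less_irrefl)+
    ultimately show "rho (x * y div (g * h)\<^sup>2) = rho (x div g\<^sup>2) * rho (y div h\<^sup>2)"
      by (simp add: rho_mult)
  qed simp
  show "(\<Sum>d | d dvd x * y. chi (int d)) = (\<Sum>d | d dvd x. chi (int d)) * (\<Sum>d | d dvd y. chi (int d))"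
    using sum_power_divisors_multiplicative[where H = "\<lambda>d n. chi (int d)" and e = 1, OF xy(3,1,2)]
    by (simp add: chi_mult)
next
  fix p k :: nat assume p: "prime p"
  let ?c = "chi (int p)"
  have p1: "p > 1" using p by (rule prime_gt_1_nat)
  have "{d. d dvd p ^ k} = (\<lambda>i. p ^ i) ` {..k}"
    using divides_primepow_nat[OF p] by auto
  hence "(\<Sum>d | d dvd p ^ k. chi (int d)) = (\<Sum>i\<le>k. chi (int (p ^ i)))"
    using p1 by (simp add: sum.reindex inj_on_def)
  moreover have "chi (int (p ^ i)) = ?c ^ i" for i
  proof (induction i)
    case 0
    show ?case using chi_mult[of 1 1] chi_values[of 1] by auto
  qed (simp add: chi_mult)
  ultimately have R: "(\<Sum>d | d dvd p ^ k. chi (int d)) = (\<Sum>i\<le>k. ?c ^ i)" by simp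
  have "{g. g\<^sup>2 dvd p ^ k} = (\<lambda>j. p ^ j) ` {j. 2 * j \<le> k}"
  proof (intro equalityI subsetI)
    fix g assume "g \<in> {g. g\<^sup>2 dvd p ^ k}"
    hence g: "g\<^sup>2 dvd p ^ k" by simp
    hence "g dvd p ^ k" by (metis dvd_power dvd_trans pos2)
    then obtain j where j: "g = p ^ j" using divides_primepow_nat[OF p] by blast
    hence "p ^ (2 * j) dvd p ^ k" using g by (simp add: power_mult[symmetric] mult.commute)
    hence "2 * j \<le> k" using p1 by (metis power_dvd_imp_le)
    then show "g \<in> (\<lambda>j. p ^ j) ` {j. 2 * j \<le> k}" using j by blast
  qed (auto simp: power_mult[symmetric] mult.commute intro: le_imp_power_dvd)
  hence "(\<Sum>g | g\<^sup>2 dvd p ^ k. rho (p ^ k div g\<^sup>2)) = (\<Sum>j | 2 * j \<le> k. rho (p ^ k div (p ^ j)\<^sup>2))"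
    using p1 by (simp add: sum.reindex inj_on_def)
  also have "\<dots> = (\<Sum>j | 2 * j \<le> k. rho (p ^ (k - 2 * j)))"
    using p1 by (intro sum.cong refl) (auto simp: power_mult[symmetric] mult.commute power_diff)
  also have "\<dots> = (\<Sum>i\<le>k. ?c ^ i)"
  proof (induction k rule: induct_nat_012)
    case 0
    have "{j::nat. j = 0} = {0}" by auto
    then show ?case using rho_1 by simp
  next
    case 1
    have "{j::nat. 2 * j \<le> Suc 0} = {0}" by auto
    then show ?case using rho_prime_power[OF p, of 0] by simp
  next
    case (ge2 k)
    have S: "{j. 2 * j \<le> Suc (Suc k)} = insert 0 (Suc ` {j. 2 * j \<le> k})"
    proof -
      have "j \<in> {j. 2 * j \<le> Suc (Suc k)} \<longleftrightarrow> j \<in> insert 0 (Suc ` {j. 2 * j \<le> k})"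
        for j by (cases j) auto
      then show ?thesis by blast
    qed
    have f: "finite {j. 2 * j \<le> k}" by (rule finite_subset[of _ "{..k}"]) auto
    have "(\<Sum>j | 2 * j \<le> Suc (Suc k). rho (p ^ (Suc (Suc k) - 2 * j)))
       = rho (p ^ Suc (Suc k)) + (\<Sum>j | 2 * j \<le> k. rho (p ^ (k - 2 * j)))"
      unfolding S using f by (subst sum.insert) (auto simp: sum.reindex inj_on_def)
    then show ?case using ge2(1) rho_prime_power[OF p, of "Suc k"] by simp
  qed
  finally show "(\<Sum>g | g\<^sup>2 dvd p ^ k. rho (p ^ k div g\<^sup>2)) = (\<Sum>d | d dvd p ^ k. chi (int d))"
    using R by simp
qed

end

section \<open>The ring of integers\<close>

definition lat :: "complex \<Rightarrow> complex \<Rightarrow> complex set" where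
  "lat u v = range (lattice_point u v)"

lemma lat_I: "of_int x * u + of_int y * v \<in> lat u v"
proof -
  have "lattice_point u v (x, y) = of_int x * u + of_int y * v" by (simp add: lattice_point_def)
  then show ?thesis unfolding lat_def by (metis rangeI)
qed

lemma lat_E:
  assumes "z \<in> lat u v" obtains x y where "z = of_int x * u + of_int y * v"
  using assms by (auto simp: lattice_point_def lat_def)

lemma rat_bounded_denominators:
  fixes q :: real and M :: int
  assumes q: "q \<in> \<rat>" and M: "M > 0" and I: "\<And>n. of_int M * q ^ n \<in> \<int>"
  shows "q \<in> \<int>"
proof -
  obtain u v :: int where uv: "v > 0" "coprime u v" "q = of_int u / of_int v"
    using q by (rule Rats_cases') auto
  have "v ^ n dvd M" for n
  proof -
    obtain t where "of_int M * q ^ n = of_int t" using I[of n] by (auto elim: Ints_cases)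
    hence "of_int M * of_int u ^ n = (of_int t * of_int v ^ n :: real)"
      using uv by (simp add: power_divide field_simps)
    hence "M * u ^ n = t * v ^ n" by (metis of_int_eq_iff of_int_mult of_int_power)
    hence "v ^ n dvd M * u ^ n" by simp
    moreover have "coprime (v ^ n) (u ^ n)" using uv(2) by (simp add: coprime_commute)
    ultimately show ?thesis using coprime_dvd_mult_left_iff by blast
  qed
  hence le: "v ^ n \<le> M" for n using M zdvd_imp_le by blast
  have "v = 1"
  proof (rule ccontr)
    assume "v \<noteq> 1"
    hence "v \<ge> 2" using uv by linarith
    hence "2 ^ nat M \<le> v ^ nat M" by (intro power_mono) auto
    moreover have "int (nat M) < 2 ^ nat M" by (metis of_nat_less_two_power)
    ultimately show False using le[of "nat M"] M by simp
  qed
  then show ?thesis using uv by simp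
qed

lemma algebraic_int_quadratic:
  fixes z :: complex
  assumes "z\<^sup>2 - of_int t * z + of_int n = 0"
  shows "algebraic_int z"
proof (rule algebraic_int.intros)
  show "lead_coeff [:of_int n, - of_int t, 1:] = (1::complex)" by simp
  show "\<forall>i. coeff [:of_int n, - of_int t, 1 :: complex:] i \<in> \<int>"
    by (auto simp: coeff_pCons split: nat.split)
  show "poly [:of_int n, - of_int t, 1:] z = 0" using assms by (simp add: power2_eq_square algebra_simps)
qed

lemma algebraic_int_add_one:
  fixes z :: complex
  assumes "algebraic_int z" shows "algebraic_int (z + 1)"
proof (rule algebraic_int_root[OF assms])
  show "poly [:-1, 1:] (z + 1) = z" by simp
  show "\<forall>i. coeff [:-1, 1 :: complex:] i \<in> \<int>" by (auto simp: coeff_pCons split: nat.split)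
qed simp_all

lemma of_real_of_rat: "of_real (of_rat r) = (of_rat r :: complex)"
  by (cases r) (simp add: of_rat_rat)

context imaginary_quadratic begin

definition sqrt_m :: complex where "sqrt_m = csqrt (of_int m)"
definition omega :: complex where "omega = (of_int T + csqrt (of_int D)) / 2"
abbreviation "K \<equiv> quadratic_field m"
abbreviation "OK \<equiv> lat 1 omega"

lemma csqrt_D: "csqrt (of_int D) = (if m mod 4 = 1 then sqrt_m else 2 * sqrt_m)"
proof -
  have "sqrt \<bar>of_int (4 * m)\<bar> = 2 * sqrt \<bar>of_int m\<bar>"
    by (simp add: abs_mult real_sqrt_mult)
  hence "csqrt (of_int (4 * m)) = 2 * sqrt_m"
    using csqrt_of_real_nonpos[of "of_int m"] csqrt_of_real_nonpos[of "of_int (4 * m)"] m_neg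
    by (simp add: sqrt_m_def)
  then show ?thesis by (simp add: quadratic_discriminant_def sqrt_m_def)
qed

lemma Re_sqrt_m: "Re sqrt_m = 0" and Im_sqrt_m: "Im sqrt_m > 0"
proof -
  have "sqrt_m = \<i> * of_real (sqrt \<bar>of_int m\<bar>)"
    using csqrt_of_real_nonpos[of "of_int m"] m_neg by (simp add: sqrt_m_def)
  then show "Re sqrt_m = 0" "Im sqrt_m > 0" using m_neg by simp_all
qed

lemma omega_square: "omega\<^sup>2 = of_int T * omega - of_int c0"
proof -
  have "of_int (T\<^sup>2 - 4 * c0) = (csqrt (of_int D))\<^sup>2" unfolding discriminant_eq by simp
  moreover have "csqrt (of_int D) = 2 * omega - of_int T" by (simp add: omega_def)
  ultimately have "of_int T ^ 2 - 4 * of_int c0 = (2 * omega - of_int T)\<^sup>2" by simp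
  hence "4 * omega\<^sup>2 = 4 * (of_int T * omega - of_int c0)" by (simp add: power2_eq_square algebra_simps)
  then show ?thesis by (simp only: mult_cancel_left) simp
qed

lemma Re_omega: "Re omega = of_int T / 2" and Im_omega: "Im omega > 0"
proof -
  have "Re (csqrt (of_int D)) = 0" "Im (csqrt (of_int D)) > 0"
    unfolding csqrt_D using Re_sqrt_m Im_sqrt_m by auto
  then show "Re omega = of_int T / 2" "Im omega > 0" by (simp_all add: omega_def)
qed

lemma cnj_omega: "cnj omega = of_int T - omega"
  by (rule complex_eqI) (simp_all add: Re_omega)

lemma omega_nonreal: "of_real a + of_real b * omega = of_real c + of_real d * omega \<longleftrightarrow> a = c \<and> b = d"
  using Im_omega by (auto simp: complex_eq_iff)

lemma K_eq: "K = {of_rat a + of_rat b * omega | a b. True}"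
proof -
  have 1: "\<exists>a' b'. of_rat a + of_rat b * sqrt_m = of_rat a' + of_rat b' * omega" for a b
  proof (cases "m mod 4 = 1")
    case True
    then have s: "sqrt_m = 2 * omega - of_int T" by (simp add: omega_def csqrt_D)
    have "of_rat a + of_rat b * sqrt_m = of_rat (a - b * of_int T) + of_rat (2 * b) * omega"
      unfolding s by (simp add: of_rat_diff of_rat_mult algebra_simps)
    then show ?thesis by blast
  next
    case False
    then have s: "sqrt_m = omega - of_int T / 2" by (simp add: omega_def csqrt_D)
    have "of_rat a + of_rat b * sqrt_m = of_rat (a - b * of_int T / 2) + of_rat b * omega"
      unfolding s by (simp add: of_rat_diff of_rat_mult of_rat_divide algebra_simps)
    then show ?thesis by blast
  qed
  have 2: "\<exists>a' b'. of_rat a + of_rat b * omega = of_rat a' + of_rat b' * sqrt_m" for a b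
  proof (cases "m mod 4 = 1")
    case True
    hence "of_rat a + of_rat b * omega = of_rat (a + b * of_int T / 2) + of_rat (b / 2) * sqrt_m"
      by (simp add: omega_def csqrt_D of_rat_add of_rat_mult of_rat_divide algebra_simps add_divide_distrib)
    then show ?thesis by blast
  next
    case False
    hence "of_rat a + of_rat b * omega = of_rat (a + b * of_int T / 2) + of_rat b * sqrt_m"
      by (simp add: omega_def csqrt_D of_rat_add of_rat_mult of_rat_divide algebra_simps add_divide_distrib)
    then show ?thesis by blast
  qed
  show ?thesis unfolding quadratic_field_def sqrt_m_def[symmetric] using 1 2 by blast
qed

lemma OK_I: "of_int x + of_int y * omega \<in> OK"
  using lat_I[of x 1 y omega] by simp

lemma OK_E:
  assumes "z \<in> OK" obtains x y where "z = of_int x + of_int y * omega"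
  using lat_E[OF assms] by auto

lemma OK_of_int: "of_int x \<in> OK" using OK_I[of x 0] by simp

lemma OK_omega: "omega \<in> OK" using OK_I[of 0 1] by simp

lemma OK_add: "a \<in> OK \<Longrightarrow> b \<in> OK \<Longrightarrow> a + b \<in> OK"
proof (elim OK_E)
  fix x y x' y' assume "a = of_int x + of_int y * omega" "b = of_int x' + of_int y' * omega"
  then have "a + b = of_int (x + x') + of_int (y + y') * omega" by (simp add: algebra_simps)
  then show ?thesis by (simp only: OK_I)
qed

lemma OK_mult: "a \<in> OK \<Longrightarrow> b \<in> OK \<Longrightarrow> a * b \<in> OK"
proof (elim OK_E)
  fix x y x' y' assume ab: "a = of_int x + of_int y * omega" "b = of_int x' + of_int y' * omega"
  have "a * b = of_int x * of_int x' + (of_int x * of_int y' + of_int y * of_int x') * omega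
      + of_int y * of_int y' * omega\<^sup>2"
    unfolding ab by (simp add: power2_eq_square algebra_simps)
  also have "\<dots> = of_int (x * x' - y * y' * c0) + of_int (x * y' + y * x' + y * y' * T) * omega"
    unfolding omega_square by (simp add: algebra_simps)
  finally show ?thesis by (simp only: OK_I)
qed

lemma OK_minus: "a \<in> OK \<Longrightarrow> - a \<in> OK"
  using OK_mult[OF OK_of_int[of "-1"], of a] by simp

lemma OK_subset_K: "OK \<subseteq> K"
proof
  fix z assume "z \<in> OK"
  then obtain x y where "z = of_int x + of_int y * omega" by (rule OK_E)
  then have "z = of_rat (of_int x) + of_rat (of_int y) * omega" by simp
  then show "z \<in> K" unfolding K_eq by blast
qed

lemma K_add: "a \<in> K \<Longrightarrow> b \<in> K \<Longrightarrow> a + b \<in> K"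
proof -
  assume "a \<in> K" "b \<in> K"
  then obtain x y x' y' where "a = of_rat x + of_rat y * omega" "b = of_rat x' + of_rat y' * omega"
    unfolding K_eq by blast
  then have "a + b = of_rat (x + x') + of_rat (y + y') * omega" by (simp add: of_rat_add algebra_simps)
  then show ?thesis unfolding K_eq by blast
qed

lemma K_mult: "a \<in> K \<Longrightarrow> b \<in> K \<Longrightarrow> a * b \<in> K"
proof -
  assume "a \<in> K" "b \<in> K"
  then obtain x y x' y' where ab: "a = of_rat x + of_rat y * omega" "b = of_rat x' + of_rat y' * omega"
    unfolding K_eq by blast
  have "a * b = of_rat x * of_rat x' + (of_rat x * of_rat y' + of_rat y * of_rat x') * omega
      + of_rat y * of_rat y' * omega\<^sup>2"
    unfolding ab by (simp add: power2_eq_square algebra_simps)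
  also have "\<dots> = of_rat (x * x' - y * y' * of_int c0) + of_rat (x * y' + y * x' + y * y' * of_int T) * omega"
    unfolding omega_square by (simp add: of_rat_add of_rat_diff of_rat_mult algebra_simps)
  finally show ?thesis unfolding K_eq by blast
qed

lemma norm_quadratic: "(norm (of_real x + of_real y * omega))\<^sup>2 = x\<^sup>2 + of_int T * x * y + of_int c0 * y\<^sup>2"
proof -
  have "(norm omega)\<^sup>2 = of_int c0"
  proof -
    have "of_real ((norm omega)\<^sup>2) = omega * cnj omega" by (rule complex_norm_square)
    also have "\<dots> = of_int T * omega - omega\<^sup>2" unfolding cnj_omega by (simp add: power2_eq_square algebra_simps)
    also have "\<dots> = of_real (of_int c0)" unfolding omega_square by simp
    finally show ?thesis by (simp only: of_real_eq_iff)
  qed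
  hence o: "(Re omega)\<^sup>2 + (Im omega)\<^sup>2 = of_int c0" by (simp add: cmod_power2)
  have "(norm (of_real x + of_real y * omega))\<^sup>2 = x\<^sup>2 + 2 * Re omega * x * y + ((Re omega)\<^sup>2 + (Im omega)\<^sup>2) * y\<^sup>2"
    unfolding cmod_power2 by (simp add: power2_eq_square algebra_simps)
  then show ?thesis unfolding o by (simp add: Re_omega)
qed

lemma K_norm_rational: "z \<in> K \<Longrightarrow> (norm z)\<^sup>2 \<in> \<rat>"
proof -
  assume "z \<in> K"
  then obtain x y where z: "z = of_rat x + of_rat y * omega" unfolding K_eq by blast
  have "z = of_real (of_rat x) + of_real (of_rat y) * omega" using z by (simp add: of_real_of_rat)
  then show ?thesis by (simp only: norm_quadratic) (intro Rats_add Rats_mult Rats_power; simp)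
qed

lemma OK_norm_int: "z \<in> OK \<Longrightarrow> (norm z)\<^sup>2 \<in> \<int>"
proof (elim OK_E)
  fix x y assume "z = of_int x + of_int y * omega"
  then have "z = of_real (of_int x) + of_real (of_int y) * omega" by simp
  then show ?thesis by (simp only: norm_quadratic) (intro Ints_add Ints_mult Ints_power; simp)
qed

lemma K_inverse: "a \<in> K \<Longrightarrow> inverse a \<in> K"
proof (cases "a = 0")
  case False
  assume a: "a \<in> K"
  then obtain x y where z: "a = of_rat x + of_rat y * omega" unfolding K_eq by blast
  have "cnj (of_rat r :: complex) = of_rat r" for r
    by (simp flip: of_real_of_rat)
  hence "cnj a = of_rat (x + y * of_int T) + of_rat (- y) * omega"
    unfolding z by (simp add: cnj_omega of_rat_add of_rat_mult of_rat_minus algebra_simps)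
  hence c: "cnj a \<in> K" unfolding K_eq by blast
  obtain r where r: "(norm a)\<^sup>2 = of_rat r" using K_norm_rational[OF a] by (auto elim: Rats_cases)
  have "inverse a = cnj a * of_real (inverse ((norm a)\<^sup>2))"
    using False complex_norm_square[of a] by (simp add: field_simps)
  also have "of_real (inverse ((norm a)\<^sup>2)) = (of_rat (inverse r) + of_rat 0 * omega)"
    unfolding r by (simp add: of_rat_inverse of_real_of_rat)
  finally have "inverse a = cnj a * (of_rat (inverse r) + of_rat 0 * omega)" .
  moreover have "of_rat (inverse r) + of_rat 0 * omega \<in> K" unfolding K_eq by blast
  ultimately show ?thesis using K_mult[OF c] by simp
qed auto

lemma K_cleared: "z \<in> K \<Longrightarrow> \<exists>k>0. of_int k * z \<in> OK"
proof -
  assume "z \<in> K"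
  then obtain x y where z: "z = of_rat x + of_rat y * omega" unfolding K_eq by blast
  have frac: "\<exists>a b. r = of_int a / of_int b \<and> b > 0" for r :: rat
    by (cases r) (auto simp: Fract_of_int_quotient)
  obtain a b where x: "x = of_int a / of_int b" "b > 0" using frac by blast
  obtain c d where y: "y = of_int c / of_int d" "d > 0" using frac by blast
  have "of_int (b * d) * z = of_int (a * d) + of_int (c * b) * omega"
  proof -
    have "of_int b * of_rat x = (of_int a :: complex)" "of_int d * of_rat y = (of_int c :: complex)"
      unfolding x(1) y(1) using x(2) y(2) by (simp_all add: of_rat_divide)
    then have "of_int d * (of_int b * of_rat x) + of_int b * (of_int d * of_rat y) * omega
        = of_int d * of_int a + of_int b * of_int c * omega" by (simp only:)
    then show ?thesis unfolding z by (simp add: algebra_simps)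
  qed
  then have "of_int (b * d) * z \<in> OK" by (simp only: OK_I)
  moreover have "b * d > 0" using x y by simp
  ultimately show ?thesis by blast
qed

text \<open>Modulo its equation of degree \<open>d\<close>, all powers of \<open>z\<close> are combinations of the first \<open>d\<close>, so
  they have a common denominator; so do the powers of the rational number \<open>|z|\<^sup>2\<close>.\<close>

lemma algebraic_int_norm:
  assumes z: "z \<in> K" "algebraic_int z" shows "(norm z)\<^sup>2 \<in> \<int>"
proof -
  obtain p where p: "poly (map_poly of_int p) z = 0" "lead_coeff p = 1"
    using z(2) unfolding algebraic_int_altdef_ipoly by blast
  obtain k where k: "k > 0" "of_int k * z \<in> OK" using K_cleared[OF z(1)] by blast
  define d where "d = degree p"
  have pow: "(of_int k * z) ^ n \<in> OK" for n
    by (induction n) (use OK_mult[OF k(2)] OK_of_int[of 1] in auto)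
  have zd: "z ^ d = - (\<Sum>i<d. of_int (coeff p i) * z ^ i)"
  proof -
    have "(\<Sum>i\<le>d. of_int (coeff p i) * z ^ i) = 0"
      using p(1) unfolding poly_altdef d_def by (simp add: degree_map_poly coeff_map_poly)
    moreover have "(\<Sum>i\<le>d. of_int (coeff p i) * z ^ i) = (\<Sum>i<d. of_int (coeff p i) * z ^ i) + z ^ d"
      using p(2) by (simp add: lessThan_Suc_atMost[symmetric] d_def)
    ultimately show ?thesis by (simp add: eq_neg_iff_add_eq_0 add.commute)
  qed
  have sumOK: "(\<Sum>i\<in>A. g i) \<in> OK" if "finite A" "\<And>i. i \<in> A \<Longrightarrow> g i \<in> OK" for A and g :: "nat \<Rightarrow> complex"
    using that OK_of_int[of 0] by (induction A rule: finite_induct) (auto intro: OK_add)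
  have all: "of_int (k ^ d) * z ^ n \<in> OK" for n
  proof (induction n rule: less_induct)
    case (less n)
    show ?case
    proof (cases "n < d")
      case True
      have "of_int (k ^ d) * z ^ n = of_int (k ^ (d - n)) * (of_int k * z) ^ n"
        using True by (simp add: power_mult_distrib flip: power_add)
      then show ?thesis using OK_mult[OF OK_of_int pow] by (simp only:)
    next
      case False
      have "of_int (k ^ d) * z ^ n = of_int (k ^ d) * (z ^ d * z ^ (n - d))"
        using False by (simp flip: power_add)
      also have "\<dots> = - (\<Sum>i<d. of_int (coeff p i) * (of_int (k ^ d) * z ^ (i + (n - d))))"
        unfolding zd by (simp add: sum_distrib_left sum_distrib_right power_add mult_ac)
      finally show ?thesis
        using False by (simp only:) (intro OK_minus sumOK OK_mult OK_of_int less; simp)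
    qed
  qed
  show ?thesis
  proof (rule rat_bounded_denominators[OF K_norm_rational[OF z(1)], of "(k ^ d)\<^sup>2"])
    show "of_int ((k ^ d)\<^sup>2) * ((norm z)\<^sup>2) ^ n \<in> \<int>" for n
    proof -
      have "of_int ((k ^ d)\<^sup>2) * ((norm z)\<^sup>2) ^ n = (norm (of_int (k ^ d) * z ^ n))\<^sup>2"
        using k(1) by (simp add: norm_mult norm_power power_mult_distrib flip: power_mult)
           (simp add: mult.commute)
      then show ?thesis using OK_norm_int[OF all[of n]] by (simp only:)
    qed
  qed (use k in auto)
qed

text \<open>The norms of \<open>z\<close> and \<open>z + 1\<close> are integers, and their difference gives the trace. For
  \<open>z = x + y \<omega>\<close>, the discriminant \<open>t\<^sup>2 - 4 n = D y\<^sup>2\<close> of the equation of \<open>z\<close> is then an integer, and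
  as \<open>m\<close> is square-free, the denominator of \<open>y\<close> can at most be \<open>2\<close>; this is excluded modulo \<open>4\<close>.\<close>

theorem ring_of_integers_eq: "ring_of_integers K = OK"
proof (intro equalityI subsetI)
  fix z assume "z \<in> OK"
  then obtain x y where z: "z = of_int x + of_int y * omega" by (rule OK_E)
  have "z\<^sup>2 - of_int (2 * x + y * T) * z + of_int (x\<^sup>2 + x * y * T + y\<^sup>2 * c0)
      = of_int y ^ 2 * (omega\<^sup>2 - of_int T * omega + of_int c0)"
    unfolding z by (simp add: power2_eq_square algebra_simps)
  also have "\<dots> = 0" unfolding omega_square by simp
  finally have "algebraic_int z" by (rule algebraic_int_quadratic)
  then show "z \<in> ring_of_integers K" using \<open>z \<in> OK\<close> OK_subset_K by (auto simp: ring_of_integers_def)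
next
  fix z assume "z \<in> ring_of_integers K"
  hence z: "z \<in> K" "algebraic_int z" by (auto simp: ring_of_integers_def)
  then obtain a b where ab: "z = of_rat a + of_rat b * omega" unfolding K_eq by blast
  define x y where "x = (of_rat a :: real)" and "y = (of_rat b :: real)"
  have zxy: "z = of_real x + of_real y * omega" using ab by (simp add: x_def y_def of_real_of_rat)
  have z1: "z + 1 \<in> K" using K_add[OF z(1)] OK_of_int[of 1] OK_subset_K by fastforce
  have n: "(norm z)\<^sup>2 \<in> \<int>" by (rule algebraic_int_norm[OF z])
  have "(norm (z + 1))\<^sup>2 \<in> \<int>" by (rule algebraic_int_norm[OF z1 algebraic_int_add_one[OF z(2)]])
  moreover have "(norm (z + 1))\<^sup>2 = (norm z)\<^sup>2 + 2 * Re z + 1"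
    unfolding cmod_power2 by (simp add: power2_eq_square algebra_simps)
  ultimately have "(norm (z + 1))\<^sup>2 - (norm z)\<^sup>2 - 1 \<in> \<int>" "(norm (z + 1))\<^sup>2 - (norm z)\<^sup>2 - 1 = 2 * Re z"
    using n by (auto intro: Ints_diff)
  hence "2 * Re z \<in> \<int>" by simp
  moreover have "2 * Re z = 2 * x + of_int T * y" unfolding zxy by (simp add: Re_omega)
  ultimately obtain t where t: "2 * x + of_int T * y = of_int t" by (metis Ints_cases)
  obtain n where n: "x\<^sup>2 + of_int T * x * y + of_int c0 * y\<^sup>2 = of_int n"
    using n unfolding zxy norm_quadratic by (auto elim: Ints_cases)
  have "of_int D = ((of_int T)\<^sup>2 - 4 * of_int c0 :: real)" unfolding discriminant_eq[symmetric] by simp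
  hence "of_int D * y\<^sup>2 = (2 * x + of_int T * y)\<^sup>2 - 4 * (x\<^sup>2 + of_int T * x * y + of_int c0 * y\<^sup>2)"
    by (simp only:) (simp add: power2_eq_square algebra_simps)
  hence Dy: "of_int D * y\<^sup>2 = of_int (t\<^sup>2 - 4 * n)" unfolding t n by simp
  obtain u v :: int where uv: "v > 0" "coprime u v" "y = of_int u / of_int v"
    using Rats_cases'[of y] y_def by (metis Rats_of_rat)
  have "D * u\<^sup>2 = (t\<^sup>2 - 4 * n) * v\<^sup>2"
  proof -
    have "of_int D * (of_int u)\<^sup>2 = (of_int (t\<^sup>2 - 4 * n) * (of_int v)\<^sup>2 :: real)"
      using Dy uv(1) unfolding uv(3) by (simp add: power_divide field_simps)
    then show ?thesis by (metis of_int_eq_iff of_int_mult of_int_power)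
  qed
  hence "v\<^sup>2 dvd D * u\<^sup>2" by simp
  moreover have "coprime (v\<^sup>2) (u\<^sup>2)" using uv(2) by (simp add: coprime_commute)
  ultimately have vD: "v\<^sup>2 dvd D" using coprime_dvd_mult_left_iff by blast
  have unit: "w = 1" if "w\<^sup>2 dvd m" "w > 0" for w
    using squarefreeD[OF m_squarefree that(1)] that(2) by simp
  have "v = 1"
  proof (cases "m mod 4 = 1")
    case True
    then show ?thesis using unit vD uv(1) by (simp add: quadratic_discriminant_def)
  next
    case m1: False
    hence D4: "D = 4 * m" by (simp add: quadratic_discriminant_def)
    show ?thesis
    proof (cases "even v")
      case False
      hence "coprime v (2 * 2)"
        by (simp only: coprime_mult_right_iff coprime_right_2_iff_odd simp_thms)
      hence "coprime (v\<^sup>2) 4" by simp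
      hence "v\<^sup>2 dvd m" using vD unfolding D4 using coprime_dvd_mult_right_iff by blast
      then show ?thesis using unit uv(1) by blast
    next
      case True
      then obtain w where w: "v = 2 * w" by blast
      have "w\<^sup>2 dvd m" using vD unfolding D4 w by (simp add: power_mult_distrib)
      hence w1: "w = 1" using unit w uv(1) by simp
      have "odd u" using uv(2) \<open>even v\<close> by (meson coprime_common_divisor odd_one)
      have T0: "T = 0" unfolding T_def D4 by simp
      have "4 * m * u\<^sup>2 = (t\<^sup>2 - 4 * n) * 4"
        using \<open>D * u\<^sup>2 = (t\<^sup>2 - 4 * n) * v\<^sup>2\<close> unfolding D4 w w1 by simp
      hence mu: "m * u\<^sup>2 = t\<^sup>2 - 4 * n" by simp
      have sq: "odd j \<Longrightarrow> j\<^sup>2 mod 4 = 1" "even j \<Longrightarrow> j\<^sup>2 mod 4 = 0" for j :: int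
      proof -
        show "j\<^sup>2 mod 4 = 1" if o: "odd j"
        proof -
          obtain i where "j = 2 * i + 1" using oddE[OF o] by blast
          hence "j\<^sup>2 = 1 + (i\<^sup>2 + i) * 4" by (simp add: power2_eq_square algebra_simps)
          then show ?thesis by (simp only: mod_mult_self1) simp
        qed
      qed (auto elim!: evenE simp: power2_eq_square)
      have "m mod 4 = (m * (u\<^sup>2 mod 4)) mod 4" using sq(1)[OF \<open>odd u\<close>] by simp
      also have "\<dots> = (t\<^sup>2 + (- n) * 4) mod 4" unfolding mod_mult_right_eq mu by (simp add: algebra_simps)
      also have "\<dots> = t\<^sup>2 mod 4" by (simp only: mod_mult_self1)
      finally have "m mod 4 = t\<^sup>2 mod 4" .
      then show ?thesis using sq[of t] m_mod_4 m1 by (cases "even t") auto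
    qed
  qed
  hence y: "y = of_int u" using uv(3) by simp
  have "(t - T * u) * (t + T * u) = 4 * (n - c0 * u\<^sup>2)"
  proof -
    have tx: "of_int t = 2 * x + of_int T * of_int u" using t y by simp
    have "of_int ((t - T * u) * (t + T * u)) = (of_int (4 * (n - c0 * u\<^sup>2)) :: real)"
      using n unfolding y by (simp add: tx power2_eq_square algebra_simps)
    then show ?thesis by (simp only: of_int_eq_iff)
  qed
  hence "even ((t - T * u) * (t + T * u))" by simp
  hence "even (t - T * u)" by auto
  then obtain x' where "t - T * u = 2 * x'" by blast
  hence "of_int t = (2 * of_int x' + of_int T * of_int u :: real)"
    by (metis add.commute add_diff_cancel_left' diff_add_cancel of_int_add of_int_mult of_int_numeral)
  hence "x = of_int x'" using t y by simp
  then have "z = of_int x' + of_int u * omega" using zxy y by simp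
  then show "z \<in> OK" by (simp only: OK_I)
qed

end

section \<open>Ideals as lattices\<close>

definition covolume :: "complex set \<Rightarrow> real" where
  "covolume S = (THE c. \<exists>u v. S = lat u v \<and> Im (cnj u * v) \<noteq> 0 \<and> c = \<bar>Im (cnj u * v)\<bar>)"

lemma lat_generators: "u \<in> lat u v" "v \<in> lat u v"
  using lat_I[of 1 u 0 v] lat_I[of 0 u 1 v] by simp_all

lemma scale_lat: "(\<lambda>z. c * z) ` lat u v = lat (c * u) (c * v)"
proof -
  have "c * lattice_point u v p = lattice_point (c * u) (c * v) p" for p
    by (simp add: lattice_point_def case_prod_unfold algebra_simps)
  then show ?thesis by (simp add: image_image lat_def)
qed

text \<open>Two bases of a lattice differ by an integer matrix whose inverse is also an integer
  matrix, hence has determinant \<open>1\<close> or \<open>-1\<close>.\<close>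

lemma covolume_lat:
  assumes d: "Im (cnj u * v) \<noteq> 0"
  shows "covolume (lat u v) = \<bar>Im (cnj u * v)\<bar>"
  unfolding covolume_def
proof (rule the_equality)
  have multiple: "\<exists>k. Im (cnj u' * v') = of_int k * Im (cnj u * v)"
    if uv: "u' \<in> lat u v" "v' \<in> lat u v" for u v u' v'
  proof -
    obtain x y where u': "u' = of_int x * u + of_int y * v" by (rule lat_E[OF uv(1)])
    obtain s t where v': "v' = of_int s * u + of_int t * v" by (rule lat_E[OF uv(2)])
    have "Im (cnj u' * v') = of_int (x * t - y * s) * Im (cnj u * v)"
      unfolding u' v' by (simp add: algebra_simps)
    then show ?thesis by blast
  qed
  fix c assume "\<exists>u' v'. lat u v = lat u' v' \<and> Im (cnj u' * v') \<noteq> 0 \<and> c = \<bar>Im (cnj u' * v')\<bar>"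
  then obtain u' v' where uv: "lat u v = lat u' v'" "c = \<bar>Im (cnj u' * v')\<bar>" by blast
  obtain k where k: "Im (cnj u' * v') = of_int k * Im (cnj u * v)"
    using multiple[of u' u v v'] lat_generators(1)[of u' v'] lat_generators(2)[of v' u'] unfolding uv(1) by metis
  obtain l where l: "Im (cnj u * v) = of_int l * Im (cnj u' * v')"
    using multiple[of u u' v' v] lat_generators(1)[of u v] lat_generators(2)[of v u] unfolding uv(1) by metis
  have "of_int (l * k) * Im (cnj u * v) = Im (cnj u * v)" using k l by simp
  hence "real_of_int (l * k) = 1" using d by simp
  hence "l * k = 1" by (simp only: of_int_eq_1_iff)
  hence "\<bar>k * l\<bar> = 1" by (simp add: mult.commute)
  hence "\<bar>k\<bar> = 1" by (rule abs_zmult_eq_1)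
  hence "\<bar>real_of_int k\<bar> = 1" by simp
  then show "c = \<bar>Im (cnj u * v)\<bar>" unfolding uv(2) k by (simp add: abs_mult)
qed (use d in blast)

lemma covolume_scale:
  assumes d: "Im (cnj u * v) \<noteq> 0" and c: "c \<noteq> 0"
  shows "covolume ((\<lambda>z. c * z) ` lat u v) = (norm c)\<^sup>2 * covolume (lat u v)"
proof -
  have "cnj (c * u) * (c * v) = of_real ((norm c)\<^sup>2) * (cnj u * v)"
    unfolding complex_norm_square by (simp add: algebra_simps)
  hence "Im (cnj (c * u) * (c * v)) = (norm c)\<^sup>2 * Im (cnj u * v)"
    by (simp only: Im_complex_of_real Re_complex_of_real times_complex.sel)
  moreover from this have "Im (cnj (c * u) * (c * v)) \<noteq> 0" using d c by simp
  ultimately show ?thesis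
    unfolding scale_lat using covolume_lat[OF d] covolume_lat[of "c * u" "c * v"]
    by (simp add: abs_mult)
qed

lemma int_subgroup_generator:
  fixes S :: "int set"
  assumes add: "\<And>x y. x \<in> S \<Longrightarrow> y \<in> S \<Longrightarrow> x + y \<in> S" and neg: "\<And>x. x \<in> S \<Longrightarrow> - x \<in> S"
    and nz: "s \<in> S" "s \<noteq> 0"
  shows "\<exists>g>0. \<forall>x. x \<in> S \<longleftrightarrow> g dvd x"
proof -
  define n where "n = (LEAST n. n > 0 \<and> int n \<in> S)"
  have "nat \<bar>s\<bar> > 0 \<and> int (nat \<bar>s\<bar>) \<in> S" using nz neg[OF nz(1)] by (auto simp: abs_if)
  hence n: "n > 0 \<and> int n \<in> S" unfolding n_def by (rule LeastI)
  have zero: "0 \<in> S" using add[OF nz(1) neg[OF nz(1)]] by simp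
  have nat_mult: "int j * x \<in> S" if "x \<in> S" for j x
    by (induction j) (use that zero add in \<open>auto simp: algebra_simps\<close>)
  have mult: "k * x \<in> S" if "x \<in> S" for k x
    using nat_mult[OF that, of "nat k"] nat_mult[OF neg[OF that], of "nat (- k)"]
    by (cases "k \<ge> 0") auto
  have "x \<in> S \<longleftrightarrow> int n dvd x" for x
  proof
    assume x: "x \<in> S"
    have "x mod int n = x + (- (x div int n)) * int n" by (simp add: minus_div_mult_eq_mod[symmetric])
    hence r: "x mod int n \<in> S" using add[OF x mult] n by metis
    have "x mod int n = 0"
    proof (rule ccontr)
      assume "x mod int n \<noteq> 0"
      moreover have "x mod int n \<ge> 0" "x mod int n < int n" using n by simp_all
      ultimately have p: "x mod int n > 0" "x mod int n < int n" by linarith+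
      hence "nat (x mod int n) > 0 \<and> int (nat (x mod int n)) \<in> S" using r by simp
      hence "n \<le> nat (x mod int n)" unfolding n_def by (rule Least_le)
      then show False using p by linarith
    qed
    then show "int n dvd x" by (simp add: dvd_eq_mod_eq_0)
  next
    assume "int n dvd x"
    then show "x \<in> S" using mult n by (metis dvd_def mult.commute)
  qed
  then show ?thesis using n by (metis of_nat_0_less_iff)
qed

context imaginary_quadratic begin

definition is_ideal :: "complex set \<Rightarrow> bool" where
  "is_ideal J \<longleftrightarrow> J \<subseteq> OK \<and> J \<noteq> {0} \<and> 0 \<in> J \<and> (\<forall>a\<in>J. \<forall>b\<in>J. a + b \<in> J) \<and> (\<forall>r\<in>OK. \<forall>a\<in>J. r * a \<in> J)"

lemma is_idealD:
  assumes "is_ideal J"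
  shows "J \<subseteq> OK" "J \<noteq> {0}" "0 \<in> J" "\<And>a b. a \<in> J \<Longrightarrow> b \<in> J \<Longrightarrow> a + b \<in> J"
    "\<And>r a. r \<in> OK \<Longrightarrow> a \<in> J \<Longrightarrow> r * a \<in> J" "\<And>k a. a \<in> J \<Longrightarrow> of_int k * a \<in> J"
    "\<And>a b. a \<in> J \<Longrightarrow> b \<in> J \<Longrightarrow> a - b \<in> J"
proof -
  show *: "J \<subseteq> OK" "J \<noteq> {0}" "0 \<in> J" "\<And>a b. a \<in> J \<Longrightarrow> b \<in> J \<Longrightarrow> a + b \<in> J"
    "\<And>r a. r \<in> OK \<Longrightarrow> a \<in> J \<Longrightarrow> r * a \<in> J" using assms unfolding is_ideal_def by blast+
  show k: "of_int k * a \<in> J" if "a \<in> J" for k a using *(5)[OF OK_of_int that] .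
  show "a - b \<in> J" if "a \<in> J" "b \<in> J" for a b
    using *(4)[OF that(1) k[OF that(2), of "-1"]] by simp
qed

text \<open>Ideals in Hermite normal form, \<open>g (a \<int> + (b + \<omega>) \<int>)\<close>.\<close>

definition std_ideal :: "int \<Rightarrow> int \<Rightarrow> int \<Rightarrow> complex set" where
  "std_ideal g a b = lat (of_int (g * a)) (of_int g * (of_int b + omega))"

lemma int_coordinates:
  "of_int x + of_int y * omega = of_int x' + of_int y' * omega \<longleftrightarrow> x = x' \<and> y = y'"
  using omega_nonreal[of "of_int x" "of_int y" "of_int x'" "of_int y'"] by simp

lemma mem_std_ideal:
  "of_int x + of_int y * omega \<in> std_ideal g a b \<longleftrightarrow> (\<exists>k l. x = g * (k * a + l * b) \<and> y = g * l)"
proof -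
  have "of_int k * of_int (g * a) + of_int l * (of_int g * (of_int b + omega))
      = of_int (g * (k * a + l * b)) + of_int (g * l) * omega" for k l
    by (simp add: algebra_simps)
  note comb = this
  show ?thesis
  proof
    assume "of_int x + of_int y * omega \<in> std_ideal g a b"
    then obtain k l where "of_int x + of_int y * omega
        = of_int k * of_int (g * a) + of_int l * (of_int g * (of_int b + omega))"
      unfolding std_ideal_def by (rule lat_E)
    then show "\<exists>k l. x = g * (k * a + l * b) \<and> y = g * l" unfolding comb int_coordinates by blast
  next
    assume "\<exists>k l. x = g * (k * a + l * b) \<and> y = g * l"
    then obtain k l where xy: "x = g * (k * a + l * b)" "y = g * l" by blast
    show "of_int x + of_int y * omega \<in> std_ideal g a b"
      unfolding std_ideal_def xy comb[symmetric] by (rule lat_I)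
  qed
qed

lemma conj_identity: "(of_int b + omega) * (of_int (b + T) - omega) = of_int (norm_form b)"
proof -
  have "(of_int b + omega) * (of_int (b + T) - omega) = of_int (b * (b + T)) + of_int T * omega - omega\<^sup>2"
    by (simp add: power2_eq_square algebra_simps)
  then show ?thesis unfolding omega_square by (simp add: norm_form_def power2_eq_square algebra_simps)
qed

lemma std_ideal_is_ideal:
  assumes g: "g > 0" and a: "a > 0" and b: "b \<in> roots a"
  shows "is_ideal (std_ideal g a b)"
proof -
  let ?J = "std_ideal g a b"
  obtain t where t: "norm_form b = a * t" using rootsD(1)[OF b] by blast
  have sub: "?J \<subseteq> OK"
  proof
    fix z assume "z \<in> ?J"
    then obtain k l where "z = of_int k * of_int (g * a) + of_int l * (of_int g * (of_int b + omega))"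
      unfolding std_ideal_def by (rule lat_E)
    then have "z = of_int (g * (k * a + l * b)) + of_int (g * l) * omega" by (simp add: algebra_simps)
    then show "z \<in> OK" by (simp only: OK_I)
  qed
  have coords: "\<exists>x y. z = of_int x + of_int y * omega" if "z \<in> ?J" for z
    using subsetD[OF sub that] by (rule OK_E) blast
  have add: "z + w \<in> ?J" if zw: "z \<in> ?J" "w \<in> ?J" for z w
  proof -
    obtain x y x' y' where z: "z = of_int x + of_int y * omega" and w: "w = of_int x' + of_int y' * omega"
      using coords zw by blast
    obtain k l where 1: "x = g * (k * a + l * b)" "y = g * l" using zw(1) unfolding z mem_std_ideal by blast
    obtain k' l' where 2: "x' = g * (k' * a + l' * b)" "y' = g * l'" using zw(2) unfolding w mem_std_ideal by blast
    have "x + x' = g * ((k + k') * a + (l + l') * b)" "y + y' = g * (l + l')"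
      unfolding 1 2 by (simp_all add: algebra_simps)
    hence "of_int (x + x') + of_int (y + y') * omega \<in> ?J" unfolding mem_std_ideal by blast
    then show ?thesis unfolding z w by (simp add: algebra_simps)
  qed
  have int_mult: "of_int c * z \<in> ?J" if zJ: "z \<in> ?J" for c z
  proof -
    obtain x y where z: "z = of_int x + of_int y * omega" using coords[OF zJ] by blast
    obtain k l where 1: "x = g * (k * a + l * b)" "y = g * l" using zJ unfolding z mem_std_ideal by blast
    have "c * x = g * ((c * k) * a + (c * l) * b)" "c * y = g * (c * l)"
      unfolding 1 by (simp_all add: algebra_simps)
    hence "of_int (c * x) + of_int (c * y) * omega \<in> ?J" unfolding mem_std_ideal by blast
    then show ?thesis unfolding z by (simp add: algebra_simps)
  qed
  have omega_mult: "omega * z \<in> ?J" if zJ: "z \<in> ?J" for z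
  proof -
    obtain x y where z: "z = of_int x + of_int y * omega" using coords[OF zJ] by blast
    obtain k l where 1: "x = g * (k * a + l * b)" "y = g * l" using zJ unfolding z mem_std_ideal by blast
    have "omega * z = of_int x * omega + of_int y * omega\<^sup>2" unfolding z by (simp add: power2_eq_square algebra_simps)
    also have "\<dots> = of_int (- (y * c0)) + of_int (x + y * T) * omega"
      unfolding omega_square by (simp add: algebra_simps)
    finally have oz: "omega * z = of_int (- (y * c0)) + of_int (x + y * T) * omega" .
    have "- (y * c0) = g * ((- (k * b) - l * t) * a + (k * a + l * b + l * T) * b)"
    proof -
      have "g * ((- (k * b) - l * t) * a + (k * a + l * b + l * T) * b)
          = g * l * (b\<^sup>2 + T * b - a * t)" by (simp add: power2_eq_square algebra_simps)
      also have "b\<^sup>2 + T * b - a * t = - c0" unfolding t[symmetric] norm_form_def by simp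
      finally show ?thesis unfolding 1 by simp
    qed
    moreover have "x + y * T = g * (k * a + l * b + l * T)" unfolding 1 by (simp add: algebra_simps)
    ultimately show ?thesis unfolding oz mem_std_ideal by blast
  qed
  have mult: "r * z \<in> ?J" if rz: "r \<in> OK" "z \<in> ?J" for r z
  proof -
    obtain x y where r: "r = of_int x + of_int y * omega" by (rule OK_E[OF rz(1)])
    have "of_int x * z + of_int y * (omega * z) \<in> ?J"
      by (intro add int_mult omega_mult rz(2))
    then show ?thesis unfolding r by (simp add: algebra_simps)
  qed
  have ga: "of_int (g * a) \<in> ?J" unfolding std_ideal_def by (rule lat_generators)
  moreover have "of_int (g * a) \<noteq> (0::complex)" using g a by simp
  ultimately have "?J \<noteq> {0}" by blast
  moreover have "0 \<in> ?J" using int_mult[OF ga, of 0] by simp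
  ultimately show ?thesis unfolding is_ideal_def using sub add mult by blast
qed

text \<open>The coefficients of \<open>\<omega>\<close> in \<open>J\<close> form a subgroup \<open>g \<int>\<close>, and the integers in \<open>J\<close> a subgroup
  \<open>A \<int>\<close>. Multiplication by \<open>\<omega>\<close> shows that \<open>g\<close> divides \<open>A\<close> and the element of \<open>J\<close> that has \<open>g\<close>
  as coefficient of \<open>\<omega>\<close>; multiplying this element by its conjugate gives the divisibility that
  makes \<open>b\<close> a root of the norm form.\<close>

theorem ideal_eq_std_ideal:
  assumes J: "is_ideal J"
  shows "\<exists>g a b. g > 0 \<and> a > 0 \<and> b \<in> roots a \<and> J = std_ideal g a b"
proof -
  note Jd = is_idealD[OF J]
  obtain z where z: "z \<in> J" "z \<noteq> 0" using Jd(2,3) by blast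
  then obtain x y where zxy: "z = of_int x + of_int y * omega" using OK_E[OF subsetD[OF Jd(1)]] by metis
  define Y where "Y = {y. \<exists>x. of_int x + of_int y * omega \<in> J}"
  define XX where "XX = {x. of_int x \<in> J}"
  have "\<exists>g>0. \<forall>y. y \<in> Y \<longleftrightarrow> g dvd y"
  proof -
    have "y + y' \<in> Y" if yy: "y \<in> Y" "y' \<in> Y" for y y'
    proof -
      obtain x x' where "of_int x + of_int y * omega \<in> J" "of_int x' + of_int y' * omega \<in> J"
        using yy unfolding Y_def by blast
      from Jd(4)[OF this] have "of_int (x + x') + of_int (y + y') * omega \<in> J" by (simp add: algebra_simps)
      then show ?thesis unfolding Y_def by blast
    qed
    moreover have "- y \<in> Y" if yy: "y \<in> Y" for y
    proof -
      obtain x where "of_int x + of_int y * omega \<in> J" using yy unfolding Y_def by blast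
      from Jd(6)[OF this, of "-1"] have "of_int (- x) + of_int (- y) * omega \<in> J" by (simp add: algebra_simps)
      then show ?thesis unfolding Y_def by blast
    qed
    moreover have "\<exists>s. s \<in> Y \<and> s \<noteq> 0"
    proof (cases "y = 0")
      case False
      then show ?thesis using z(1) unfolding zxy Y_def by blast
    next
      case True
      have "of_int 0 + of_int x * omega \<in> J" using Jd(5)[OF OK_omega z(1)] zxy True by (simp add: mult.commute)
      moreover have "x \<noteq> 0" using z(2) zxy True by auto
      ultimately show ?thesis unfolding Y_def by blast
    qed
    ultimately show ?thesis using int_subgroup_generator[of Y] by blast
  qed
  then obtain g where g: "g > 0" "\<And>y. y \<in> Y \<longleftrightarrow> g dvd y" by blast
  have "\<exists>A>0. \<forall>x. x \<in> XX \<longleftrightarrow> A dvd x"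
  proof -
    have "x + x' \<in> XX" if "x \<in> XX" "x' \<in> XX" for x x'
      using Jd(4)[of "of_int x" "of_int x'"] that unfolding XX_def by simp
    moreover have "- x \<in> XX" if "x \<in> XX" for x
      using Jd(6)[of "of_int x" "-1"] that unfolding XX_def by simp
    moreover have "\<exists>s. s \<in> XX \<and> s \<noteq> 0"
    proof -
      have "cnj z = of_int (x + y * T) + of_int (- y) * omega" unfolding zxy by (simp add: cnj_omega algebra_simps)
      hence "cnj z \<in> OK" by (simp only: OK_I)
      hence "cnj z * z \<in> J" using Jd(5) z(1) by blast
      moreover have "cnj z * z = of_real ((norm z)\<^sup>2)" by (simp only: complex_norm_square mult.commute)
      moreover obtain s where s: "(norm z)\<^sup>2 = of_int s" using OK_norm_int Jd(1) z(1) by (metis Ints_cases subsetD)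
      ultimately have "s \<in> XX" unfolding XX_def by (metis mem_Collect_eq of_real_of_int_eq)
      moreover have "s \<noteq> 0" using z(2) s by auto
      ultimately show ?thesis by blast
    qed
    ultimately show ?thesis using int_subgroup_generator[of XX] by blast
  qed
  then obtain A where A: "A > 0" "\<And>x. x \<in> XX \<longleftrightarrow> A dvd x" by blast
  have AJ: "of_int A \<in> J" using A(2)[of A] unfolding XX_def by simp
  have "of_int 0 + of_int A * omega \<in> J" using Jd(5)[OF OK_omega AJ] by (simp add: mult.commute)
  hence "g dvd A" unfolding g(2)[symmetric] Y_def by blast
  then obtain a where a: "A = g * a" by blast
  have a0: "a > 0" using A(1) g(1) unfolding a by (simp add: zero_less_mult_iff)
  have "g \<in> Y" using g(2) by simp
  then obtain x0 where x0: "of_int x0 + of_int g * omega \<in> J" unfolding Y_def by blast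
  have "omega * (of_int x0 + of_int g * omega) = of_int x0 * omega + of_int g * omega\<^sup>2"
    by (simp add: power2_eq_square algebra_simps)
  also have "\<dots> = of_int (- (g * c0)) + of_int (x0 + g * T) * omega"
    unfolding omega_square by (simp add: algebra_simps)
  finally have "of_int (- (g * c0)) + of_int (x0 + g * T) * omega \<in> J"
    using Jd(5)[OF OK_omega x0] by (simp only:)
  hence "g dvd x0 + g * T" unfolding g(2)[symmetric] Y_def by blast
  hence "g dvd x0" by (metis dvd_add_left_iff dvd_triv_left)
  then obtain b0 where b0: "x0 = g * b0" by blast
  define b where "b = b0 mod a"
  have gb: "of_int g * (of_int b + omega) \<in> J"
  proof -
    have "of_int g * (of_int b + omega) = (of_int x0 + of_int g * omega) - of_int (b0 div a) * of_int A"
    proof -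
      have "b = b0 - (b0 div a) * a" unfolding b_def by (simp add: minus_div_mult_eq_mod)
      hence "(of_int b :: complex) = of_int b0 - of_int (b0 div a) * of_int a"
        by (simp only: of_int_diff of_int_mult)
      then show ?thesis unfolding b0 a by (simp only: of_int_mult) (simp add: algebra_simps)
    qed
    then show ?thesis using Jd(7)[OF x0 Jd(6)[OF AJ]] by (simp only:)
  qed
  have "of_int (g * norm_form b) \<in> J"
  proof -
    have "of_int (b + T) - omega = of_int (b + T) + of_int (- 1) * omega" by simp
    hence "of_int (b + T) - omega \<in> OK" by (simp only: OK_I)
    from Jd(5)[OF this gb] show ?thesis using conj_identity[of b] by (simp add: mult_ac)
  qed
  hence "g * a dvd g * norm_form b" using A(2) a unfolding XX_def by blast
  hence "b \<in> roots a" using g(1) a0 unfolding roots_def b_def by simp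
  moreover have "J = std_ideal g a b"
  proof (intro equalityI subsetI)
    fix w assume "w \<in> std_ideal g a b"
    then obtain k l where w: "w = of_int k * of_int (g * a) + of_int l * (of_int g * (of_int b + omega))"
      unfolding std_ideal_def by (rule lat_E)
    show "w \<in> J" unfolding w by (rule Jd(4)[OF Jd(6)[OF AJ[unfolded a]] Jd(6)[OF gb]])
  next
    fix w assume w: "w \<in> J"
    then obtain x y where wxy: "w = of_int x + of_int y * omega" using OK_E[OF subsetD[OF Jd(1)]] by metis
    hence "y \<in> Y" using w unfolding Y_def by blast
    then obtain l where l: "y = g * l" using g(2) by blast
    have "w - of_int l * (of_int g * (of_int b + omega)) \<in> J" using Jd(7)[OF w Jd(6)[OF gb]] .
    moreover have "w - of_int l * (of_int g * (of_int b + omega)) = of_int (x - l * g * b)"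
      unfolding wxy l by (simp add: algebra_simps)
    ultimately have "x - l * g * b \<in> XX" unfolding XX_def by simp
    hence "A dvd x - l * g * b" using A(2) by blast
    then obtain k where "x - l * g * b = g * a * k" unfolding a by blast
    hence "x = g * (k * a + l * b)" by (simp add: algebra_simps)
    then show "w \<in> std_ideal g a b" unfolding wxy mem_std_ideal using l by blast
  qed
  ultimately show ?thesis using g(1) a0 by blast
qed

lemma std_ideal_inj:
  assumes 1: "g > 0" "a > 0" "b \<in> roots a" and 2: "g' > 0" "a' > 0" "b' \<in> roots a'"
    and eq: "std_ideal g a b = std_ideal g' a' b'"
  shows "g = g' \<and> a = a' \<and> b = b'"
proof -
  have gen: "of_int (g * b) + of_int g * omega \<in> std_ideal g a b"
    "of_int (g * a) + of_int 0 * omega \<in> std_ideal g a b" for g a b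
  proof -
    have "g * b = g * (0 * a + 1 * b) \<and> g = g * 1" by simp
    then show "of_int (g * b) + of_int g * omega \<in> std_ideal g a b" unfolding mem_std_ideal by blast
    have "g * a = g * (1 * a + 0 * b) \<and> 0 = g * 0" by simp
    then show "of_int (g * a) + of_int 0 * omega \<in> std_ideal g a b" unfolding mem_std_ideal by blast
  qed
  have gdvd: "g dvd g'" if "std_ideal g' a' b' \<subseteq> std_ideal g a b" for g a b g' a' b'
  proof -
    have "of_int (g' * b') + of_int g' * omega \<in> std_ideal g a b" by (rule subsetD[OF that gen(1)])
    then show ?thesis unfolding mem_std_ideal by (metis dvd_triv_left)
  qed
  have g: "g = g'"
    by (rule zdvd_antisym_nonneg) (use 1(1) 2(1) eq gdvd in \<open>simp_all add: order_less_imp_le, blast+\<close>)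
  have adm: "a dvd a' \<and> b mod a = b' mod a"
    if g0: "g > 0" and sub: "std_ideal g a' b' \<subseteq> std_ideal g a b" for a b a' b'
  proof -
    have "of_int (g * a') + of_int 0 * omega \<in> std_ideal g a b" by (rule subsetD[OF sub gen(2)])
    then obtain k l where kl: "g * (k * a + l * b) = g * a'" "g * l = 0" unfolding mem_std_ideal by metis
    have "l = 0" using kl(2) g0 by simp
    hence "k * a = a'" using kl(1) g0 by simp
    hence 1: "a dvd a'" by (metis dvd_triv_right)
    have "of_int (g * b') + of_int g * omega \<in> std_ideal g a b" by (rule subsetD[OF sub gen(1)])
    then obtain k l where kl: "g * (k * a + l * b) = g * b'" "g * l = g" unfolding mem_std_ideal by metis
    have "l = 1" using kl(2) g0 by simp
    hence "k * a + b = b'" using kl(1) g0 by simp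
    hence "b mod a = b' mod a" using mod_mult_self3[of k a b] by simp
    with 1 show ?thesis ..
  qed
  have sub: "std_ideal g a' b' \<subseteq> std_ideal g a b" "std_ideal g a b \<subseteq> std_ideal g a' b'"
    using eq g by blast+
  have a: "a = a'"
    by (rule zdvd_antisym_nonneg[OF less_imp_le[OF 1(2)] less_imp_le[OF 2(2)]
          conjunct1[OF adm[OF 1(1) sub(1)]] conjunct1[OF adm[OF 1(1) sub(2)]]])
  have "b mod a = b' mod a" using adm[OF 1(1) sub(1)] by blast
  moreover have "b mod a = b" by (rule rootsD(2)[OF 1(3)])
  moreover have "b' mod a = b'" using rootsD(2)[OF 2(3)] a by metis
  ultimately show ?thesis using g a by metis
qed

lemma covolume_std_ideal:
  assumes "g > 0" "a > 0"
  shows "Im (cnj (of_int (g * a)) * (of_int g * (of_int b + omega))) > 0"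
    and "covolume (std_ideal g a b) = of_int (g\<^sup>2 * a) * Im omega"
proof -
  have i: "Im (cnj (of_int (g * a)) * (of_int g * (of_int b + omega))) = of_int (g\<^sup>2 * a) * Im omega"
    by (simp add: power2_eq_square algebra_simps)
  then show p: "Im (cnj (of_int (g * a)) * (of_int g * (of_int b + omega))) > 0"
    using Im_omega assms by simp
  show "covolume (std_ideal g a b) = of_int (g\<^sup>2 * a) * Im omega"
    unfolding std_ideal_def covolume_lat[OF less_imp_neq[OF p, symmetric]]
    using abs_of_pos[OF p] i by (simp only:)
qed

lemma ideal_is_lattice:
  assumes "is_ideal J"
  obtains u v where "J = lat u v" "Im (cnj u * v) \<noteq> 0"
  using ideal_eq_std_ideal[OF assms] covolume_std_ideal(1) unfolding std_ideal_def
  by (metis less_irrefl)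

end

section \<open>The theta series of an ideal class\<close>

context imaginary_quadratic begin

abbreviation scale :: "complex \<Rightarrow> complex set \<Rightarrow> complex set" where
  "scale c J \<equiv> (\<lambda>z. c * z) ` J"

definition ideal_norm :: "complex set \<Rightarrow> real" where "ideal_norm J = covolume J / Im omega"

definition ideal_class :: "complex set \<Rightarrow> complex set set" where
  "ideal_class J = {I. is_ideal I \<and> (\<exists>c. c \<noteq> 0 \<and> I = scale c J)}"

lemma scale_scale: "scale c (scale d J) = scale (c * d) J"
  by (simp add: image_image mult.assoc)

lemma scale_1: "scale 1 J = J" by simp

lemma scale_cancel: "c \<noteq> 0 \<Longrightarrow> scale c I = scale d J \<Longrightarrow> I = scale (d / c) J"
  using scale_scale[of "inverse c" c I] scale_scale[of "inverse c" d J]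
  by (simp add: field_simps)

lemma ideal_norm_scale:
  assumes "is_ideal J" "c \<noteq> 0"
  shows "ideal_norm (scale c J) = (norm c)\<^sup>2 * ideal_norm J"
proof -
  obtain u v where "J = lat u v" "Im (cnj u * v) \<noteq> 0" by (rule ideal_is_lattice[OF assms(1)])
  then show ?thesis unfolding ideal_norm_def using covolume_scale[of u v c] assms(2) by simp
qed

lemma ideal_norm_std: "g > 0 \<Longrightarrow> a > 0 \<Longrightarrow> ideal_norm (std_ideal g a b) = of_int (g\<^sup>2 * a)"
  unfolding ideal_norm_def using covolume_std_ideal(2)[of g a b] Im_omega by simp

lemma ideal_norm_pos: "is_ideal J \<Longrightarrow> ideal_norm J > 0"
proof -
  assume "is_ideal J"
  then obtain g a b where "g > 0" "a > 0" "J = std_ideal g a b" using ideal_eq_std_ideal by blast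
  then show ?thesis using ideal_norm_std[of g a b] by simp
qed

lemma ideal_nonzero_element:
  assumes "is_ideal J" obtains z where "z \<in> J" "z \<noteq> 0"
  using is_idealD(2,3)[OF assms] by blast

text \<open>Four times the norm of \<open>x + y \<omega>\<close> is \<open>(2 x + T y)\<^sup>2 + N y\<^sup>2\<close>, and \<open>N > 4\<close>.\<close>

lemma units_of_norm_one:
  assumes "e \<in> OK" "norm e = 1" shows "e = 1 \<or> e = -1"
proof -
  obtain x y where e: "e = of_int x + of_int y * omega" using assms(1) by (rule OK_E)
  have "e = of_real (of_int x) + of_real (of_int y) * omega" using e by simp
  hence "(of_int x)\<^sup>2 + of_int T * of_int x * of_int y + of_int c0 * (of_int y)\<^sup>2 = (1::real)"
    using assms(2) norm_quadratic[of "of_int x" "of_int y"] by simp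
  hence "of_int (x\<^sup>2 + T * x * y + c0 * y\<^sup>2) = (of_int 1 :: real)" by simp
  hence n: "x\<^sup>2 + T * x * y + c0 * y\<^sup>2 = 1" by (simp only: of_int_eq_iff)
  have "(2 * x + T * y)\<^sup>2 - (T\<^sup>2 - 4 * c0) * y\<^sup>2 = 4 * (x\<^sup>2 + T * x * y + c0 * y\<^sup>2)"
    by (simp add: power2_eq_square algebra_simps)
  hence 4: "(2 * x + T * y)\<^sup>2 + N * y\<^sup>2 = 4" using discriminant_less unfolding n discriminant_eq by simp
  have "y = 0"
  proof (rule ccontr)
    assume "y \<noteq> 0"
    hence "y\<^sup>2 > 0" by simp
    hence "y\<^sup>2 \<ge> 1" by linarith
    hence "N * 1 \<le> N * y\<^sup>2" by (intro mult_left_mono) auto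
    moreover have "(2 * x + T * y)\<^sup>2 \<ge> 0" by simp
    ultimately show False using 4 N_greater by linarith
  qed
  hence "x\<^sup>2 = 1" using n by simp
  hence "x = 1 \<or> x = -1" by (simp add: power2_eq_1_iff)
  then show ?thesis using e \<open>y = 0\<close> by auto
qed

text \<open>Multiplication by \<open>e\<close> acts on a basis of \<open>J\<close> by an integer matrix, so \<open>e\<close> is a root
  of its characteristic polynomial.\<close>

lemma multiplier_in_OK:
  assumes J: "is_ideal J" and e: "scale e J \<subseteq> J"
  shows "e \<in> OK"
proof -
  obtain u v where uv: "J = lat u v" "Im (cnj u * v) \<noteq> 0" by (rule ideal_is_lattice[OF J])
  have nz: "u \<noteq> 0" "v \<noteq> 0" using uv(2) by auto
  have "e * u \<in> lat u v" "e * v \<in> lat u v" using e lat_generators unfolding uv(1) by blast+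
  then obtain a b c d where 1: "e * u = of_int a * u + of_int b * v" and 2: "e * v = of_int c * u + of_int d * v"
    by (metis lat_E)
  have "(e - of_int a) * u * ((e - of_int d) * v) = (of_int b * v) * (of_int c * u)"
    using 1 2 by (simp add: algebra_simps)
  hence "((e - of_int a) * (e - of_int d) - of_int b * of_int c) * (u * v) = 0"
    by (simp add: algebra_simps)
  hence "(e - of_int a) * (e - of_int d) - of_int b * of_int c = 0" using nz by simp
  hence "e\<^sup>2 - of_int (a + d) * e + of_int (a * d - b * c) = 0"
    by (simp add: power2_eq_square algebra_simps)
  hence "algebraic_int e" by (rule algebraic_int_quadratic)
  moreover have "e \<in> K"
  proof -
    have u: "u \<in> K" "e * u \<in> K"
      using \<open>e * u \<in> lat u v\<close> lat_generators(1)[of u v] is_idealD(1)[OF J] OK_subset_K uv(1) by blast+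
    have "(e * u) * inverse u = e" using nz by simp
    then show ?thesis using K_mult[OF u(2) K_inverse[OF u(1)]] by (simp only:)
  qed
  ultimately show ?thesis using ring_of_integers_eq unfolding ring_of_integers_def by blast
qed

lemma scale_eq_self_imp:
  assumes J: "is_ideal J" and e: "e \<noteq> 0" "scale e J = J"
  shows "e = 1 \<or> e = -1"
proof (rule units_of_norm_one)
  show "e \<in> OK" by (rule multiplier_in_OK[OF J]) (use e(2) in simp)
  have "(norm e)\<^sup>2 * ideal_norm J = ideal_norm J" using ideal_norm_scale[OF J e(1)] e(2) by simp
  hence "(norm e)\<^sup>2 = 1" using ideal_norm_pos[OF J] by simp
  then show "norm e = 1" by (simp add: power2_eq_1_iff) (smt (verit) norm_ge_zero)
qed

lemma scale_is_ideal:
  assumes J: "is_ideal J" and c: "c \<noteq> 0" and sub: "scale c J \<subseteq> OK"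
  shows "is_ideal (scale c J)"
proof -
  note Jd = is_idealD[OF J]
  obtain z where z: "z \<in> J" "z \<noteq> 0" by (rule ideal_nonzero_element[OF J])
  have "c * z \<in> scale c J" "c * z \<noteq> 0" using z c by auto
  hence "scale c J \<noteq> {0}" by blast
  moreover have "0 \<in> scale c J" using Jd(3) by (metis image_eqI mult_zero_right)
  moreover have "a + b \<in> scale c J" if ab: "a \<in> scale c J" "b \<in> scale c J" for a b
  proof -
    obtain a' b' where "a = c * a'" "b = c * b'" "a' \<in> J" "b' \<in> J" using ab by blast
    then have "a + b = c * (a' + b')" "a' + b' \<in> J" using Jd(4) by (simp_all add: algebra_simps)
    then show ?thesis by blast
  qed
  moreover have "r * a \<in> scale c J" if ra: "r \<in> OK" "a \<in> scale c J" for r a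
  proof -
    obtain a' where "a = c * a'" "a' \<in> J" using ra by blast
    then have "r * a = c * (r * a')" "r * a' \<in> J" using Jd(5)[OF ra(1)] by (simp_all add: algebra_simps)
    then show ?thesis by blast
  qed
  ultimately show ?thesis unfolding is_ideal_def using sub by blast
qed

text \<open>The ideals of a class are the multiples \<open>c J\<close> with \<open>c\<close> in the inverse of \<open>J\<close>; this
  inverse is again a lattice, being a multiple of an ideal.\<close>

definition colon :: "complex set \<Rightarrow> complex set" where
  "colon J = {c. \<forall>z\<in>J. c * z \<in> OK}"

lemma colon_lattice:
  assumes J: "is_ideal J"
  obtains u v where "colon J = lat u v" "Im (cnj u * v) \<noteq> 0"
proof -
  obtain z where z: "z \<in> J" "z \<noteq> 0" by (rule ideal_nonzero_element[OF J])
  have "1 \<in> colon J" using is_idealD(1)[OF J] unfolding colon_def by auto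
  have I: "is_ideal (scale z (colon J))"
    unfolding is_ideal_def
  proof (intro conjI ballI)
    show "scale z (colon J) \<subseteq> OK" using z(1) unfolding colon_def by (auto simp: mult.commute)
    have "z * 1 \<in> scale z (colon J)" using \<open>1 \<in> colon J\<close> by blast
    then show "scale z (colon J) \<noteq> {0}" using z(2) by auto
    have "0 \<in> colon J" unfolding colon_def using OK_of_int[of 0] by simp
    then show "0 \<in> scale z (colon J)" by (metis image_eqI mult_zero_right)
  next
    fix a b assume "a \<in> scale z (colon J)" "b \<in> scale z (colon J)"
    then obtain a' b' where ab: "a = z * a'" "b = z * b'" "a' \<in> colon J" "b' \<in> colon J" by blast
    have "a' + b' \<in> colon J" using ab(3,4) OK_add unfolding colon_def by (simp add: distrib_right)
    moreover have "a + b = z * (a' + b')" using ab by (simp add: algebra_simps)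
    ultimately show "a + b \<in> scale z (colon J)" by blast
  next
    fix r a assume r: "r \<in> OK" and "a \<in> scale z (colon J)"
    then obtain a' where a: "a = z * a'" "a' \<in> colon J" by blast
    have "r * a' \<in> colon J" using a(2) OK_mult[OF r] unfolding colon_def by (simp add: mult.assoc)
    moreover have "r * a = z * (r * a')" using a by (simp add: algebra_simps)
    ultimately show "r * a \<in> scale z (colon J)" by blast
  qed
  obtain u v where uv: "scale z (colon J) = lat u v" "Im (cnj u * v) \<noteq> 0" by (rule ideal_is_lattice[OF I])
  have "colon J = scale (inverse z) (lat u v)"
    unfolding uv(1)[symmetric] scale_scale using z(2) by simp
  hence "colon J = lat (inverse z * u) (inverse z * v)" by (simp only: scale_lat)
  moreover have "Im (cnj (inverse z * u) * (inverse z * v)) \<noteq> 0"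
  proof -
    have "cnj (inverse z * u) * (inverse z * v) = (inverse z * cnj (inverse z)) * (cnj u * v)" by simp
    also have "\<dots> = of_real ((norm (inverse z))\<^sup>2) * (cnj u * v)"
      by (simp only: complex_norm_square)
    finally have "Im (cnj (inverse z * u) * (inverse z * v)) = (norm (inverse z))\<^sup>2 * Im (cnj u * v)"
      by (simp only: Im_complex_of_real Re_complex_of_real times_complex.sel)
    then show ?thesis using z(2) uv(2) by simp
  qed
  ultimately show ?thesis by (rule that)
qed

text \<open>One element out of each pair \<open>c\<close>, \<open>- c\<close> of nonzero complex numbers.\<close>

definition upper_half :: "complex set" where
  "upper_half = {c. Re c > 0 \<or> (Re c = 0 \<and> Im c > 0)}"

lemma upper_half: "c \<noteq> 0 \<Longrightarrow> c \<in> upper_half \<longleftrightarrow> - c \<notin> upper_half" "0 \<notin> upper_half"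
  by (auto simp: upper_half_def complex_eq_iff)

text \<open>Two numbers \<open>c\<close> and \<open>d\<close> give the same ideal only if their quotient is a unit, that is, if
  \<open>d = c\<close> or \<open>d = - c\<close>.\<close>

lemma ideal_class_parametrization:
  assumes J: "is_ideal J"
  shows "bij_betw (\<lambda>c. scale c J) (colon J \<inter> upper_half) (ideal_class J)"
proof (rule bij_betw_imageI)
  show "inj_on (\<lambda>c. scale c J) (colon J \<inter> upper_half)"
  proof (rule inj_onI)
    fix c d assume c: "c \<in> colon J \<inter> upper_half" and d: "d \<in> colon J \<inter> upper_half"
      and eq: "scale c J = scale d J"
    have nz: "c \<noteq> 0" "d \<noteq> 0" using c d upper_half(2) by auto
    have "J = scale (d / c) J" by (rule scale_cancel[OF nz(1) eq])
    hence "d / c = 1 \<or> d / c = -1" using scale_eq_self_imp[OF J, of "d / c"] nz by simp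
    hence "d = c \<or> d = - c" using nz by (auto simp: field_simps)
    then show "c = d" using c d upper_half(1)[OF nz(1)] by auto
  qed
  show "(\<lambda>c. scale c J) ` (colon J \<inter> upper_half) = ideal_class J"
  proof (intro equalityI subsetI)
    fix I assume "I \<in> (\<lambda>c. scale c J) ` (colon J \<inter> upper_half)"
    then obtain c where c: "I = scale c J" "c \<in> colon J" "c \<in> upper_half" by blast
    have "c \<noteq> 0" using c upper_half(2) by auto
    moreover have "scale c J \<subseteq> OK" using c(2) unfolding colon_def by blast
    ultimately show "I \<in> ideal_class J"
      unfolding ideal_class_def c(1) using scale_is_ideal[OF J] by blast
  next
    fix I assume "I \<in> ideal_class J"
    then obtain c where c: "is_ideal I" "c \<noteq> 0" "I = scale c J" unfolding ideal_class_def by blast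
    have cJ: "c * z \<in> OK" if "z \<in> J" for z using is_idealD(1)[OF c(1)] that unfolding c(3) by blast
    hence "c \<in> colon J" "- c \<in> colon J" unfolding colon_def using OK_minus by auto
    moreover have "scale (- c) J = scale c J"
    proof -
      have "scale (-1) J = J"
      proof -
        have neg: "scale (-1) J \<subseteq> J" using is_idealD(6)[OF J, of _ "-1"] by auto
        hence "scale (-1) (scale (-1) J) \<subseteq> scale (-1) J" by blast
        hence "J \<subseteq> scale (-1) J" unfolding scale_scale by simp
        with neg show ?thesis by blast
      qed
      then show ?thesis using scale_scale[of c "-1" J] by simp
    qed
    ultimately show "I \<in> (\<lambda>c. scale c J) ` (colon J \<inter> upper_half)"
      using upper_half(1)[OF c(2)] c(3) by (metis Int_iff image_eqI)
  qed
qed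

lemma lattice_point_bij:
  assumes "Im (cnj u * v) \<noteq> 0" shows "bij_betw (lattice_point u v) UNIV (lat u v)"
  unfolding lat_def
proof (rule inj_on_imp_bij_betw, rule injI)
  fix p q assume pq: "lattice_point u v p = lattice_point u v q"
  obtain \<kappa> where k: "\<kappa> > 0"
    "\<And>x y. norm (lattice_point u v (x, y)) \<ge> \<kappa> * (\<bar>real_of_int x\<bar> + \<bar>real_of_int y\<bar>)"
    using lattice_norm_lower_bound[OF assms] by blast
  have "lattice_point u v (fst p - fst q, snd p - snd q) = 0"
    using pq by (simp add: lattice_point_def case_prod_unfold algebra_simps)
  hence "\<kappa> * (\<bar>real_of_int (fst p - fst q)\<bar> + \<bar>real_of_int (snd p - snd q)\<bar>) \<le> 0"
    using k(2)[of "fst p - fst q" "snd p - snd q"] by simp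
  hence "\<bar>real_of_int (fst p - fst q)\<bar> + \<bar>real_of_int (snd p - snd q)\<bar> \<le> 0"
    using k(1) by (simp add: mult_le_0_iff)
  hence "real_of_int (fst p - fst q) = 0 \<and> real_of_int (snd p - snd q) = 0" by linarith
  then show "p = q" by (simp add: prod_eq_iff)
qed

text \<open>The partial zeta function of a class, in the form of a theta series: half of the theta
  series of a lattice, without the term of the origin. This missing term contributes the
  constant \<open>-1/2\<close>, which is the same for every class.\<close>

theorem ideal_class_theta:
  assumes J: "is_ideal J"
  shows "\<And>t. t > 0 \<Longrightarrow> (\<lambda>I. exp (- t * ideal_norm I)) summable_on ideal_class J"
    and "\<exists>A. (\<lambda>k. infsum (\<lambda>I. exp (- ideal_norm I / 4 ^ k)) (ideal_class J) - A * 4 ^ k) \<longlonglongrightarrow> - 1 / 2"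
proof -
  obtain u v where uv: "colon J = lat u v" "Im (cnj u * v) \<noteq> 0" by (rule colon_lattice[OF J])
  define \<kappa> where "\<kappa> = sqrt (ideal_norm J)"
  have \<kappa>: "\<kappa> > 0" "\<kappa>\<^sup>2 = ideal_norm J" using ideal_norm_pos[OF J] by (auto simp: \<kappa>_def)
  define \<Theta> where "\<Theta> = (\<lambda>t. infsum (\<lambda>p. gaussian (sqrt t * \<kappa>) (lattice_point u v p)) UNIV)"
  let ?H = "colon J \<inter> upper_half"
  have main: "((\<lambda>I. exp (- t * ideal_norm I)) has_sum ((\<Theta> t - 1) / 2)) (ideal_class J)" if t: "t > 0" for t
  proof -
    let ?g = "gaussian (sqrt t * \<kappa>)"
    have "((\<lambda>p. ?g (lattice_point u v p)) has_sum \<Theta> t) UNIV"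
      unfolding \<Theta>_def using gaussian_lattice_summable[OF uv(2), of "sqrt t * \<kappa>" 0] t \<kappa>
      by (intro has_sum_infsum) simp
    hence all: "(?g has_sum \<Theta> t) (colon J)"
      unfolding uv(1) using has_sum_reindex_bij_betw[OF lattice_point_bij[OF uv(2)]] by blast
    have neg: "- c \<in> colon J \<longleftrightarrow> c \<in> colon J" for c
    proof -
      have "- c \<in> colon J" if "c \<in> colon J" for c using that OK_minus unfolding colon_def by auto
      from this[of c] this[of "- c"] show ?thesis by auto
    qed
    have sH: "?g summable_on ?H"
      by (rule summable_on_subset_banach[OF has_sum_imp_summable[OF all]]) auto
    define s where "s = infsum ?g ?H"
    have 1: "(?g has_sum s) ?H" unfolding s_def using sH by (rule has_sum_infsum)
    have bijneg: "bij_betw uminus ?H (uminus ` ?H)" by (rule inj_on_imp_bij_betw) (simp add: inj_on_def)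
    have "(\<lambda>c. ?g (- c)) = ?g" by (simp add: gaussian_def fun_eq_iff)
    hence "((\<lambda>c. ?g (- c)) has_sum s) ?H" using 1 by (simp only:)
    hence 2: "(?g has_sum s) (uminus ` ?H)" using has_sum_reindex_bij_betw[OF bijneg, of ?g s] by blast
    have 0: "(?g has_sum ?g 0) {0}" using has_sum_finite[of "{0}" ?g] by simp
    have U: "colon J = insert 0 (?H \<union> uminus ` ?H)"
    proof (intro equalityI subsetI)
      fix c assume "c \<in> colon J"
      then have "c = 0 \<or> c \<in> ?H \<or> - c \<in> ?H" using neg[of c] upper_half(1)[of c] by auto
      then show "c \<in> insert 0 (?H \<union> uminus ` ?H)" by (metis Un_iff image_eqI insert_iff minus_minus)
    next
      have "0 \<in> colon J" unfolding colon_def using OK_of_int[of 0] by simp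
      then show "c \<in> colon J" if "c \<in> insert 0 (?H \<union> uminus ` ?H)" for c using that neg by auto
    qed
    have disj: "?H \<inter> uminus ` ?H = {}" 
    proof -
      have False if "y \<in> upper_half" "- y \<in> upper_half" for y
        using that upper_half(1)[of y] upper_half(2) by auto
      then show ?thesis by blast
    qed
    have "0 \<notin> ?H \<union> uminus ` ?H" using upper_half(2) by auto
    hence "{0} \<inter> (?H \<union> uminus ` ?H) = {}" by blast
    note un = has_sum_Un_disjoint[OF 0 has_sum_Un_disjoint[OF 1 2 disj] this]
    have "{0} \<union> (?H \<union> uminus ` ?H) = colon J" using U by simp
    hence "(?g has_sum (?g 0 + (s + s))) (colon J)" using un by (simp only:)
    hence "\<Theta> t = 1 + (s + s)" using has_sum_unique[OF all] by (simp add: gaussian_def)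
    hence s: "s = (\<Theta> t - 1) / 2" by simp
    have "exp (- t * ideal_norm (scale c J)) = ?g c" if "c \<in> ?H" for c
    proof -
      have "c \<noteq> 0" using that upper_half(2) by auto
      then show ?thesis unfolding ideal_norm_scale[OF J \<open>c \<noteq> 0\<close>] using \<kappa>(2) t
        by (simp add: gaussian_def power_mult_distrib)
    qed
    hence "((\<lambda>c. exp (- t * ideal_norm (scale c J))) has_sum s) ?H"
      using 1 has_sum_cong[of ?H "\<lambda>c. exp (- t * ideal_norm (scale c J))" ?g s] by blast
    hence "((\<lambda>I. exp (- t * ideal_norm I)) has_sum s) (ideal_class J)"
      using has_sum_reindex_bij_betw[OF ideal_class_parametrization[OF J], of "\<lambda>I. exp (- t * ideal_norm I)" s]
      by blast
    then show ?thesis unfolding s .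
  qed
  show "(\<lambda>I. exp (- t * ideal_norm I)) summable_on ideal_class J" if "t > 0" for t
    using main[OF that] by (rule has_sum_imp_summable)
  have d: "Im (cnj (of_real \<kappa> * u) * (of_real \<kappa> * v)) \<noteq> 0"
  proof -
    have "cnj (of_real \<kappa> * u) * (of_real \<kappa> * v) = of_real (\<kappa>\<^sup>2) * (cnj u * v)"
      by (simp add: power2_eq_square algebra_simps)
    hence "Im (cnj (of_real \<kappa> * u) * (of_real \<kappa> * v)) = \<kappa>\<^sup>2 * Im (cnj u * v)"
      by (simp only: Im_complex_of_real Re_complex_of_real times_complex.sel)
    then show ?thesis using uv(2) \<kappa>(1) by simp
  qed
  obtain c where c: "(\<lambda>k. infsum (\<lambda>p. exp (- ((norm (lattice_point (of_real \<kappa> * u) (of_real \<kappa> * v) p))\<^sup>2 / 4 ^ k))) UNIV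
      - c * 4 ^ k) \<longlonglongrightarrow> 0"
    using lattice_theta_asymptotics[OF d] by blast
  have \<Theta>: "infsum (\<lambda>p. exp (- ((norm (lattice_point (of_real \<kappa> * u) (of_real \<kappa> * v) p))\<^sup>2 / 4 ^ k))) UNIV
      = \<Theta> (1 / 4 ^ k)" for k
  proof -
    have "exp (- ((norm (lattice_point (of_real \<kappa> * u) (of_real \<kappa> * v) p))\<^sup>2 / 4 ^ k))
        = gaussian (sqrt (1 / 4 ^ k) * \<kappa>) (lattice_point u v p)" for p
    proof -
      have "lattice_point (of_real \<kappa> * u) (of_real \<kappa> * v) p = of_real \<kappa> * lattice_point u v p"
        by (simp add: lattice_point_def case_prod_unfold algebra_simps)
      hence "norm (lattice_point (of_real \<kappa> * u) (of_real \<kappa> * v) p) = \<kappa> * norm (lattice_point u v p)"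
        using \<kappa>(1) by (simp add: norm_mult)
      moreover have "(sqrt (1 / 4 ^ k) * \<kappa> * norm (lattice_point u v p))\<^sup>2
          = (\<kappa> * norm (lattice_point u v p))\<^sup>2 / 4 ^ k"
        by (simp add: power_mult_distrib)
      ultimately show ?thesis by (simp only: gaussian_def)
    qed
    then show ?thesis unfolding \<Theta>_def by simp
  qed
  have "infsum (\<lambda>I. exp (- ideal_norm I / 4 ^ k)) (ideal_class J) = (\<Theta> (1 / 4 ^ k) - 1) / 2" for k
    using infsumI[OF main[of "1 / 4 ^ k"]] by simp
  moreover have "(\<lambda>k. (\<Theta> (1 / 4 ^ k) - c * 4 ^ k - 1) / 2) \<longlonglongrightarrow> (0 - 1) / 2"
    using c unfolding \<Theta> by (intro tendsto_divide tendsto_diff tendsto_const) auto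
  moreover have "(\<Theta> (1 / 4 ^ k) - 1) / 2 - c / 2 * 4 ^ k = (\<Theta> (1 / 4 ^ k) - c * 4 ^ k - 1) / 2" for k
    by (simp add: field_simps)
  ultimately have "(\<lambda>k. infsum (\<lambda>I. exp (- ideal_norm I / 4 ^ k)) (ideal_class J) - c / 2 * 4 ^ k) \<longlonglongrightarrow> - 1 / 2"
    by (simp only: diff_0)
  then show "\<exists>A. (\<lambda>k. infsum (\<lambda>I. exp (- ideal_norm I / 4 ^ k)) (ideal_class J) - A * 4 ^ k) \<longlonglongrightarrow> - 1 / 2"
    by blast
qed

end

section \<open>Finiteness of the class number\<close>

lemma lat_commute: "lat u v = lat v u"
proof -
  have "lat u v \<subseteq> lat v u" for u v
  proof
    fix z assume "z \<in> lat u v"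
    then obtain x y where "z = of_int x * u + of_int y * v" by (rule lat_E)
    then have "z = of_int y * v + of_int x * u" by simp
    then show "z \<in> lat v u" by (simp only: lat_I)
  qed
  then show ?thesis by blast
qed

lemma lat_add_multiple: "lat u (v + of_int k * u) = lat u v"
proof -
  have sub: "lat u (v + of_int k * u) \<subseteq> lat u v" for v k
  proof
    fix z assume "z \<in> lat u (v + of_int k * u)"
    then obtain x y where "z = of_int x * u + of_int y * (v + of_int k * u)" by (rule lat_E)
    then have "z = of_int (x + y * k) * u + of_int y * v" by (simp add: algebra_simps)
    then show "z \<in> lat u v" by (simp only: lat_I)
  qed
  have "lat u (v + of_int k * u + of_int (- k) * u) \<subseteq> lat u (v + of_int k * u)" by (rule sub)
  with sub[of v k] show ?thesis by simp
qed

lemma lat_minus: "lat u (- v) = lat u v"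
proof -
  have "lat u (- v) \<subseteq> lat u v" for v
  proof
    fix z assume "z \<in> lat u (- v)"
    then obtain x y where "z = of_int x * u + of_int y * (- v)" by (rule lat_E)
    then have "z = of_int x * u + of_int (- y) * v" by simp
    then show "z \<in> lat u v" by (simp only: lat_I)
  qed
  from this[of v] this[of "- v"] show ?thesis by simp
qed

context imaginary_quadratic begin

definition ideal_classes :: "complex set set set" where
  "ideal_classes = ideal_class ` {J. is_ideal J}"

lemma ideal_class_self: "is_ideal J \<Longrightarrow> J \<in> ideal_class J"
  unfolding ideal_class_def using scale_1[of J] by (metis (mono_tags, lifting) mem_Collect_eq zero_neq_one)

lemma ideal_class_eq:
  assumes "I \<in> ideal_class J" shows "ideal_class I = ideal_class J"
proof -
  obtain c where c: "c \<noteq> 0" "I = scale c J" using assms unfolding ideal_class_def by blast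
  have sub: "ideal_class (scale c J) \<subseteq> ideal_class J" if "c \<noteq> 0" for c J
  proof
    fix L assume "L \<in> ideal_class (scale c J)"
    then obtain d where d: "is_ideal L" "d \<noteq> 0" "L = scale d (scale c J)" unfolding ideal_class_def by blast
    hence "L = scale (d * c) J" by (simp only: scale_scale)
    moreover have "d * c \<noteq> 0" using d that by simp
    ultimately show "L \<in> ideal_class J" unfolding ideal_class_def using d(1) by blast
  qed
  have "scale (inverse c) I = J" unfolding c(2) scale_scale using c(1) by simp
  hence "ideal_class J \<subseteq> ideal_class I" using sub[of "inverse c" I] c(1) by simp
  moreover have "ideal_class I \<subseteq> ideal_class J" unfolding c(2) by (rule sub[OF c(1)])
  ultimately show ?thesis by blast
qed

lemma std_ideal_1: assumes "a > 0" shows "lat (of_int a) (of_int b + omega) = std_ideal 1 a (b mod a)"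
proof -
  have "of_int b = (of_int (b mod a) + of_int (b div a) * of_int a :: complex)"
    by (metis div_mult_mod_eq add.commute of_int_add of_int_mult)
  hence "of_int b + omega = (of_int (b mod a) + omega) + of_int (b div a) * of_int a" by simp
  then show ?thesis unfolding std_ideal_def by (simp only: lat_add_multiple mult_1 of_int_1)
qed

text \<open>In the class of \<open>J\<close>, choose an ideal \<open>a\<int> + (b + \<omega>)\<int>\<close> with \<open>a\<close> as small as possible.
  Multiplying it with \<open>cnj (b + \<omega>) / a\<close> replaces \<open>a\<close> by \<open>c = N (b + \<omega>) / a\<close>, so \<open>a \<le> c\<close>;
  as \<open>b\<close> may be reduced modulo \<open>a\<close>, this bounds \<open>a\<close>.\<close>

lemma ideal_class_reduced:
  assumes J: "is_ideal J"
  shows "\<exists>a b. 0 < a \<and> a \<le> N \<and> b \<in> roots a \<and> ideal_class J = ideal_class (std_ideal 1 a b)"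
proof -
  define P where "P = (\<lambda>a. a > 0 \<and> (\<exists>b\<in>roots a. std_ideal 1 a b \<in> ideal_class J))"
  have "\<exists>n. P (int n)"
  proof -
    obtain g a b where gab: "g > 0" "a > 0" "b \<in> roots a" "J = std_ideal g a b"
      using ideal_eq_std_ideal[OF J] by blast
    have "scale (inverse (of_int g)) J = std_ideal 1 a b"
      unfolding gab(4) std_ideal_def scale_lat using gab(1) by (simp flip: mult.assoc)
    moreover have "is_ideal (std_ideal 1 a b)" using std_ideal_is_ideal gab by simp
    moreover have "inverse (of_int g) \<noteq> (0::complex)" using gab(1) by simp
    ultimately have "std_ideal 1 a b \<in> ideal_class J" unfolding ideal_class_def by blast
    hence "P a" unfolding P_def using gab by blast
    then show ?thesis using gab(2) by (metis zero_le_imp_eq_int less_imp_le)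
  qed
  define n where "n = (LEAST n. P (int n))"
  define a where "a = int n"
  have "P a" unfolding a_def n_def by (rule LeastI_ex) fact
  then obtain b where b: "a > 0" "b \<in> roots a" "std_ideal 1 a b \<in> ideal_class J" unfolding P_def by blast
  have minimal: "a \<le> c" if "P c" for c
  proof -
    have "c > 0" using that unfolding P_def by blast
    hence "int (nat c) = c" by simp
    hence "n \<le> nat c" unfolding n_def using that by (intro Least_le) simp
    then show ?thesis using \<open>c > 0\<close> unfolding a_def by linarith
  qed
  \<comment> \<open>Division with a remainder that is smallest in absolute value: \<open>|2 b' + T| \<le> a\<close>.\<close>
  define q where "q = (2 * b + T + a) div (2 * a)"
  define b' where "b' = b - a * q"
  have "2 * b' + T + a = (2 * b + T + a) mod (2 * a)"
    unfolding b'_def q_def by (simp add: minus_mult_div_eq_mod[symmetric] algebra_simps)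
  moreover have "0 \<le> (2 * b + T + a) mod (2 * a)" "(2 * b + T + a) mod (2 * a) < 2 * a" using b(1) by simp_all
  ultimately have "\<bar>2 * b' + T\<bar> \<le> a" by linarith
  hence sq: "(2 * b' + T)\<^sup>2 \<le> a\<^sup>2" using b(1) by (metis abs_le_square_iff abs_of_pos)
  have b'b: "b' mod a = b" unfolding b'_def using rootsD(2)[OF b(2)] mod_mult_self2[of b a "- q"] by simp
  have L: "std_ideal 1 a b = lat (of_int a) (of_int b' + omega)" using std_ideal_1[OF b(1)] b'b by simp
  have "a dvd norm_form b'"
  proof (rule norm_form_dvd_cong[OF _ rootsD(1)[OF b(2)]])
    show "[b = b'] (mod a)" unfolding Cong.cong_def using b'b rootsD(2)[OF b(2)] by simp
  qed
  then obtain c where c: "norm_form b' = a * c" by blast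
  have "a * c > 0" using norm_form_pos[of b'] c by simp
  hence c0: "c > 0" using b(1) by (simp add: zero_less_mult_iff)
  \<comment> \<open>The conjugate root: \<open>d + \<omega>\<close> is minus the conjugate of \<open>b' + \<omega>\<close>.\<close>
  define d where "d = - b' - T"
  have nd: "norm_form d = a * c" using norm_form_diff[of d b'] c by (simp add: d_def)
  have conj: "(of_int b' + omega) * (of_int d + omega) = - of_int (a * c)"
    using conj_identity[of b'] c by (simp add: d_def algebra_simps)
  have bo: "of_int b' + omega \<noteq> 0" using omega_nonreal[of "of_int b'" 1 0 0] by simp
  have do: "of_int d + omega \<noteq> 0" using omega_nonreal[of "of_int d" 1 0 0] by simp
  have a_nz: "of_int a \<noteq> (0::complex)" using b(1) by simp
  have "scale ((of_int d + omega) / of_int a) (std_ideal 1 a b) = lat (of_int d + omega) (- of_int c)"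
  proof -
    have "(of_int d + omega) / of_int a * of_int a = of_int d + omega" using a_nz by simp
    moreover have "(of_int d + omega) / of_int a * (of_int b' + omega) = - of_int c"
      using conj a_nz by (simp add: field_simps)
    ultimately show ?thesis unfolding L scale_lat by (simp only:)
  qed
  also have "\<dots> = lat (of_int c) (of_int d + omega)" by (metis lat_commute lat_minus)
  also have "\<dots> = std_ideal 1 c (d mod c)" by (rule std_ideal_1[OF c0])
  finally have sc: "scale ((of_int d + omega) / of_int a) (std_ideal 1 a b) = std_ideal 1 c (d mod c)" .
  have dc: "d mod c \<in> roots c" by (rule mod_in_roots[OF c0]) (simp add: nd)
  have "std_ideal 1 c (d mod c) \<in> ideal_class (std_ideal 1 a b)"
  proof -
    have "is_ideal (std_ideal 1 c (d mod c))" by (rule std_ideal_is_ideal[OF _ c0 dc]) simp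
    moreover have "(of_int d + omega) / of_int a \<noteq> 0" using do a_nz by simp
    ultimately show ?thesis unfolding ideal_class_def using sc by (metis (mono_tags, lifting) mem_Collect_eq)
  qed
  hence "P c" unfolding P_def ideal_class_eq[OF b(3)] using c0 dc by blast
  hence "a \<le> c" by (rule minimal)
  hence "a * a \<le> a * c" using b(1) by simp
  moreover have "4 * (a * c) = (2 * b' + T)\<^sup>2 - D" using four_norm_form[of b'] c by simp
  \<comment> \<open>\<open>4 a\<^sup>2 \<le> 4 a c = (2 b' + T)\<^sup>2 + N \<le> a\<^sup>2 + N\<close>\<close>
  ultimately have "3 * a\<^sup>2 \<le> N" using sq by (simp add: power2_eq_square)
  moreover have "a * 1 \<le> a * a" using b(1) by (intro mult_left_mono) auto
  ultimately have "a \<le> N" using b(1) unfolding power2_eq_square by linarith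
  then show ?thesis using b ideal_class_eq[OF b(3)] by blast
qed

lemma finite_ideal_classes: "finite ideal_classes"
proof (rule finite_subset)
  show "ideal_classes \<subseteq> (\<lambda>(a, b). ideal_class (std_ideal 1 a b)) ` ({0..N} \<times> {0..N})"
  proof
    fix Z assume "Z \<in> ideal_classes"
    then obtain J where J: "is_ideal J" "Z = ideal_class J" unfolding ideal_classes_def by blast
    obtain a b where ab: "0 < a" "a \<le> N" "b \<in> roots a" "Z = ideal_class (std_ideal 1 a b)"
      using ideal_class_reduced[OF J(1)] J(2) by blast
    have "b \<in> {0..N}" "a \<in> {0..N}" using ab(1,2,3) unfolding roots_def by auto
    hence "(a, b) \<in> {0..N} \<times> {0..N}" by blast
    then show "Z \<in> (\<lambda>(a, b). ideal_class (std_ideal 1 a b)) ` ({0..N} \<times> {0..N})"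
      using ab(4) by (intro image_eqI[of _ _ "(a, b)"]) simp_all
  qed
qed (intro finite_imageI finite_cartesian_product; simp)

lemma ideal_classes_partition:
  "\<Union>ideal_classes = {J. is_ideal J}" "Z \<in> ideal_classes \<Longrightarrow> Y \<in> ideal_classes \<Longrightarrow> Z \<noteq> Y \<Longrightarrow> Z \<inter> Y = {}"
proof -
  show "\<Union>ideal_classes = {J. is_ideal J}"
  proof (intro equalityI subsetI)
    fix I assume "I \<in> \<Union>ideal_classes"
    then obtain J where "I \<in> ideal_class J" unfolding ideal_classes_def by blast
    then show "I \<in> {J. is_ideal J}" unfolding ideal_class_def by simp
  next
    fix I assume "I \<in> {J. is_ideal J}"
    hence I: "is_ideal I" by simp
    hence "ideal_class I \<in> ideal_classes" unfolding ideal_classes_def by simp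
    then show "I \<in> \<Union>ideal_classes" using ideal_class_self[OF I] by (rule UnionI)
  qed
  show "Z \<inter> Y = {}" if ZY: "Z \<in> ideal_classes" "Y \<in> ideal_classes" "Z \<noteq> Y" for Z Y
  proof (rule ccontr)
    assume "Z \<inter> Y \<noteq> {}"
    then obtain I where I: "I \<in> Z" "I \<in> Y" by blast
    obtain J L where "Z = ideal_class J" "Y = ideal_class L" using ZY unfolding ideal_classes_def by blast
    then show False using ideal_class_eq I ZY(3) by metis
  qed
qed

text \<open>Summing the theta series over the classes: each class contributes the constant \<open>-1/2\<close>,
  so the constant term counts the classes.\<close>

theorem zeta_asymptotics_classes:
  shows "\<And>t. t > 0 \<Longrightarrow> (\<lambda>I. exp (- t * ideal_norm I)) summable_on {I. is_ideal I}"
    and "\<exists>A. (\<lambda>k. infsum (\<lambda>I. exp (- ideal_norm I / 4 ^ k)) {I. is_ideal I} - A * 4 ^ k)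
        \<longlonglongrightarrow> - real (card ideal_classes) / 2"
proof -
  have cl: "\<exists>J. is_ideal J \<and> Z = ideal_class J" if "Z \<in> ideal_classes" for Z
    using that unfolding ideal_classes_def by blast
  have sum: "((\<lambda>I. exp (- t * ideal_norm I)) has_sum
      (\<Sum>Z\<in>ideal_classes. infsum (\<lambda>I. exp (- t * ideal_norm I)) Z)) {I. is_ideal I}" if t: "t > 0" for t
  proof -
    have 1: "((\<lambda>I. exp (- t * ideal_norm I)) has_sum infsum (\<lambda>I. exp (- t * ideal_norm I)) Z) Z"
      if Z: "Z \<in> ideal_classes" for Z
      using cl[OF Z] ideal_class_theta(1)[OF _ t] by (blast intro: has_sum_infsum)
    have "((\<lambda>I. exp (- t * ideal_norm I)) has_sum
        (\<Sum>Z\<in>S. infsum (\<lambda>I. exp (- t * ideal_norm I)) Z)) (\<Union> S)"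
      if S: "finite S" "S \<subseteq> ideal_classes" for S
      using S
    proof (induction S rule: finite_induct)
      case (insert Z S)
      have "Z \<inter> \<Union>S = {}" using insert ideal_classes_partition(2)[of Z] by fastforce
      with insert 1[of Z] show ?case by (auto intro: has_sum_Un_disjoint)
    qed simp
    from this[OF finite_ideal_classes subset_refl] show ?thesis by (simp only: ideal_classes_partition(1))
  qed
  then show "(\<lambda>I. exp (- t * ideal_norm I)) summable_on {I. is_ideal I}" if "t > 0" for t
    using that by (blast intro: has_sum_imp_summable)
  have "\<forall>Z\<in>ideal_classes. \<exists>A. (\<lambda>k. infsum (\<lambda>I. exp (- ideal_norm I / 4 ^ k)) Z - A * 4 ^ k) \<longlonglongrightarrow> - 1 / 2"
    using cl ideal_class_theta(2) by blast
  from bchoice[OF this] obtain A where A: "\<And>Z. Z \<in> ideal_classes \<Longrightarrow>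
      (\<lambda>k. infsum (\<lambda>I. exp (- ideal_norm I / 4 ^ k)) Z - A Z * 4 ^ k) \<longlonglongrightarrow> - 1 / 2"
    by blast
  have "(\<lambda>k. \<Sum>Z\<in>ideal_classes. infsum (\<lambda>I. exp (- ideal_norm I / 4 ^ k)) Z - A Z * 4 ^ k)
      \<longlonglongrightarrow> (\<Sum>Z\<in>ideal_classes. - 1 / 2)"
    by (rule tendsto_sum) (rule A)
  moreover have "(\<Sum>Z\<in>ideal_classes. infsum (\<lambda>I. exp (- ideal_norm I / 4 ^ k)) Z - A Z * 4 ^ k)
      = infsum (\<lambda>I. exp (- ideal_norm I / 4 ^ k)) {I. is_ideal I} - (\<Sum>Z\<in>ideal_classes. A Z) * 4 ^ k" for k
  proof -
    have p: "(0::real) < 1 / 4 ^ k" by simp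
    have e: "- (1 / 4 ^ k) * x = - x / 4 ^ k" for x :: real by simp
    have "infsum (\<lambda>I. exp (- ideal_norm I / 4 ^ k)) {I. is_ideal I}
        = (\<Sum>Z\<in>ideal_classes. infsum (\<lambda>I. exp (- ideal_norm I / 4 ^ k)) Z)"
      by (rule infsumI[OF sum[OF p], unfolded e])
    then show ?thesis by (simp only: sum_subtractf sum_distrib_right)
  qed
  moreover have "(\<Sum>Z\<in>ideal_classes. - 1 / 2) = - real (card ideal_classes) / 2" by simp
  ultimately show "\<exists>A. (\<lambda>k. infsum (\<lambda>I. exp (- ideal_norm I / 4 ^ k)) {I. is_ideal I} - A * 4 ^ k)
        \<longlonglongrightarrow> - real (card ideal_classes) / 2" by (intro exI) (simp only:)
qed

end

section \<open>The class group as a set of orbits\<close>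

lemma complex_subring_simps [simp]:
  "carrier (complex_subring A) = A" "x \<otimes>\<^bsub>complex_subring A\<^esub> y = x * y"
  "x \<oplus>\<^bsub>complex_subring A\<^esub> y = x + y" "\<zero>\<^bsub>complex_subring A\<^esub> = 0" "\<one>\<^bsub>complex_subring A\<^esub> = 1"
  by (simp_all add: complex_subring_def ring_of_type_algebra_def)

context imaginary_quadratic begin

lemma ring_OK: "ring (complex_subring OK)"
proof -
  interpret R: ring "ring_of_type_algebra :: complex ring" by (rule ring_from_type_algebra)
  have neg: "\<ominus>\<^bsub>ring_of_type_algebra\<^esub> x = - x" for x :: complex
    by (rule R.minus_equality) (simp_all add: ring_of_type_algebra_def)
  have "subring OK (ring_of_type_algebra :: complex ring)"
    by (rule R.subringI)
       (use OK_of_int[of 1] in \<open>auto simp: ring_of_type_algebra_def OK_mult OK_add OK_minus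
          neg[unfolded ring_of_type_algebra_def]\<close>)
  from R.subring_is_ring[OF this] show ?thesis unfolding complex_subring_def .
qed

lemma ideal_iff: "ideal J (complex_subring OK) \<and> J \<noteq> {0} \<longleftrightarrow> is_ideal J"
proof
  assume J: "ideal J (complex_subring OK) \<and> J \<noteq> {0}"
  interpret I: ideal J "complex_subring OK" using J by blast
  show "is_ideal J"
    unfolding is_ideal_def
  proof (intro conjI ballI)
    show "J \<subseteq> OK" using I.a_subset by simp
    show "J \<noteq> {0}" using J by blast
    show "0 \<in> J" using additive_subgroup.zero_closed[OF I.additive_subgroup_axioms] by simp
    show "a + b \<in> J" if "a \<in> J" "b \<in> J" for a b using additive_subgroup.a_closed[OF I.additive_subgroup_axioms that] by simp
    show "r * a \<in> J" if "r \<in> OK" "a \<in> J" for r a using I.I_l_closed[OF that(2), of r] that(1) by simp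
  qed
next
  assume J: "is_ideal J"
  note Jd = is_idealD[OF J]
  interpret R: ring "complex_subring OK" by (rule ring_OK)
  have neg: "\<ominus>\<^bsub>complex_subring OK\<^esub> x = - x" if "x \<in> OK" for x
    by (rule R.minus_equality) (use that OK_minus in simp_all)
  have "ideal J (complex_subring OK)"
  proof (rule idealI[OF ring_OK])
    show "subgroup J (add_monoid (complex_subring OK))"
    proof (rule R.add.subgroupI)
      show "J \<subseteq> carrier (complex_subring OK)" using Jd(1) by simp
      show "J \<noteq> {}" using Jd(3) by blast
      show "\<ominus>\<^bsub>complex_subring OK\<^esub> a \<in> J" if "a \<in> J" for a
        using neg[of a] Jd(1) Jd(6)[OF that, of "-1"] that by (simp add: subset_iff)
      show "a \<oplus>\<^bsub>complex_subring OK\<^esub> b \<in> J" if "a \<in> J" "b \<in> J" for a b using Jd(4)[OF that] by simp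
    qed
    show "x \<otimes>\<^bsub>complex_subring OK\<^esub> a \<in> J" if "a \<in> J" "x \<in> carrier (complex_subring OK)" for a x
      using Jd(5)[of x a] that by simp
    show "a \<otimes>\<^bsub>complex_subring OK\<^esub> x \<in> J" if "a \<in> J" "x \<in> carrier (complex_subring OK)" for a x
      using Jd(5)[of x a] that by (simp add: mult.commute)
  qed
  then show "ideal J (complex_subring OK) \<and> J \<noteq> {0}" using Jd(2) by blast
qed

lemma fractional_ideals_eq: "fractional_ideals K = {scale (inverse d) J | d J. d \<in> OK \<and> d \<noteq> 0 \<and> is_ideal J}"
proof -
  have "(\<lambda>z. z / d) ` J = scale (inverse d) J" for d :: complex and J
    by (simp add: divide_inverse mult.commute)
  then show ?thesis unfolding fractional_ideals_def ring_of_integers_eq ideal_iff by auto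
qed

lemma ideal_prod_principal:
  assumes J: "\<And>a b. a \<in> J \<Longrightarrow> b \<in> J \<Longrightarrow> a + b \<in> J" "\<And>r a. r \<in> OK \<Longrightarrow> a \<in> J \<Longrightarrow> r * a \<in> J"
  shows "ideal_prod (complex_subring K) (scale c OK) J = scale c J"
proof (intro equalityI subsetI)
  fix z assume "z \<in> ideal_prod (complex_subring K) (scale c OK) J"
  then show "z \<in> scale c J"
  proof (induction rule: ideal_prod.induct)
    case (prod i j)
    then obtain r where r: "i = c * r" "r \<in> OK" by blast
    have "i \<otimes>\<^bsub>complex_subring K\<^esub> j = c * (r * j)" unfolding r by simp
    moreover have "r * j \<in> J" by (rule J(2)[OF r(2) prod(2)])
    ultimately show ?case by blast
  next
    case (sum s1 s2)
    then obtain a b where ab: "s1 = c * a" "s2 = c * b" "a \<in> J" "b \<in> J" by blast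
    have "s1 \<oplus>\<^bsub>complex_subring K\<^esub> s2 = c * (a + b)" unfolding ab by (simp add: algebra_simps)
    then show ?case using J(1)[OF ab(3,4)] by blast
  qed
next
  fix z assume "z \<in> scale c J"
  then obtain a where a: "z = c * a" "a \<in> J" by blast
  have "c * 1 \<in> scale c OK" using OK_of_int[of 1] by (intro imageI) simp
  from ideal_prod.prod[OF this a(2), of "complex_subring K"]
  show "z \<in> ideal_prod (complex_subring K) (scale c OK) J" unfolding a by simp
qed

definition orbit :: "complex set \<Rightarrow> complex set set" where
  "orbit J = {scale c J | c. c \<in> K \<and> c \<noteq> 0}"

lemma coset_eq_orbit:
  assumes J: "J \<in> fractional_ideals K"
  shows "r_coset (fractional_ideal_group K) (principal_fractional_ideals K) J = orbit J"
proof -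
  obtain d L where d: "d \<in> OK" "d \<noteq> 0" "is_ideal L" "J = scale (inverse d) L"
    using J unfolding fractional_ideals_eq by blast
  note Ld = is_idealD[OF d(3)]
  have "ideal_prod (complex_subring K) (scale c OK) J = scale c J" for c
  proof (rule ideal_prod_principal)
    fix a b assume "a \<in> J" "b \<in> J"
    then obtain a' b' where ab: "a = inverse d * a'" "b = inverse d * b'" "a' \<in> L" "b' \<in> L" unfolding d(4) by blast
    have "a + b = inverse d * (a' + b')" unfolding ab by (simp add: distrib_left)
    then show "a + b \<in> J" unfolding d(4) using Ld(4)[OF ab(3,4)] by blast
  next
    fix r a assume r: "r \<in> OK" and "a \<in> J"
    then obtain a' where a: "a = inverse d * a'" "a' \<in> L" unfolding d(4) by blast
    have "r * a = inverse d * (r * a')" unfolding a by simp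
    then show "r * a \<in> J" unfolding d(4) using Ld(5)[OF r a(2)] by blast
  qed
  then show ?thesis
    unfolding r_coset_def orbit_def principal_fractional_ideals_def ring_of_integers_eq fractional_ideal_group_def
    by auto
qed

lemma orbit_scale:
  assumes "d \<in> K" "d \<noteq> 0" shows "orbit (scale d J) = orbit J"
proof (intro equalityI subsetI)
  fix I assume "I \<in> orbit (scale d J)"
  then obtain c where c: "I = scale c (scale d J)" "c \<in> K" "c \<noteq> 0" unfolding orbit_def by blast
  have "I = scale (c * d) J" unfolding c(1) by (rule scale_scale)
  moreover have "c * d \<in> K" "c * d \<noteq> 0" using c assms K_mult by auto
  ultimately show "I \<in> orbit J" unfolding orbit_def by blast
next
  fix I assume "I \<in> orbit J"
  then obtain c where c: "I = scale c J" "c \<in> K" "c \<noteq> 0" unfolding orbit_def by blast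
  have "I = scale (c * inverse d) (scale d J)" 
  proof -
    have "c * inverse d * d = c" using assms(2) by simp
    then show ?thesis unfolding scale_scale c(1) by (simp only:)
  qed
  moreover have "c * inverse d \<in> K" "c * inverse d \<noteq> 0" using c assms K_mult K_inverse by auto
  ultimately show "I \<in> orbit (scale d J)" unfolding orbit_def by blast
qed

lemma orbit_Int_ideals:
  assumes J: "is_ideal J" shows "orbit J \<inter> {I. is_ideal I} = ideal_class J"
proof -
  have "c \<in> K" if I: "is_ideal (scale c J)" for c
  proof -
    obtain z where z: "z \<in> J" "z \<noteq> 0" by (rule ideal_nonzero_element[OF J])
    have zK: "c * z \<in> K" "z \<in> K" using z(1) is_idealD(1)[OF I] is_idealD(1)[OF J] OK_subset_K by blast+
    have "c * z * inverse z = c" using z(2) by simp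
    then show ?thesis using K_mult[OF zK(1) K_inverse[OF zK(2)]] by (simp only:)
  qed
  then show ?thesis unfolding orbit_def ideal_class_def by blast
qed

text \<open>Multiplication with a principal ideal is scaling, so the cosets are the orbits of the
  fractional ideals under scaling. A fractional ideal is a multiple of an ideal, so every
  orbit is determined by the ideals in it, and these form an ideal class.\<close>

theorem class_number_eq: "class_number K = card ideal_classes"
proof -
  have "class_number K = card (r_coset (fractional_ideal_group K) (principal_fractional_ideals K) ` fractional_ideals K)"
    unfolding class_number_def ideal_class_group_def Coset.order_def carrier_FactGroup
    by (simp add: fractional_ideal_group_def)
  also have "r_coset (fractional_ideal_group K) (principal_fractional_ideals K) ` fractional_ideals K = orbit ` fractional_ideals K"
    by (intro image_cong refl coset_eq_orbit)
  also have "orbit ` fractional_ideals K = orbit ` {J. is_ideal J}"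
  proof (intro equalityI subsetI)
    fix X' assume "X' \<in> orbit ` fractional_ideals K"
    then obtain d J where d: "d \<in> OK" "d \<noteq> 0" "is_ideal J" "X' = orbit (scale (inverse d) J)"
      unfolding fractional_ideals_eq by blast
    have "inverse d \<in> K" "inverse d \<noteq> 0" using d OK_subset_K K_inverse by auto
    from orbit_scale[OF this] d show "X' \<in> orbit ` {J. is_ideal J}" by blast
  next
    fix X' assume "X' \<in> orbit ` {J. is_ideal J}"
    then obtain J where J: "is_ideal J" "X' = orbit J" by blast
    have "J = scale (inverse 1) J" by simp
    hence "J \<in> fractional_ideals K" unfolding fractional_ideals_eq using J(1) OK_of_int[of 1] by fastforce
    then show "X' \<in> orbit ` fractional_ideals K" using J by blast
  qed
  also have "card \<dots> = card ideal_classes"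
  proof (rule bij_betw_same_card[of "\<lambda>Z. Z \<inter> {I. is_ideal I}"], rule bij_betw_imageI)
    have self: "J \<in> orbit J" for J
    proof -
      have "J = scale 1 J" "1 \<in> K" using OK_of_int[of 1] OK_subset_K by auto
      then show ?thesis unfolding orbit_def by fastforce
    qed
    show "inj_on (\<lambda>Z. Z \<inter> {I. is_ideal I}) (orbit ` {J. is_ideal J})"
    proof (rule inj_onI)
      fix Z Z' assume "Z \<in> orbit ` {J. is_ideal J}" "Z' \<in> orbit ` {J. is_ideal J}"
        and eq: "Z \<inter> {I. is_ideal I} = Z' \<inter> {I. is_ideal I}"
      then obtain J J' where J: "is_ideal J" "Z = orbit J" "is_ideal J'" "Z' = orbit J'" by blast
      have "J \<in> orbit J'" using eq self[of J] J by blast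
      then obtain c where "J = scale c J'" "c \<in> K" "c \<noteq> 0" unfolding orbit_def by blast
      then show "Z = Z'" using orbit_scale[of c J'] J by simp
    qed
    show "(\<lambda>Z. Z \<inter> {I. is_ideal I}) ` orbit ` {J. is_ideal J} = ideal_classes"
      unfolding ideal_classes_def image_image by (intro image_cong refl) (simp add: orbit_Int_ideals)
  qed
  finally show ?thesis .
qed

end

section \<open>Power series with periodic coefficients\<close>

text \<open>Functions of this shape are closed under differentiation, and each derivative has a factor
  \<open>exp (- x)\<close>, from which it gets its decay.\<close>

lemma exp_rational_derivative:
  fixes U Q :: "real poly"
  assumes Q: "poly Q (exp (- x)) \<noteq> 0"
  shows "((\<lambda>x. poly U (exp (- x)) / poly Q (exp (- x)) ^ k) has_real_derivative
     poly ([:0, 1:] * (smult (real k) (U * pderiv Q) - pderiv U * Q)) (exp (- x)) / poly Q (exp (- x)) ^ Suc k) (at x)"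
proof -
  let ?q = "exp (- x)"
  have e: "((\<lambda>x. exp (- x)) has_real_derivative - ?q) (at x)"
    by (auto intro!: derivative_eq_intros)
  have U: "((\<lambda>x. poly U (exp (- x))) has_real_derivative poly (pderiv U) ?q * - ?q) (at x)"
    by (rule DERIV_chain2[OF poly_DERIV e])
  have "((\<lambda>x. poly Q (exp (- x))) has_real_derivative poly (pderiv Q) ?q * - ?q) (at x)"
    by (rule DERIV_chain2[OF poly_DERIV e])
  from DERIV_power[OF this, of k]
  have "((\<lambda>x. poly Q (exp (- x)) ^ k) has_real_derivative
      of_nat k * (poly (pderiv Q) ?q * - ?q * poly Q ?q ^ (k - 1))) (at x)" by simp
  from DERIV_divide[OF U this] Q
  have "((\<lambda>x. poly U (exp (- x)) / poly Q (exp (- x)) ^ k) has_real_derivative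
     (poly (pderiv U) ?q * - ?q * poly Q ?q ^ k
      - poly U ?q * (of_nat k * (poly (pderiv Q) ?q * - ?q * poly Q ?q ^ (k - 1))))
      / (poly Q ?q ^ k * poly Q ?q ^ k)) (at x)" by simp
  moreover have "(poly (pderiv U) ?q * - ?q * poly Q ?q ^ k
      - poly U ?q * (of_nat k * (poly (pderiv Q) ?q * - ?q * poly Q ?q ^ (k - 1))))
      / (poly Q ?q ^ k * poly Q ?q ^ k)
      = poly ([:0, 1:] * (smult (real k) (U * pderiv Q) - pderiv U * Q)) ?q / poly Q ?q ^ Suc k"
    using Q by (cases k) (simp_all add: field_simps)
  ultimately show ?thesis by simp
qed

lemma poly_bounded_unit_interval:
  fixes p :: "real poly"
  shows "\<exists>M. \<forall>q. 0 \<le> q \<longrightarrow> q \<le> 1 \<longrightarrow> \<bar>poly p q\<bar> \<le> M"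
proof (intro exI allI impI)
  fix q :: real assume q: "0 \<le> q" "q \<le> 1"
  have "\<bar>poly p q\<bar> \<le> (\<Sum>i\<le>degree p. \<bar>coeff p i * q ^ i\<bar>)"
    unfolding poly_altdef by (rule sum_abs)
  also have "\<dots> \<le> (\<Sum>i\<le>degree p. \<bar>coeff p i\<bar>)"
    using q by (intro sum_mono) (simp add: abs_mult mult_left_le power_le_one)
  finally show "\<bar>poly p q\<bar> \<le> (\<Sum>i\<le>degree p. \<bar>coeff p i\<bar>)" .
qed

lemma exp_rational_bound:
  fixes U Q :: "real poly"
  assumes Q: "\<And>q. 0 \<le> q \<Longrightarrow> poly Q q \<ge> 1"
  shows "\<exists>C. \<forall>x\<ge>0. \<bar>poly ([:0, 1:] * U) (exp (- x)) / poly Q (exp (- x)) ^ k\<bar> \<le> C * exp (- x)"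
proof -
  obtain M where M: "\<And>q. 0 \<le> q \<Longrightarrow> q \<le> 1 \<Longrightarrow> \<bar>poly U q\<bar> \<le> M" using poly_bounded_unit_interval by blast
  have "\<bar>poly ([:0, 1:] * U) (exp (- x)) / poly Q (exp (- x)) ^ k\<bar> \<le> M * exp (- x)" if x: "x \<ge> 0" for x :: real
  proof -
    let ?q = "exp (- x)"
    have U: "\<bar>poly U ?q\<bar> \<le> M" using x by (intro M) auto
    hence M0: "M \<ge> 0" by linarith
    have 1: "1 \<le> poly Q ?q ^ k" using Q[of ?q] by (simp add: one_le_power)
    have "\<bar>poly ([:0, 1:] * U) ?q / poly Q ?q ^ k\<bar> = (?q * \<bar>poly U ?q\<bar>) / poly Q ?q ^ k"
      using 1 by (simp add: abs_mult)
    also have "\<dots> \<le> (?q * M) / 1"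
      using U 1 M0 by (intro frac_le mult_left_mono) auto
    finally show ?thesis by (simp add: mult.commute)
  qed
  then show ?thesis by blast
qed

text \<open>For a periodic sequence of mean zero the power series is \<open>P / (1 - q\<^sup>N)\<close> with a
  polynomial \<open>P\<close> that vanishes at \<open>1\<close>; cancelling \<open>1 - q\<close> shows that it has no pole there,
  and its value there is the regularised sum of the sequence.\<close>

lemma periodic_power_series:
  fixes c :: "nat \<Rightarrow> real"
  assumes N: "N > 0" and per: "\<And>n. c (n + N) = c n" and c0: "c 0 = 0" and mean: "(\<Sum>r<N. c r) = 0"
  shows "\<exists>G G' G'' C. (\<forall>x. (G has_real_derivative G' x) (at x)) \<and> (\<forall>x. (G' has_real_derivative G'' x) (at x))
    \<and> (\<forall>x\<ge>0. \<bar>G x\<bar> \<le> C * exp (- x)) \<and> (\<forall>x\<ge>0. \<bar>G'' x\<bar> \<le> C * exp (- x))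
    \<and> (\<forall>x>0. (\<lambda>d. c d * exp (- x) ^ d) sums G x) \<and> G 0 = - (\<Sum>r<N. real r * c r) / real N"
proof -
  define P where "P = (\<Sum>r<N. monom (c r) r)"
  have Pq: "poly P q = (\<Sum>r<N. c r * q ^ r)" for q by (simp add: P_def poly_sum poly_monom)
  have "poly P 0 = (\<Sum>r<N. if r = 0 then c 0 else 0)" unfolding Pq by (intro sum.cong) auto
  hence "poly P 0 = 0" using c0 by simp
  then obtain P1 where P1: "P = [:0, 1:] * P1" by (auto simp: poly_eq_0_iff_dvd)
  have "poly P 1 = 0" unfolding Pq using mean by simp
  hence "poly P1 1 = 0" unfolding P1 by simp
  then obtain P2 where P2: "P1 = [:-1, 1:] * P2" by (auto simp: poly_eq_0_iff_dvd)
  define U where "U = [:0, 1:] * (- P2)"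
  have PU: "P = [:1, -1:] * U"
    unfolding U_def P1 P2 by (simp add: algebra_simps)
  define Q :: "real poly" where "Q = (\<Sum>i<N. monom 1 i)"
  have Qq: "poly Q q = (\<Sum>i<N. q ^ i)" for q by (simp add: Q_def poly_sum poly_monom)
  have Q1: "poly Q q \<ge> 1" if "q \<ge> 0" for q
  proof -
    have "(\<Sum>i\<in>{0}. q ^ i) \<le> (\<Sum>i<N. q ^ i)" using that N by (intro sum_mono2) auto
    then show ?thesis by (simp add: Qq)
  qed
  have Qnz: "poly Q (exp (- x)) \<noteq> 0" for x using Q1[of "exp (- x)"] by simp
  define U1 where "U1 = [:0, 1:] * (smult (real 1) (U * pderiv Q) - pderiv U * Q)"
  define U2 where "U2 = [:0, 1:] * (smult (real 2) (U1 * pderiv Q) - pderiv U1 * Q)"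
  define G where "G = (\<lambda>x. poly U (exp (- x)) / poly Q (exp (- x)) ^ 1)"
  define G1 where "G1 = (\<lambda>x. poly U1 (exp (- x)) / poly Q (exp (- x)) ^ 2)"
  define G2 where "G2 = (\<lambda>x. poly U2 (exp (- x)) / poly Q (exp (- x)) ^ 3)"
  have suc: "Suc 1 = 2" "Suc 2 = 3" by simp_all
  have d1: "(G has_real_derivative G1 x) (at x)" for x
    unfolding G_def G1_def U1_def
    by (rule exp_rational_derivative[where k = 1, OF Qnz, unfolded suc])
  have d2: "(G1 has_real_derivative G2 x) (at x)" for x
    unfolding G1_def G2_def U2_def
    by (rule exp_rational_derivative[where k = 2, OF Qnz, unfolded suc])
  obtain C1 where C1: "\<And>x. x \<ge> 0 \<Longrightarrow> \<bar>G x\<bar> \<le> C1 * exp (- x)"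
    using exp_rational_bound[OF Q1, of "- P2" 1] unfolding G_def U_def by blast
  obtain C2 where C2: "\<And>x. x \<ge> 0 \<Longrightarrow> \<bar>G2 x\<bar> \<le> C2 * exp (- x)"
    using exp_rational_bound[OF Q1, of "smult (real 2) (U1 * pderiv Q) - pderiv U1 * Q" 3]
    unfolding G2_def U2_def by blast
  have mx: "a * exp (- x) \<le> max C1 C2 * exp (- x)" if "a = C1 \<or> a = C2" for a x :: real
    using that by (intro mult_right_mono) auto
  have bd: "\<bar>c n\<bar> \<le> (\<Sum>r<N. \<bar>c r\<bar>)" for n
  proof -
    have "c n = c (n mod N)"
    proof (induction n rule: less_induct)
      case (less n)
      show ?case
      proof (cases "n < N")
        case False
        then have "c n = c (n - N)" using per[of "n - N"] by simp
        then show ?thesis using less[of "n - N"] False N by (simp add: le_mod_geq)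
      qed simp
    qed
    also have "\<bar>c (n mod N)\<bar> \<le> (\<Sum>r<N. \<bar>c r\<bar>)"
      using N by (intro member_le_sum) auto
    finally show ?thesis .
  qed
  have sums: "(\<lambda>d. c d * exp (- x) ^ d) sums G x" if x: "x > 0" for x
  proof -
    let ?q = "exp (- x)"
    have q: "0 < ?q" "?q < 1" using x by auto
    have sm: "summable (\<lambda>d. c d * ?q ^ d)"
    proof (rule summable_comparison_test'[where N = 0])
      show "summable (\<lambda>d. (\<Sum>r<N. \<bar>c r\<bar>) * ?q ^ d)" using q by (intro summable_mult summable_geometric) auto
      show "norm (c d * ?q ^ d) \<le> (\<Sum>r<N. \<bar>c r\<bar>) * ?q ^ d" for d
        using mult_right_mono[OF bd[of d], of "?q ^ d"] by (simp add: abs_mult)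
    qed
    define S where "S = suminf (\<lambda>d. c d * ?q ^ d)"
    have "S = suminf (\<lambda>d. c (d + N) * ?q ^ (d + N)) + (\<Sum>d<N. c d * ?q ^ d)"
      unfolding S_def by (rule suminf_split_initial_segment[OF sm])
    also have "suminf (\<lambda>d. c (d + N) * ?q ^ (d + N)) = suminf (\<lambda>d. ?q ^ N * (c d * ?q ^ d))"
      unfolding per by (simp add: power_add mult_ac)
    also have "\<dots> = ?q ^ N * S" unfolding S_def by (rule suminf_mult[OF sm])
    finally have "(1 - ?q ^ N) * S = poly P ?q" unfolding Pq by (simp add: algebra_simps)
    moreover have "1 - ?q ^ N = (1 - ?q) * poly Q ?q" unfolding Qq by (rule one_diff_power_eq)
    moreover have "poly P ?q = (1 - ?q) * poly U ?q" unfolding PU by (simp add: algebra_simps)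
    ultimately have "(1 - ?q) * (poly Q ?q * S) = (1 - ?q) * poly U ?q" by (simp only: mult.assoc)
    hence "poly Q ?q * S = poly U ?q" using q(2) by simp
    hence "S = G x" unfolding G_def using Qnz[of x] by (simp add: field_simps)
    then show ?thesis using summable_sums[OF sm] S_def by simp
  qed
  have "G 0 = - (\<Sum>r<N. real r * c r) / real N"
  proof -
    have "poly (pderiv P) 1 = - poly U 1" unfolding PU pderiv_mult by (simp add: pderiv_pCons)
    moreover have "pderiv (\<Sum>r\<in>A. monom (c r) r) = (\<Sum>r\<in>A. pderiv (monom (c r) r))" for A
      by (induction A rule: infinite_finite_induct) (simp_all add: pderiv_add)
    hence "poly (pderiv P) 1 = (\<Sum>r<N. real r * c r)"
      by (simp add: P_def pderiv_monom poly_sum poly_monom)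
    moreover have "poly Q 1 = real N" by (simp add: Qq)
    ultimately show ?thesis unfolding G_def by simp
  qed
  moreover have "\<bar>G x\<bar> \<le> max C1 C2 * exp (- x)" "\<bar>G2 x\<bar> \<le> max C1 C2 * exp (- x)" if "x \<ge> 0" for x
    using C1[OF that] C2[OF that] mx[OF disjI1[OF refl], of x] mx[OF disjI2[OF refl], of x] by linarith+
  ultimately show ?thesis using d1 d2 sums by blast
qed

section \<open>The class number formula\<close>

context imaginary_quadratic begin

lemma chi_0: "chi 0 = 0"
  by (rule chi_zero) (use N_greater in simp)

lemma chi_shift: "chi (x + N) = chi x"
  using chi_mod[of "x + N"] chi_mod[of x] by simp

lemma chi_reflect: "chi (N - x) = - chi x"
proof -
  have "chi (N - x) = chi (-1 * x + N)" by simp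
  also have "\<dots> = chi (-1) * chi x" by (simp only: chi_shift chi_mult)
  finally show ?thesis by (simp add: chi_minus_one)
qed

lemma chi_abs_le: "\<bar>chi x\<bar> \<le> 1"
  using chi_zero[of x] chi_values[of x] by (cases "coprime x N") auto

text \<open>The character is odd.\<close>

lemma sum_chi_period: "(\<Sum>r<nat N. chi (int r)) = 0"
proof -
  have "(\<Sum>r<nat N. chi (int r)) = (\<Sum>r\<in>{1..<nat N}. chi (int r))"
    by (rule sum.mono_neutral_right) (auto simp: chi_0 not_less_eq_eq)
  moreover have "(\<Sum>r\<in>{1..<nat N}. chi (int r)) = (\<Sum>r\<in>{1..<nat N}. chi (int (nat N - r)))"
    by (rule sum.reindex_bij_witness[of _ "\<lambda>r. nat N - r" "\<lambda>r. nat N - r"]) auto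
  moreover have "\<dots> = (\<Sum>r\<in>{1..<nat N}. - chi (int r))"
    by (intro sum.cong refl) (auto simp: of_nat_diff chi_reflect)
  ultimately show ?thesis by (simp add: sum_negf)
qed

definition ideals_of_norm :: "nat \<Rightarrow> complex set set" where
  "ideals_of_norm n = {I. is_ideal I \<and> ideal_norm I = real n}"

text \<open>The ideal \<open>g (a \<int> + (b + \<omega>) \<int>)\<close> has norm \<open>g\<^sup>2 a\<close>.\<close>

lemma card_ideals_of_norm:
  assumes n: "n > 0"
  shows "finite (ideals_of_norm n)" "int (card (ideals_of_norm n)) = (\<Sum>d | d dvd n. chi (int d))"
proof -
  define S where "S = Sigma {g. g\<^sup>2 dvd n} (\<lambda>g. roots (int (n div g\<^sup>2)))"
  have div_pos: "n div g\<^sup>2 > 0" "g > 0" if "g\<^sup>2 dvd n" for g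
  proof -
    have "n div g\<^sup>2 * g\<^sup>2 = n" using that by simp
    then show "n div g\<^sup>2 > 0" "g > 0" using n by (auto intro!: Nat.gr0I)
  qed
  have fin: "finite {g. g\<^sup>2 dvd n}"
  proof (rule finite_subset)
    show "{g. g\<^sup>2 dvd n} \<subseteq> {..n}"
    proof
      fix g assume "g \<in> {g. g\<^sup>2 dvd n}"
      hence "g\<^sup>2 \<le> n" using n by (auto intro: dvd_imp_le)
      moreover have "g \<le> g\<^sup>2" by (simp add: power2_eq_square)
      ultimately show "g \<in> {..n}" by simp
    qed
  qed simp
  have "bij_betw (\<lambda>(g, b). std_ideal (int g) (int (n div g\<^sup>2)) b) S (ideals_of_norm n)"
  proof (rule bij_betw_imageI)
    show "inj_on (\<lambda>(g, b). std_ideal (int g) (int (n div g\<^sup>2)) b) S"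
    proof (rule inj_onI)
      fix z z' assume z: "z \<in> S" "z' \<in> S"
        and eq: "(\<lambda>(g, b). std_ideal (int g) (int (n div g\<^sup>2)) b) z = (\<lambda>(g, b). std_ideal (int g) (int (n div g\<^sup>2)) b) z'"
      obtain g b g' b' where zz: "z = (g, b)" "z' = (g', b')" by (metis surj_pair)
      have g: "g\<^sup>2 dvd n" "b \<in> roots (int (n div g\<^sup>2))" "g'\<^sup>2 dvd n" "b' \<in> roots (int (n div g'\<^sup>2))"
        using z unfolding zz S_def by auto
      have "std_ideal (int g) (int (n div g\<^sup>2)) b = std_ideal (int g') (int (n div g'\<^sup>2)) b'"
        using eq unfolding zz by simp
      from std_ideal_inj[OF _ _ g(2) _ _ g(4) this] div_pos[OF g(1)] div_pos[OF g(3)]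
      have "int g = int g' \<and> b = b'" by simp
      then show "z = z'" unfolding zz by simp
    qed
    show "(\<lambda>(g, b). std_ideal (int g) (int (n div g\<^sup>2)) b) ` S = ideals_of_norm n"
    proof (intro equalityI subsetI)
      fix I assume "I \<in> (\<lambda>(g, b). std_ideal (int g) (int (n div g\<^sup>2)) b) ` S"
      then obtain g b where I: "I = std_ideal (int g) (int (n div g\<^sup>2)) b" "g\<^sup>2 dvd n" "b \<in> roots (int (n div g\<^sup>2))"
        unfolding S_def by auto
      have p: "int g > 0" "int (n div g\<^sup>2) > 0" using div_pos[OF I(2)] by simp_all
      have "int ((g\<^sup>2) * (n div g\<^sup>2)) = int n" using I(2) by (simp only: dvd_mult_div_cancel)
      hence "(int g)\<^sup>2 * int (n div g\<^sup>2) = int n" by (simp only: of_nat_mult of_nat_power)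
      hence "ideal_norm I = real n" unfolding I(1) ideal_norm_std[OF p] by (simp only: of_int_of_nat_eq)
      then show "I \<in> ideals_of_norm n"
        unfolding ideals_of_norm_def using std_ideal_is_ideal[OF p I(3)] I(1) by blast
    next
      fix I assume "I \<in> ideals_of_norm n"
      hence I: "is_ideal I" "ideal_norm I = real n" unfolding ideals_of_norm_def by blast+
      obtain g a b where gab: "g > 0" "a > 0" "b \<in> roots a" "I = std_ideal g a b"
        using ideal_eq_std_ideal[OF I(1)] by blast
      have "real_of_int (g\<^sup>2 * a) = of_int (int n)" using I(2) ideal_norm_std[OF gab(1,2)] gab(4) by simp
      hence gn: "g\<^sup>2 * a = int n" by (simp only: of_int_eq_iff)
      define g' a' where "g' = nat g" and "a' = nat a"
      have g': "g = int g'" "a = int a'" using gab(1,2) by (simp_all add: g'_def a'_def)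
      have na: "n = g'\<^sup>2 * a'"
      proof -
        have "int n = int (g'\<^sup>2 * a')" using gn unfolding g' by simp
        then show ?thesis by (simp only: of_nat_eq_iff)
      qed
      hence "n div g'\<^sup>2 = a'" using gab(1) g' by simp
      hence "(g', b) \<in> S" "I = (\<lambda>(g, b). std_ideal (int g) (int (n div g\<^sup>2)) b) (g', b)"
        unfolding S_def using gab(3,4) g' na by auto
      then show "I \<in> (\<lambda>(g, b). std_ideal (int g) (int (n div g\<^sup>2)) b) ` S" by blast
    qed
  qed
  note bij = this
  have "finite S" unfolding S_def using fin by (intro finite_SigmaI) auto
  then show "finite (ideals_of_norm n)" using bij_betw_finite[OF bij] by blast
  have "card S = (\<Sum>g | g\<^sup>2 dvd n. card (roots (int (n div g\<^sup>2))))"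
    unfolding S_def using fin by (intro card_SigmaI) auto
  hence "int (card S) = (\<Sum>g | g\<^sup>2 dvd n. rho (n div g\<^sup>2))" unfolding rho_def by simp
  then show "int (card (ideals_of_norm n)) = (\<Sum>d | d dvd n. chi (int d))"
    using bij_betw_same_card[OF bij] sum_rho_eq_sum_chi[OF n] by simp
qed

text \<open>For \<open>d, k \<ge> 1\<close> we have \<open>d k \<ge> (d + k) / 2\<close>, so the double sum is dominated by a product of
  geometric series.\<close>

lemma exp_hyperbola_summable:
  fixes t :: real assumes t: "t > 0"
  shows "(\<lambda>(k, d). real_of_int (chi (int d)) * exp (- t * real (d * k))) summable_on ({1..} \<times> {1..})"
proof (rule abs_summable_summable, rule summable_on_comparison_test)
  let ?f = "\<lambda>p::nat \<times> nat. (int (fst p), int (snd p))"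
  let ?g = "\<lambda>p::int \<times> int. exp (- (t / 2) * (\<bar>real_of_int (fst p)\<bar> + \<bar>real_of_int (snd p)\<bar>))"
  have "?g summable_on (?f ` ({1..} \<times> {1..}))"
    by (rule summable_on_subset_banach[OF exp_lattice_sum(1)]) (use t in auto)
  moreover have "inj_on ?f ({1..} \<times> {1..})" by (auto simp: inj_on_def)
  ultimately show "(?g \<circ> ?f) summable_on ({1..} \<times> {1..})" using summable_on_reindex by blast
  fix p :: "nat \<times> nat" assume p: "p \<in> {1..} \<times> {1..}"
  obtain k d where kd: "p = (k, d)" "k \<ge> 1" "d \<ge> 1" using p by auto
  have "(real k - 1) * (real d - 1) \<ge> 0" using kd by (intro mult_nonneg_nonneg) auto
  moreover have "real d \<ge> 1" "real k \<ge> 1" "real d * real k \<ge> 1"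
    using kd mult_mono[of 1 "real d" 1 "real k"] by auto
  ultimately have "real d * real k \<ge> (real k + real d) / 2" by (simp add: algebra_simps)
  hence "t * ((real k + real d) / 2) \<le> t * (real d * real k)" using t by (intro mult_left_mono) auto
  hence "exp (- t * real (d * k)) \<le> (?g \<circ> ?f) p" unfolding kd by simp
  moreover have "norm (case p of (k, d) \<Rightarrow> real_of_int (chi (int d)) * exp (- t * real (d * k))) \<le> exp (- t * real (d * k))"
  proof -
    have "\<bar>real_of_int (chi (int d))\<bar> \<le> 1" using chi_abs_le[of "int d"] by linarith
    from mult_right_mono[OF this, of "exp (- t * real (d * k))"] show ?thesis unfolding kd by (simp add: abs_mult)
  qed
  ultimately show "norm (case p of (k, d) \<Rightarrow> real_of_int (chi (int d)) * exp (- t * real (d * k))) \<le> (?g \<circ> ?f) p"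
    by linarith
qed simp

text \<open>Collecting the ideals by their norm \<open>n\<close>, and then the pairs \<open>(n, d)\<close> with \<open>d\<close> dividing
  \<open>n\<close> by the cofactor \<open>k = n / d\<close>.\<close>

lemma ideal_sum_eq_character_sum:
  assumes t: "t > 0"
  shows "infsum (\<lambda>I. exp (- t * ideal_norm I)) {I. is_ideal I}
    = infsum (\<lambda>k. infsum (\<lambda>d. real_of_int (chi (int d)) * exp (- t * real (d * k))) {1..}) {1::nat..}"
proof -
  let ?e = "\<lambda>n::nat. exp (- t * real n)"
  let ?h = "\<lambda>n. \<Sum>d | d dvd n. real_of_int (chi (int d))"
  have bij1: "bij_betw snd (Sigma {1..} ideals_of_norm) {I. is_ideal I}"
  proof (rule bij_betw_imageI)
    show "inj_on snd (Sigma {1..} ideals_of_norm)"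
      by (auto simp: inj_on_def ideals_of_norm_def)
    show "snd ` Sigma {1..} ideals_of_norm = {I. is_ideal I}"
    proof (intro equalityI subsetI)
      fix I assume "I \<in> {I. is_ideal I}"
      hence I: "is_ideal I" by simp
      obtain g a b where gab: "g > 0" "a > 0" "I = std_ideal g a b" using ideal_eq_std_ideal[OF I] by blast
      have "ideal_norm I = real (nat (g\<^sup>2 * a))" using ideal_norm_std[OF gab(1,2)] gab by simp
      moreover have "nat (g\<^sup>2 * a) \<ge> 1" using gab(1,2) by (simp add: Suc_le_eq)
      ultimately have "(nat (g\<^sup>2 * a), I) \<in> Sigma {1..} ideals_of_norm"
        unfolding ideals_of_norm_def using I by simp
      then show "I \<in> snd ` Sigma {1..} ideals_of_norm" by force
    qed (auto simp: ideals_of_norm_def)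
  qed
  have s1: "(\<lambda>z. exp (- t * ideal_norm (snd z))) summable_on (Sigma {1..} ideals_of_norm)"
    using summable_on_reindex_bij_betw[OF bij1, of "\<lambda>I. exp (- t * ideal_norm I)"]
      zeta_asymptotics_classes(1)[OF t] by blast
  have "infsum (\<lambda>I. exp (- t * ideal_norm I)) {I. is_ideal I}
      = infsum (\<lambda>z. exp (- t * ideal_norm (snd z))) (Sigma {1..} ideals_of_norm)"
    by (rule infsum_reindex_bij_betw[OF bij1, symmetric])
  also have "\<dots> = infsum (\<lambda>n. infsum (\<lambda>I. exp (- t * ideal_norm (snd (n, I)))) (ideals_of_norm n)) {1..}"
    by (rule infsum_Sigma_banach[OF s1, symmetric])
  also have "\<dots> = infsum (\<lambda>n. infsum (\<lambda>d. real_of_int (chi (int d)) * ?e n) {d. d dvd n}) {1..}"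
  proof (rule infsum_cong)
    fix n :: nat assume "n \<in> {1..}"
    hence n: "n > 0" by simp
    have "infsum (\<lambda>I. exp (- t * ideal_norm (snd (n, I)))) (ideals_of_norm n) = (\<Sum>I\<in>ideals_of_norm n. ?e n)"
      using card_ideals_of_norm(1)[OF n] by (simp add: infsum_finite ideals_of_norm_def)
    also have "\<dots> = real_of_int (int (card (ideals_of_norm n))) * ?e n" by simp
    also have "\<dots> = (\<Sum>d | d dvd n. real_of_int (chi (int d)) * ?e n)"
      unfolding card_ideals_of_norm(2)[OF n] by (simp add: sum_distrib_right)
    also have "\<dots> = infsum (\<lambda>d. real_of_int (chi (int d)) * ?e n) {d. d dvd n}"
      using n by (simp add: infsum_finite)
    finally show "infsum (\<lambda>I. exp (- t * ideal_norm (snd (n, I)))) (ideals_of_norm n)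
      = infsum (\<lambda>d. real_of_int (chi (int d)) * ?e n) {d. d dvd n}" .
  qed
  also have "\<dots> = infsum (\<lambda>(n, d). real_of_int (chi (int d)) * ?e n) (Sigma {1..} (\<lambda>n. {d. d dvd n}))"
  proof -
    have bij2: "bij_betw (\<lambda>(k, d). (d * k, d)) ({1..} \<times> {1..}) (Sigma {1..} (\<lambda>n::nat. {d. d dvd n}))"
    proof (rule bij_betw_byWitness[where f' = "\<lambda>(n, d). (n div d, d)"])
      show "\<forall>a'\<in>Sigma {1..} (\<lambda>n. {d. d dvd n}). (\<lambda>(k, d). (d * k, d)) ((\<lambda>(n, d). (n div d, d)) a') = (a' :: nat \<times> nat)"
        by auto
      show "(\<lambda>(n, d). (n div d, d)) ` Sigma {1..} (\<lambda>n. {d. d dvd n}) \<subseteq> {1..} \<times> ({1..} :: nat set)"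
        by (auto elim!: dvdE simp: Suc_le_eq)
    qed (auto simp: Suc_le_eq)
    have eq: "(\<lambda>z. (\<lambda>(n, d). real_of_int (chi (int d)) * ?e n) ((\<lambda>(k, d). (d * k, d)) z))
       = (\<lambda>(k, d). real_of_int (chi (int d)) * exp (- t * real (d * k)))"
      by (simp add: fun_eq_iff)
    have "(\<lambda>(n, d). real_of_int (chi (int d)) * ?e n) summable_on (Sigma {1..} (\<lambda>n. {d. d dvd n}))"
      using summable_on_reindex_bij_betw[OF bij2, of "\<lambda>(n, d). real_of_int (chi (int d)) * ?e n"]
        exp_hyperbola_summable[OF t] unfolding eq by blast
    from infsum_Sigma_banach[OF this] show ?thesis by simp
  qed
  also have "\<dots> = infsum (\<lambda>(k, d). real_of_int (chi (int d)) * exp (- t * real (d * k))) ({1..} \<times> {1..})"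
  proof -
    have bij2: "bij_betw (\<lambda>(k, d). (d * k, d)) ({1..} \<times> {1..}) (Sigma {1..} (\<lambda>n::nat. {d. d dvd n}))"
    proof (rule bij_betw_byWitness[where f' = "\<lambda>(n, d). (n div d, d)"])
      show "\<forall>a'\<in>Sigma {1..} (\<lambda>n. {d. d dvd n}). (\<lambda>(k, d). (d * k, d)) ((\<lambda>(n, d). (n div d, d)) a') = (a' :: nat \<times> nat)"
        by auto
      show "(\<lambda>(n, d). (n div d, d)) ` Sigma {1..} (\<lambda>n. {d. d dvd n}) \<subseteq> {1..} \<times> ({1..} :: nat set)"
        by (auto elim!: dvdE simp: Suc_le_eq)
    qed (auto simp: Suc_le_eq)
    show ?thesis
      using infsum_reindex_bij_betw[OF bij2, of "\<lambda>(n, d). real_of_int (chi (int d)) * ?e n"]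
      by (simp add: case_prod_unfold)
  qed
  also have "\<dots> = infsum (\<lambda>k. infsum (\<lambda>d. real_of_int (chi (int d)) * exp (- t * real (d * k))) {1..}) {1..}"
    using infsum_Sigma_banach[OF exp_hyperbola_summable[OF t]] by simp
  finally show ?thesis .
qed

theorem zeta_asymptotics_character:
  "\<exists>A. (\<lambda>k. infsum (\<lambda>I. exp (- ideal_norm I / 4 ^ k)) {I. is_ideal I} - A * 4 ^ k)
     \<longlonglongrightarrow> real_of_int (\<Sum>r<nat N. int r * chi (int r)) / (2 * real_of_int N)"
proof -
  let ?c = "\<lambda>d::nat. real_of_int (chi (int d))"
  have N0: "nat N > 0" using N_greater by simp
  have per: "?c (n + nat N) = ?c n" for n using chi_shift[of "int n"] by simp
  have mean: "(\<Sum>r<nat N. ?c r) = 0" using sum_chi_period by (metis of_int_0 of_int_sum)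
  have c00: "?c 0 = 0" using chi_0 by simp
  obtain G G' G'' C where GG: "\<forall>x. (G has_real_derivative G' x) (at x)"
    "\<forall>x. (G' has_real_derivative G'' x) (at x)"
    "\<forall>x\<ge>0. \<bar>G x\<bar> \<le> C * exp (- x)" "\<forall>x\<ge>0. \<bar>G'' x\<bar> \<le> C * exp (- x)"
    "\<forall>x>0. (\<lambda>d. ?c d * exp (- x) ^ d) sums G x"
    and G0: "G 0 = - (\<Sum>r<nat N. real r * ?c r) / real (nat N)"
    using periodic_power_series[OF N0 per c00 mean] by (elim exE conjE) (rule that)
  note G = GG(1,2)[rule_format] GG(3,4)[rule_format]
  note Gs = GG(5)[rule_format]
  have inner: "infsum (\<lambda>d. ?c d * exp (- t * real (d * k))) {1..} = G (real k * t)" if tk: "t > 0" "k > 0" for t k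
  proof -
    have x: "real k * t > 0" using tk by simp
    have e: "exp (- t * real (d * k)) = exp (- (real k * t)) ^ d" for d
      by (simp add: mult_ac flip: exp_of_nat_mult)
    have "summable (\<lambda>d. norm (?c d * exp (- (real k * t)) ^ d))"
    proof (rule summable_comparison_test'[where N = 0])
      show "summable (\<lambda>d. exp (- (real k * t)) ^ d)" using x by (intro summable_geometric) auto
      show "norm (norm (?c d * exp (- (real k * t)) ^ d)) \<le> exp (- (real k * t)) ^ d" for d
      proof -
        have "\<bar>?c d\<bar> \<le> 1" using chi_abs_le[of "int d"] by linarith
        from mult_right_mono[OF this, of "exp (- (real k * t)) ^ d"] show ?thesis by (simp add: abs_mult)
      qed
    qed
    from norm_summable_imp_has_sum[OF this Gs[OF x]]
    have "((\<lambda>d. ?c d * exp (- (real k * t)) ^ d) has_sum G (real k * t)) UNIV" .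
    moreover have "((\<lambda>d. ?c d * exp (- (real k * t)) ^ d) has_sum G (real k * t)) {1..}
      \<longleftrightarrow> ((\<lambda>d. ?c d * exp (- (real k * t)) ^ d) has_sum G (real k * t)) UNIV"
    proof (rule has_sum_cong_neutral)
      fix d :: nat assume "d \<in> UNIV - {1..}"
      hence "d = 0" by auto
      then show "?c d * exp (- (real k * t)) ^ d = 0" by (simp add: chi_0)
    qed simp_all
    ultimately have "((\<lambda>d. ?c d * exp (- (real k * t)) ^ d) has_sum G (real k * t)) {1..}" by blast
    then show ?thesis unfolding e by (rule infsumI)
  qed
  have S: "infsum (\<lambda>I. exp (- t * ideal_norm I)) {I. is_ideal I} = suminf (\<lambda>n. G (real (Suc n) * t))"
    if t: "t > 0" for t
  proof -
    have "infsum (\<lambda>I. exp (- t * ideal_norm I)) {I. is_ideal I} = infsum (\<lambda>k. G (real k * t)) {1..}"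
      unfolding ideal_sum_eq_character_sum[OF t]
      by (rule infsum_cong, rule inner[OF t]) simp
    also have "\<dots> = infsum (\<lambda>n. G (real (Suc n) * t)) UNIV"
    proof (rule infsum_reindex_bij_betw[symmetric])
      show "bij_betw Suc UNIV {1..}"
        by (rule bij_betw_byWitness[where f' = "\<lambda>n. n - 1"]) auto
    qed
    also have "\<dots> = suminf (\<lambda>n. G (real (Suc n) * t))"
    proof -
      have s: "summable (\<lambda>n. \<bar>G (real (Suc n) * t)\<bar>)" by (rule trapezoid_asymptotics(2)[OF G t])
      have "summable (\<lambda>n. norm (G (real (Suc n) * t)))" using s by simp
      from norm_summable_imp_has_sum[OF this summable_sums[OF summable_rabs_cancel[OF s]]]
      show ?thesis by (rule infsumI)
    qed
    finally show ?thesis .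
  qed
  obtain A where A: "(\<lambda>k. suminf (\<lambda>n. G (real (Suc n) / 4 ^ k)) - A * 4 ^ k) \<longlonglongrightarrow> - G 0 / 2"
    using trapezoid_asymptotics(1)[OF G] by blast
  have "suminf (\<lambda>n. G (real (Suc n) / 4 ^ k)) = infsum (\<lambda>I. exp (- ideal_norm I / 4 ^ k)) {I. is_ideal I}" for k
  proof -
    have p: "(0::real) < 1 / 4 ^ k" by simp
    have e: "- (1 / 4 ^ k) * x = - x / 4 ^ k" "x * (1 / 4 ^ k) = x / 4 ^ k" for x :: real by simp_all
    show ?thesis by (rule S[OF p, unfolded e, symmetric])
  qed
  moreover have "- G 0 / 2 = real_of_int (\<Sum>r<nat N. int r * chi (int r)) / (2 * real_of_int N)"
    unfolding G0 using N_greater by simp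
  ultimately show ?thesis using A by (intro exI[of _ A]) (simp only:)
qed

text \<open>The two expansions of the same function along \<open>t = 4\<^sup>-\<^sup>k\<close> have the same leading coefficient,
  hence the same constant term.\<close>

theorem class_number_formula:
  "int (card ideal_classes) * N = - (\<Sum>r<nat N. int r * chi (int r))"
proof -
  define S where "S = (\<lambda>k. infsum (\<lambda>I. exp (- ideal_norm I / 4 ^ k)) {I. is_ideal I})"
  define s where "s = real_of_int (\<Sum>r<nat N. int r * chi (int r)) / (2 * real_of_int N)"
  define h where "h = real (card ideal_classes)"
  obtain A where A: "(\<lambda>k. S k - A * 4 ^ k) \<longlonglongrightarrow> - h / 2"
    using zeta_asymptotics_classes(2) unfolding S_def h_def by blast
  obtain A' where A': "(\<lambda>k. S k - A' * 4 ^ k) \<longlonglongrightarrow> s"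
    using zeta_asymptotics_character unfolding S_def s_def by blast
  have d: "(\<lambda>k. (A' - A) * 4 ^ k) \<longlonglongrightarrow> - h / 2 - s"
    using tendsto_diff[OF A A'] by (simp add: algebra_simps)
  have z: "(\<lambda>k. (1 / 4 :: real) ^ k) \<longlonglongrightarrow> 0" by (rule LIMSEQ_realpow_zero) auto
  have "(\<lambda>k. ((A' - A) * 4 ^ k) * (1 / 4) ^ k) \<longlonglongrightarrow> (- h / 2 - s) * 0" by (rule tendsto_mult[OF d z])
  moreover have "((A' - A) * 4 ^ k) * (1 / 4) ^ k = A' - A" for k by (simp add: power_divide)
  ultimately have "(\<lambda>k::nat. A' - A) \<longlonglongrightarrow> 0" by simp
  hence "A' - A = 0" using LIMSEQ_unique tendsto_const by blast
  hence "(\<lambda>k::nat. 0) \<longlonglongrightarrow> - h / 2 - s" using d by simp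
  hence "- h / 2 - s = 0" using LIMSEQ_unique tendsto_const by blast
  hence "h * real_of_int N = - real_of_int (\<Sum>r<nat N. int r * chi (int r))"
  proof -
    have "real_of_int N \<noteq> 0" using N_greater by simp
    moreover have "y / (2 * n) * (2 * n) = y" if "n \<noteq> 0" for y n :: real using that by simp
    ultimately have "s * (2 * real_of_int N) = real_of_int (\<Sum>r<nat N. int r * chi (int r))"
      unfolding s_def by (simp only: not_False_eq_True)
    moreover have "h = - 2 * s" using \<open>- h / 2 - s = 0\<close> by simp
    ultimately show ?thesis by simp
  qed
  hence "real_of_int (int (card ideal_classes) * N) = real_of_int (- (\<Sum>r<nat N. int r * chi (int r)))"
    unfolding h_def by simp
  then show ?thesis by (simp only: of_int_eq_iff)
qed

end

section \<open>Cycles and periodic expansions\<close>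

text \<open>A periodic expansion determines its block: the block is the base \<open>B\<close> representation of
  the integer \<open>(B\<^sup>e - 1) r\<close>.\<close>

definition base_value :: "int \<Rightarrow> int list \<Rightarrow> int" where
  "base_value B = foldl (\<lambda>v d. v * B + d) 0"

lemma base_value_inj:
  assumes "length as = length bs" "set as \<subseteq> {0..<B}" "set bs \<subseteq> {0..<B}" "base_value B as = base_value B bs"
  shows "as = bs"
  using assms
proof (induction as arbitrary: bs rule: rev_induct)
  case (snoc a as)
  then obtain b bs' where bs: "bs = bs' @ [b]" by (metis length_append_singleton length_0_conv nat.simps(3) rev_exhaust)
  have ab: "0 \<le> a" "a < B" "0 \<le> b" "b < B" using snoc.prems bs by auto
  have eq: "base_value B as * B + a = base_value B bs' * B + b" using snoc.prems(4) unfolding bs by (simp add: base_value_def)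
  have "a = (base_value B as * B + a) mod B" using ab by simp
  also have "\<dots> = b" unfolding eq using ab by simp
  finally have "a = b" .
  moreover have "base_value B as = base_value B bs'" using eq \<open>a = b\<close> ab by simp
  moreover have "length as = length bs'" "set as \<subseteq> {0..<B}" "set bs' \<subseteq> {0..<B}" using snoc.prems bs by auto
  ultimately show ?case using snoc.IH[of bs'] bs by simp
qed simp

lemma sum_eq_base_value:
  assumes B: "B > 0"
  shows "(\<Sum>i<length as. of_int (as ! i) / of_int B ^ Suc i) = (of_int (base_value B as) / of_int B ^ length as :: real)"
proof (induction as rule: rev_induct)
  case (snoc a as)
  have "(\<Sum>i<length (as @ [a]). of_int ((as @ [a]) ! i) / of_int B ^ Suc i)
      = (\<Sum>i<length as. of_int (as ! i) / of_int B ^ Suc i) + (of_int a / of_int B ^ Suc (length as) :: real)"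
    by (simp add: nth_append)
  also have "\<dots> = of_int (base_value B (as @ [a])) / of_int B ^ length (as @ [a])"
  proof -
    have "v / p + c / (b * p) = (v * b + c) / (b * p)" if "b \<noteq> 0" for v p b c :: real
      using that by (cases "p = 0") (simp_all add: add_divide_distrib)
    from this[of "of_int B"] show ?thesis
      unfolding snoc.IH using B by (simp add: base_value_def)
  qed
  finally show ?case .
qed (simp add: base_value_def)

lemma periodic_expansion_value:
  assumes B: "B > 1" and p: "periodic_expansion B as r"
  shows "of_int (base_value B as) = r * (of_int B ^ length as - 1)"
proof -
  let ?e = "length as"
  let ?f = "\<lambda>i. of_int (as ! (i mod ?e)) / of_int B ^ Suc i :: real"
  have e: "?e > 0" and s: "?f sums r" using p unfolding periodic_expansion_def by auto
  have "r = suminf (\<lambda>i. ?f (i + ?e)) + sum ?f {..<?e}"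
    using suminf_split_initial_segment[OF sums_summable[OF s], of ?e] sums_unique[OF s] by simp
  also have "suminf (\<lambda>i. ?f (i + ?e)) = suminf (\<lambda>i. (1 / of_int B ^ ?e) * ?f i)"
    by (simp add: power_add mult_ac)
  also have "\<dots> = r / of_int B ^ ?e"
    using suminf_mult[OF sums_summable[OF s], of "1 / of_int B ^ ?e"] sums_unique[OF s] by simp
  also have "sum ?f {..<?e} = of_int (base_value B as) / of_int B ^ ?e"
    using sum_eq_base_value[of B as] B by simp
  finally have "r = (r + of_int (base_value B as)) / of_int B ^ ?e" by (simp add: add_divide_distrib)
  moreover have "of_int B ^ ?e \<noteq> (0::real)" using B by simp
  ultimately have "r * of_int B ^ ?e = r + of_int (base_value B as)" by (metis nonzero_eq_divide_eq)
  then show ?thesis by (simp add: algebra_simps)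
qed

lemma periodic_expansion_unique:
  assumes "B > 1" "periodic_expansion B as r" "periodic_expansion B bs r" "length as = length bs"
  shows "as = bs"
proof (rule base_value_inj[OF assms(4)])
  have "real_of_int (base_value B as) = of_int (base_value B bs)"
    using periodic_expansion_value[OF assms(1,2)] periodic_expansion_value[OF assms(1,3)] assms(4) by simp
  then show "base_value B as = base_value B bs" by (simp only: of_int_eq_iff)
qed (use assms in \<open>auto simp: periodic_expansion_def\<close>)

locale base_cycles =
  fixes B N :: int
  assumes B: "B > 1" and N: "N > 1" and cop: "gcd B N = 1"
begin

abbreviation "period \<equiv> ord (nat N) (nat B)"
definition shift :: "int \<Rightarrow> int" where "shift x = (B * x) mod N"
definition digit :: "int \<Rightarrow> int" where "digit x = (B * x) div N"
definition cycle_from :: "int \<Rightarrow> int list" where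
  "cycle_from x = map (\<lambda>i. (shift ^^ i) x) [0..<period]"

lemma division: "B * x = digit x * N + shift x" by (simp add: digit_def shift_def)

lemma shift_eq: "(\<lambda>y. (B * y) mod N) = shift" by (simp add: shift_def fun_eq_iff)

lemma B_cycle_iff: "B_cycle B N c \<longleftrightarrow> (\<exists>x\<in>unit_residues N. c = cycle_from x)"
  unfolding B_cycle_def shift_eq cycle_from_def ..

lemma period_pos: "period > 0"
proof -
  have "coprime (int (nat N)) (int (nat B))"
    using cop B N by (simp add: coprime_iff_gcd_eq_1 gcd.commute)
  hence "coprime (nat N) (nat B)" by (simp only: coprime_int_iff)
  then show ?thesis by (simp add: coprime_ord)
qed

lemma power_cong_1: "[B ^ d = 1] (mod N) \<longleftrightarrow> period dvd d"
proof -
  have "[nat B ^ d = 1] (mod nat N) \<longleftrightarrow> [int (nat B ^ d) = int 1] (mod int (nat N))"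
    by (simp only: cong_int_iff)
  then show ?thesis using ord_divides[of "nat B" d "nat N"] B N by simp
qed

lemma unit_residues_bounds: "x \<in> unit_residues N \<Longrightarrow> 1 \<le> x \<and> x < N \<and> coprime x N"
  using N by (auto simp: unit_residues_def coprime_iff_gcd_eq_1 order.order_iff_strict)

lemma shift_funpow: "x \<in> unit_residues N \<Longrightarrow> (shift ^^ i) x = (B ^ i * x) mod N"
proof (induction i)
  case 0
  then show ?case using unit_residues_bounds[of x] by simp
next
  case (Suc i)
  then show ?case by (simp add: shift_def mod_mult_right_eq mult.assoc)
qed

lemma shift_unit: "x \<in> unit_residues N \<Longrightarrow> shift x \<in> unit_residues N"
proof -
  assume x: "x \<in> unit_residues N"
  have "coprime (B * x) N" using unit_residues_bounds[OF x] cop by (simp add: coprime_iff_gcd_eq_1[symmetric])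
  hence "gcd (shift x) N = 1" unfolding shift_def by (metis coprime_iff_gcd_eq_1 gcd.commute gcd_red_int)
  moreover have "0 \<le> shift x" "shift x < N" using N by (simp_all add: shift_def)
  moreover have "shift x \<noteq> 0" using calculation(1) N by auto
  ultimately show ?thesis unfolding unit_residues_def by simp
qed

lemma shift_funpow_unit: "x \<in> unit_residues N \<Longrightarrow> (shift ^^ i) x \<in> unit_residues N"
  by (induction i) (simp_all add: shift_unit)

lemma funpow_eq_iff:
  assumes x: "x \<in> unit_residues N" and ij: "i \<le> j"
  shows "(shift ^^ i) x = (shift ^^ j) x \<longleftrightarrow> period dvd j - i"
proof -
  have "(shift ^^ i) x = (shift ^^ j) x \<longleftrightarrow> [B ^ i * x = B ^ i * x * B ^ (j - i)] (mod N)"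
    unfolding shift_funpow[OF x] Cong.cong_def using ij by (simp add: mult_ac flip: power_add)
  also have "\<dots> \<longleftrightarrow> [B ^ i * x * 1 = B ^ i * x * B ^ (j - i)] (mod N)" by simp
  also have "\<dots> \<longleftrightarrow> [1 = B ^ (j - i)] (mod N)"
  proof (rule cong_mult_lcancel)
    show "coprime (B ^ i * x) N" using cop unit_residues_bounds[OF x] by (simp add: coprime_iff_gcd_eq_1[symmetric])
  qed
  also have "\<dots> \<longleftrightarrow> period dvd j - i" using power_cong_1[of "j - i"] cong_sym_eq by blast
  finally show ?thesis .
qed

lemma shift_inj_on: "inj_on shift (unit_residues N)"
proof (rule inj_onI)
  fix x y assume xy: "x \<in> unit_residues N" "y \<in> unit_residues N" "shift x = shift y"
  have "[B * x = B * y] (mod N)" using xy(3) unfolding shift_def Cong.cong_def .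
  hence "[x = y] (mod N)" using cong_mult_lcancel[of B N x y] cop by (simp add: coprime_iff_gcd_eq_1)
  then show "x = y" using unit_residues_bounds[OF xy(1)] unit_residues_bounds[OF xy(2)] by (simp add: Cong.cong_def)
qed

lemma finite_unit_residues: "finite (unit_residues N)"
  by (rule finite_subset[of _ "{1..N}"]) (auto simp: unit_residues_def)

lemma shift_bij: "bij_betw shift (unit_residues N) (unit_residues N)"
proof -
  have "shift ` unit_residues N = unit_residues N"
    by (rule endo_inj_surj[OF finite_unit_residues _ shift_inj_on]) (use shift_unit in blast)
  then show ?thesis using shift_inj_on by (simp add: bij_betw_def)
qed

lemma cycle_from_nth: "i < period \<Longrightarrow> cycle_from x ! i = (shift ^^ i) x"
  and length_cycle_from: "length (cycle_from x) = period"
  by (simp_all add: cycle_from_def)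

lemma rotate_cycle_from:
  assumes x: "x \<in> unit_residues N" shows "rotate k (cycle_from x) = cycle_from ((shift ^^ k) x)"
proof (rule nth_equalityI)
  fix i assume "i < length (rotate k (cycle_from x))"
  hence i: "i < period" by (simp add: length_cycle_from)
  have "rotate k (cycle_from x) ! i = cycle_from x ! ((k + i) mod period)"
    using i by (simp add: nth_rotate length_cycle_from)
  also have "\<dots> = (shift ^^ ((k + i) mod period)) x" using period_pos by (simp add: cycle_from_nth)
  also have "\<dots> = (shift ^^ (k + i)) x"
    using funpow_eq_iff[OF x, of "(k + i) mod period" "k + i"] by simp
  also have "\<dots> = (shift ^^ i) ((shift ^^ k) x)" by (simp only: add.commute[of k] funpow_add o_apply)
  finally show "rotate k (cycle_from x) ! i = cycle_from ((shift ^^ k) x) ! i" using i by (simp add: cycle_from_nth)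
qed (simp add: length_cycle_from)

lemma cycle_containing:
  assumes x: "x \<in> unit_residues N" and i: "i < period" and y: "y = (shift ^^ i) x"
  shows "cycle_from x = rotate (period - i) (cycle_from y)"
proof -
  have yX: "y \<in> unit_residues N" unfolding y by (rule shift_funpow_unit[OF x])
  have "(shift ^^ (period - i)) y = (shift ^^ period) x"
    unfolding y using i by (metis add.commute funpow_add le_add_diff_inverse2 less_imp_le_nat o_apply)
  also have "\<dots> = x" using funpow_eq_iff[OF x, of 0 period] by simp
  finally show ?thesis using rotate_cycle_from[OF yX, of "period - i"] by simp
qed

text \<open>A residue lies on the cycle that starts with it, hence on exactly one of the listed cycles;
  its position there is unique as the powers of \<open>B\<close> below the period are distinct modulo \<open>N\<close>.\<close>

lemma cycles_enumerate_residues: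
  assumes C: "lists_B_cycles B N f C"
  shows "bij_betw (\<lambda>(j, i). C j ! (i - 1)) ({1..f} \<times> {1..period}) (unit_residues N)"
proof -
  have start: "\<exists>x\<in>unit_residues N. C j = cycle_from x" if "j \<in> {1..f}" for j
    using C that unfolding lists_B_cycles_def B_cycle_iff by blast
  have unique: "\<exists>!j. j \<in> {1..f} \<and> (\<exists>k. C j = rotate k (cycle_from x))" if "x \<in> unit_residues N" for x
    using C that unfolding lists_B_cycles_def B_cycle_iff by blast
  show ?thesis
  proof (rule bij_betw_imageI)
    show "inj_on (\<lambda>(j, i). C j ! (i - 1)) ({1..f} \<times> {1..period})"
    proof (rule inj_onI)
      fix z z' assume zz: "z \<in> {1..f} \<times> {1..period}" "z' \<in> {1..f} \<times> {1..period}"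
        and eq: "(\<lambda>(j, i). C j ! (i - 1)) z = (\<lambda>(j, i). C j ! (i - 1)) z'"
      obtain j i j' i' where z: "z = (j, i)" "z' = (j', i')" by (metis surj_pair)
      have ji: "j \<in> {1..f}" "j' \<in> {1..f}" "1 \<le> i" "i \<le> period" "1 \<le> i'" "i' \<le> period" using zz unfolding z by auto
      obtain x where x: "x \<in> unit_residues N" "C j = cycle_from x" using start[OF ji(1)] by blast
      obtain x' where x': "x' \<in> unit_residues N" "C j' = cycle_from x'" using start[OF ji(2)] by blast
      define y where "y = (shift ^^ (i - 1)) x"
      have i1: "i - 1 < period" "i' - 1 < period" using ji by auto
      have y': "y = (shift ^^ (i' - 1)) x'"
      proof -
        have "C j ! (i - 1) = C j' ! (i' - 1)" using eq unfolding z by simp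
        then show ?thesis
          unfolding y_def x(2) x'(2) cycle_from_nth[OF i1(1)] cycle_from_nth[OF i1(2)] .
      qed
      have yX: "y \<in> unit_residues N" unfolding y_def by (rule shift_funpow_unit[OF x(1)])
      have "C j = rotate (period - (i - 1)) (cycle_from y)" unfolding x(2) by (rule cycle_containing[OF x(1) i1(1) y_def])
      moreover have "C j' = rotate (period - (i' - 1)) (cycle_from y)" unfolding x'(2) by (rule cycle_containing[OF x'(1) i1(2) y'])
      ultimately have j: "j = j'" using unique[OF yX] ji(1,2) by blast
      hence "x = x'"
        using x(2) x'(2) cycle_from_nth[OF period_pos, of x] cycle_from_nth[OF period_pos, of x'] by simp
      hence e: "(shift ^^ (i - 1)) x = (shift ^^ (i' - 1)) x" using y' y_def by simp
      have "a = b" if "a \<le> b" "b < period" "(shift ^^ a) x = (shift ^^ b) x" for a b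
      proof -
        have "period dvd b - a" using funpow_eq_iff[OF x(1) that(1)] that(3) by simp
        moreover have "b - a < period" using that(2) by simp
        ultimately show ?thesis using that(1) by (metis diff_is_0_eq dvd_imp_le le_antisym not_le gr0I)
      qed
      hence "i - 1 = i' - 1" using e i1 by (metis nat_le_linear)
      then show "z = z'" unfolding z using j ji by simp
    qed
    show "(\<lambda>(j, i). C j ! (i - 1)) ` ({1..f} \<times> {1..period}) = unit_residues N"
    proof (intro equalityI subsetI)
      fix y assume "y \<in> (\<lambda>(j, i). C j ! (i - 1)) ` ({1..f} \<times> {1..period})"
      then obtain j i where ji: "j \<in> {1..f}" "1 \<le> i" "i \<le> period" "y = C j ! (i - 1)" by auto
      obtain x where x: "x \<in> unit_residues N" "C j = cycle_from x" using start[OF ji(1)] by blast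
      have "y = (shift ^^ (i - 1)) x" unfolding ji(4) x(2) using ji by (intro cycle_from_nth) simp
      then show "y \<in> unit_residues N" using shift_funpow_unit[OF x(1)] by simp
    next
      fix x assume x: "x \<in> unit_residues N"
      obtain j k where jk: "j \<in> {1..f}" "C j = rotate k (cycle_from x)" using unique[OF x] by blast
      have "x = cycle_from x ! 0" using cycle_from_nth[OF period_pos, of x] by simp
      hence "x \<in> set (cycle_from x)" using period_pos length_cycle_from by (metis nth_mem)
      hence "x \<in> set (C j)" unfolding jk(2) by simp
      moreover have "length (C j) = period" unfolding jk(2) by (simp add: length_cycle_from)
      ultimately obtain i where i: "i < period" "x = C j ! i" by (metis in_set_conv_nth)
      have "(j, Suc i) \<in> {1..f} \<times> {1..period}" "x = (\<lambda>(j, i). C j ! (i - 1)) (j, Suc i)" using jk(1) i by auto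
      then show "x \<in> (\<lambda>(j, i). C j ! (i - 1)) ` ({1..f} \<times> {1..period})" by blast
    qed
  qed
qed

lemma digits_of_expansion:
  assumes c: "B_cycle B N c" and a: "length a = period" "periodic_expansion B a (of_int (c ! 0) / of_int N)"
  shows "a = map digit c"
proof (rule periodic_expansion_unique[OF B a(2)])
  show "periodic_expansion B (map digit c) (of_int (c ! 0) / of_int N)"
    using B_cycle_periodic_expansion[OF B N cop c] unfolding digit_def .
  show "length a = length (map digit c)" using a(1) c by (auto simp: B_cycle_iff length_cycle_from)
qed

lemma cycle_multiplicative:
  fixes g :: "int \<Rightarrow> int"
  assumes g: "\<And>x y. g (x * y) = g x * g y" "\<And>x. g (x mod N) = g x"
    and c: "B_cycle B N c" and i: "i < period"
  shows "g (c ! i) = g B ^ i * g (c ! 0)"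
proof -
  obtain x where x: "c = cycle_from x" using c unfolding B_cycle_iff by blast
  have "g ((shift ^^ i) x) = g B ^ i * g x" by (induction i) (simp_all add: shift_def g)
  then show ?thesis unfolding x using cycle_from_nth[OF i] cycle_from_nth[OF period_pos] by simp
qed

text \<open>Division with remainder, summed against a completely multiplicative function: as \<open>x\<close>
  runs through the residues, so do the remainders.\<close>

lemma sum_digits_character:
  fixes g :: "int \<Rightarrow> int"
  assumes g: "\<And>x y. g (x * y) = g x * g y" "\<And>x. g (x mod N) = g x" and gB: "g B * g B = 1"
  shows "N * (\<Sum>x\<in>unit_residues N. g x * digit x) = (B - g B) * (\<Sum>x\<in>unit_residues N. g x * x)"
proof -
  have gs: "g (shift x) = g B * g x" for x by (simp add: shift_def g)
  have "(\<Sum>x\<in>unit_residues N. g x * x) = (\<Sum>x\<in>unit_residues N. g (shift x) * shift x)"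
    by (rule sum.reindex_bij_betw[OF shift_bij, symmetric])
  also have "\<dots> = g B * (\<Sum>x\<in>unit_residues N. g x * shift x)"
    unfolding gs by (simp add: sum_distrib_left mult.assoc)
  finally have "g B * (\<Sum>x\<in>unit_residues N. g x * x) = (g B * g B) * (\<Sum>x\<in>unit_residues N. g x * shift x)"
    by simp
  hence 1: "g B * (\<Sum>x\<in>unit_residues N. g x * x) = (\<Sum>x\<in>unit_residues N. g x * shift x)" unfolding gB by simp
  have "N * (\<Sum>x\<in>unit_residues N. g x * digit x) = (\<Sum>x\<in>unit_residues N. g x * (B * x - shift x))"
    unfolding sum_distrib_left by (intro sum.cong refl) (simp add: division)
  also have "\<dots> = B * (\<Sum>x\<in>unit_residues N. g x * x) - (\<Sum>x\<in>unit_residues N. g x * shift x)"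
    by (simp add: sum_distrib_left sum_subtractf algebra_simps)
  finally show ?thesis unfolding 1[symmetric] by (simp add: algebra_simps)
qed

end

section \<open>Digit sums and the class number\<close>

lemma (in imaginary_quadratic) class_number_residues:
  "int (class_number (quadratic_field m)) * N = - (\<Sum>x\<in>unit_residues N. chi x * x)"
proof -
  have "(\<Sum>r<nat N. int r * chi (int r)) = (\<Sum>x\<in>{0..<N}. chi x * x)"
    by (rule sum.reindex_bij_witness[of _ nat int]) auto
  also have "\<dots> = (\<Sum>x\<in>unit_residues N. chi x * x)"
  proof (rule sum.mono_neutral_right)
    show "unit_residues N \<subseteq> {0..<N}"
      using N_greater by (auto simp: unit_residues_def order.order_iff_strict)
    show "\<forall>x\<in>{0..<N} - unit_residues N. chi x * x = 0"
    proof
      fix x assume x: "x \<in> {0..<N} - unit_residues N"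
      show "chi x * x = 0"
      proof (cases "x = 0")
        case False
        with x have "gcd x N \<noteq> 1" by (auto simp: unit_residues_def)
        hence "\<not> coprime x N" by (simp add: coprime_iff_gcd_eq_1)
        then show ?thesis by (simp add: chi_zero)
      qed simp
    qed
  qed simp
  finally show ?thesis using class_number_formula class_number_eq by simp
qed

text \<open>Along a cycle, \<open>\<chi> (x\<^sub>i) = \<chi> (B)\<^sup>i\<^sup>-\<^sup>1 \<chi> (x\<^sub>1)\<close>. So under either hypothesis the sum on the right is,
  up to sign, the sum of \<open>\<chi> (x)\<close> times the first digit of \<open>x / N\<close> over all residues \<open>x\<close>.\<close>

theorem theorem2p2:
  fixes m D N B :: int and e f :: nat and C a :: "nat \<Rightarrow> int list"
    and chi :: "int \<Rightarrow> int" and h :: int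
  assumes "m < 0" and "squarefree m"
    and "D = quadratic_discriminant m" and "D < -4"
    and "N = \<bar>D\<bar>"
    and "chi = quadratic_character m"
    and "h = int (class_number (quadratic_field m))"
    and "B > 1" and "gcd B N = 1"
    and "e = ord (nat N) (nat B)"
    and "f = totient (nat N) div e"
    and "lists_B_cycles B N f C"
    and "\<And>j. j \<in> {1..f} \<Longrightarrow> length (a j) = e"
    and "\<And>j. j \<in> {1..f} \<Longrightarrow> periodic_expansion B (a j) (of_int (C j ! 0) / of_int N)"
  shows "(chi B = -1 \<and> (\<forall>j\<in>{1..f}. chi (C j ! 0) = 1) \<longrightarrow>
            (B + 1) * h = (\<Sum>j=1..f. \<Sum>i=1..e. (-1) ^ i * a j ! (i - 1))) \<and>
         (chi B = 1 \<longrightarrow>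
            (B - 1) * h = - (\<Sum>j=1..f. common_value chi (C j) * (\<Sum>i=1..e. a j ! (i - 1))))"
proof -
  note C = \<open>lists_B_cycles B N f C\<close>
  have "imaginary_quadratic m" using assms(1,2,4) unfolding assms(3) by (rule imaginary_quadratic.intro)
  then interpret Q: imaginary_quadratic m .
  have N: "N = \<bar>quadratic_discriminant m\<bar>" unfolding assms(5,3) ..
  have "N > 1" unfolding N using Q.N_greater by linarith
  with assms(8) have "base_cycles B N" using assms(9) by (rule base_cycles.intro)
  then interpret cyc: base_cycles B N .
  have e: "e = cyc.period" by fact
  have chi: "chi (x * y) = chi x * chi y" "chi (x mod N) = chi x" for x y
    unfolding assms(6) N by (rule Q.chi_mult, rule Q.chi_mod)
  have h: "h * N = - (\<Sum>x\<in>unit_residues N. chi x * x)"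
    unfolding assms(6,7) N by (rule Q.class_number_residues)
  have Bc: "B_cycle B N (C j)" if "j \<in> {1..f}" for j
    using C that unfolding lists_B_cycles_def by blast
  have digits: "a j ! (i - 1) = cyc.digit (C j ! (i - 1))" if j: "j \<in> {1..f}" and i: "i \<in> {1..e}" for j i
  proof -
    have l: "length (a j) = e" and p: "periodic_expansion B (a j) (of_int (C j ! 0) / of_int N)"
      using assms(13,14) j by blast+
    have aj: "a j = map cyc.digit (C j)" by (rule cyc.digits_of_expansion[OF Bc[OF j] l[unfolded e] p])
    hence "i - 1 < length (C j)" using l i by auto
    then show ?thesis unfolding aj by (rule nth_map)
  qed
  have chi_term: "chi (C j ! (i - 1)) = chi B ^ (i - 1) * chi (C j ! 0)" if j: "j \<in> {1..f}" and i: "i \<in> {1..e}" for j i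
    by (rule cyc.cycle_multiplicative[OF chi Bc[OF j]]) (use i e in auto)
  have all: "(\<Sum>j=1..f. \<Sum>i=1..e. chi (C j ! (i - 1)) * a j ! (i - 1)) = (\<Sum>x\<in>unit_residues N. chi x * cyc.digit x)"
  proof -
    have "(\<Sum>j=1..f. \<Sum>i=1..e. chi (C j ! (i - 1)) * a j ! (i - 1))
        = (\<Sum>j=1..f. \<Sum>i=1..e. chi (C j ! (i - 1)) * cyc.digit (C j ! (i - 1)))"
      by (intro sum.cong refl) (simp only: digits)
    also have "\<dots> = (\<Sum>z\<in>{1..f} \<times> {1..e}. (\<lambda>x. chi x * cyc.digit x) ((\<lambda>(j, i). C j ! (i - 1)) z))"
      unfolding sum.cartesian_product case_prod_unfold ..
    also have "\<dots> = (\<Sum>x\<in>unit_residues N. chi x * cyc.digit x)"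
      unfolding e by (rule sum.reindex_bij_betw[OF cyc.cycles_enumerate_residues[OF C], of "\<lambda>x. chi x * cyc.digit x"])
    finally show ?thesis .
  qed
  have main: "(\<Sum>j=1..f. \<Sum>i=1..e. chi (C j ! (i - 1)) * a j ! (i - 1)) = - ((B - chi B) * h)"
    if B2: "chi B * chi B = 1"
  proof -
    have "N * (\<Sum>x\<in>unit_residues N. chi x * cyc.digit x) = N * (- ((B - chi B) * h))"
    proof -
      have s: "(\<Sum>x\<in>unit_residues N. chi x * x) = - (h * N)" using h by simp
      show ?thesis unfolding cyc.sum_digits_character[OF chi B2] s by (simp add: mult_ac)
    qed
    moreover have "N \<noteq> 0" using cyc.N by linarith
    ultimately show ?thesis unfolding all using mult_left_cancel by blast
  qed
  show ?thesis
  proof (intro conjI impI)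
    assume n: "chi B = -1 \<and> (\<forall>j\<in>{1..f}. chi (C j ! 0) = 1)"
    have "(\<Sum>j=1..f. \<Sum>i=1..e. chi (C j ! (i - 1)) * a j ! (i - 1))
        = (\<Sum>j=1..f. \<Sum>i=1..e. - ((-1) ^ i * a j ! (i - 1)))"
    proof (intro sum.cong refl)
      fix j i assume ji: "j \<in> {1..f}" "i \<in> {1..e}"
      have "chi (C j ! 0) = 1" "chi B = -1" using n ji(1) by blast+
      hence "chi (C j ! (i - 1)) = (-1) ^ (i - 1)" using chi_term[OF ji] by (simp only: mult_1_right)
      also have "\<dots> = - ((-1) ^ i)" using ji(2) by (cases i) simp_all
      finally show "chi (C j ! (i - 1)) * a j ! (i - 1) = - ((-1) ^ i * a j ! (i - 1))" by simp
    qed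
    moreover have nB: "chi B = -1" using n by blast
    have "(\<Sum>j=1..f. \<Sum>i=1..e. chi (C j ! (i - 1)) * a j ! (i - 1)) = - ((B - chi B) * h)"
      by (rule main) (simp add: nB)
    ultimately have "- ((B - -1) * h) = - (\<Sum>j=1..f. \<Sum>i=1..e. (-1) ^ i * a j ! (i - 1))"
      unfolding nB by (simp only: sum_negf)
    then show "(B + 1) * h = (\<Sum>j=1..f. \<Sum>i=1..e. (-1) ^ i * a j ! (i - 1))"
      by (simp only: neg_equal_iff_equal diff_minus_eq_add)
  next
    assume p: "chi B = 1"
    have "common_value chi (C j) * (\<Sum>i=1..e. a j ! (i - 1)) = (\<Sum>i=1..e. chi (C j ! (i - 1)) * a j ! (i - 1))"
      if j: "j \<in> {1..f}" for j
    proof -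
      have c: "chi (C j ! (i - 1)) = chi (C j ! 0)" if "i \<in> {1..e}" for i
        using chi_term[OF j that] unfolding p by (simp only: power_one mult_1)
      have len: "length (C j) = e" using Bc[OF j] e unfolding cyc.B_cycle_iff by (auto simp: cyc.length_cycle_from)
      have const: "\<forall>x\<in>set (C j). chi x = chi (C j ! 0)"
      proof
        fix x assume "x \<in> set (C j)"
        then obtain i where "i < e" "x = C j ! i" using len by (metis in_set_conv_nth)
        moreover have "Suc i \<in> {1..e}" using \<open>i < e\<close> by simp
        ultimately show "chi x = chi (C j ! 0)" using c[of "Suc i"] diff_Suc_1[of i] by metis
      qed
      have mem: "C j ! 0 \<in> set (C j)" using len e cyc.period_pos by (intro nth_mem) simp
      have "common_value chi (C j) = chi (C j ! 0)"
        unfolding common_value_def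
      proof (rule the_equality)
        show "\<forall>x\<in>set (C j). chi x = chi (C j ! 0)" by (rule const)
        fix v assume "\<forall>x\<in>set (C j). chi x = v"
        from bspec[OF this mem] show "v = chi (C j ! 0)" by (rule sym)
      qed
      then have "common_value chi (C j) * (\<Sum>i=1..e. a j ! (i - 1)) = (\<Sum>i=1..e. chi (C j ! 0) * a j ! (i - 1))"
        by (simp only: sum_distrib_left)
      also have "\<dots> = (\<Sum>i=1..e. chi (C j ! (i - 1)) * a j ! (i - 1))"
        by (intro sum.cong refl) (simp only: c)
      finally show ?thesis .
    qed
    hence "(\<Sum>j=1..f. common_value chi (C j) * (\<Sum>i=1..e. a j ! (i - 1)))
        = (\<Sum>j=1..f. \<Sum>i=1..e. chi (C j ! (i - 1)) * a j ! (i - 1))" by (intro sum.cong refl)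
    moreover have "(\<Sum>j=1..f. \<Sum>i=1..e. chi (C j ! (i - 1)) * a j ! (i - 1)) = - ((B - chi B) * h)"
      by (rule main) (simp add: p)
    ultimately show "(B - 1) * h = - (\<Sum>j=1..f. common_value chi (C j) * (\<Sum>i=1..e. a j ! (i - 1)))"
      unfolding p by (simp only: minus_minus)
  qed
qed

end
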